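(* Let $0<c<d$, $p,q:[c,d]\to[0,\infty)$ bounded measurable, and $B_1,B_2:\mathbb R\times C([c,d])\to\mathbb R$. Consider problem (PP): $V''(x)+H(x,V(x),V'(x))=0$ for a.e. $x\in[c,d]$, $B_1(V(c),V)=0$, $B_2(V(d),V)=0$. Assume there exist a lower solution $\alpha$ and an upper solution $\beta$ of (PP) with $\alpha(x)\le\beta(x)$ for all $x\in[c,d]$. Let $[\alpha,\beta]=\{\gamma\in AC([c,d]):\alpha\le\gamma\le\beta\}$ and $E=[\min_{[c,d]}\alpha,\max_{[c,d]}\beta]$, and assume: (H1) for all $\gamma\in[\alpha,\beta]$, all $y\in E$ and $i=1,2$: $\liminf_{z\to y^-}B_i(z,\gamma)\ge B_i(y,\gamma)\ge\limsup_{z\to y^+}B_i(z,\gamma)$; (H2) for all $y\in E$ and $i=1,2$, $B_i(y,\cdot)$ is nonincreasing on $[\alpha,\beta]$: if $\gamma_1,\gamma_2\in[\alpha,\beta]$ and $\gamma_1\le\gamma_2$ on $[c,d]$, then $B_i(y,\gamma_1)\ge B_i(y,\gamma_2)$. Then (PP) has extremal convex solutions in $[\alpha,\beta]$: there exist convex solutions $V_*,V^*\in[\alpha,\beta]$ of (PP) such that every solution $V\in[\alpha,\beta]$ of (PP) satisfies $V_*\le V\le V^*$ on $[c,d]$.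
   Context: $H(x,y,z)=\frac{p(x)x^2-\sqrt{p(x)^2x^4+4x^3q(x)|xz-y|}}{2x^3}$. A solution of (PP) is a $V\in C^1([c,d])$ with $V'$ absolutely continuous satisfying the equation a.e. and both boundary conditions. Dini derivatives: $D^+\gamma(x_0)=\limsup_{h\to0^+}\frac{\gamma(x_0+h)-\gamma(x_0)}{h}$, $D_+\gamma(x_0)=\liminf_{h\to0^+}(\cdot)$, $D^-\gamma(x_0)=\limsup_{h\to0^-}(\cdot)$, $D_-\gamma(x_0)=\liminf_{h\to0^-}(\cdot)$. A lower solution of (PP) is $\alpha\in AC([c,d])$ with $B_1(\alpha(c),\alpha)\le0$, $B_2(\alpha(d),\alpha)\le0$, and such that for each $x_0\in(c,d)$ either $D_-\alpha(x_0)<D^+\alpha(x_0)$, or there is an open interval $J_0$ with $x_0\in J_0\subset(c,d)$, $\alpha|_{J_0}\in W^{2,1}(J_0)$ and $\alpha''(x)+H(x,\alpha(x),\alpha'(x))\ge0$ for a.e. $x\in J_0$. An upper solution of (PP) is $\beta\in AC([c,d])$ with $B_1(\beta(c),\beta)\ge0$, $B_2(\beta(d),\beta)\ge0$, and such that for each $x_0\in(c,d)$ either $D^-\beta(x_0)>D_+\beta(x_0)$, or there is an open interval $J_0$ with $x_0\in J_0\subset(c,d)$, $\beta|_{J_0}\in W^{2,1}(J_0)$ and $\beta''(x)+H(x,\beta(x),\beta'(x))\le0$ for a.e. $x\in J_0$. *)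

theory Defs
  imports "HOL-Analysis.Analysis"
begin

definition Hfun :: "(real \<Rightarrow> real) \<Rightarrow> (real \<Rightarrow> real) \<Rightarrow> real \<Rightarrow> real \<Rightarrow> real \<Rightarrow> real" where
  "Hfun p q x y z =
     (p x * x^2 - sqrt ((p x)^2 * x^4 + 4 * x^3 * q x * \<bar>x * z - y\<bar>)) / (2 * x^3)"

definition abs_cont_on :: "real set \<Rightarrow> (real \<Rightarrow> real) \<Rightarrow> bool" where
  "abs_cont_on S f \<longleftrightarrow>
     (\<forall>\<epsilon>>0. \<exists>\<delta>>0. \<forall>(n::nat) (a::nat \<Rightarrow> real) (b::nat \<Rightarrow> real).
        (\<forall>i<n. a i \<le> b i \<and> {a i..b i} \<subseteq> S) \<and>
        (\<forall>i<n. \<forall>j<n. i \<noteq> j \<longrightarrow> b i \<le> a j \<or> b j \<le> a i) \<and>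
        (\<Sum>i<n. b i - a i) < \<delta>
        \<longrightarrow> (\<Sum>i<n. \<bar>f (b i) - f (a i)\<bar>) < \<epsilon>)"

text \<open>Membership in W^{2,1}(J) for a bounded open interval J (one-dimensional
  characterisation): f is differentiable on J and its derivative is absolutely
  continuous on J.\<close>
definition W21_on :: "real set \<Rightarrow> (real \<Rightarrow> real) \<Rightarrow> bool" where
  "W21_on J f \<longleftrightarrow>
     (\<exists>f'. (\<forall>x\<in>J. (f has_real_derivative f' x) (at x)) \<and> abs_cont_on J f')"

definition Dini_upper_right :: "(real \<Rightarrow> real) \<Rightarrow> real \<Rightarrow> ereal" where
  "Dini_upper_right g x0 = Limsup (at_right 0) (\<lambda>h. ereal ((g (x0 + h) - g x0) / h))"
definition Dini_lower_right :: "(real \<Rightarrow> real) \<Rightarrow> real \<Rightarrow> ereal" where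
  "Dini_lower_right g x0 = Liminf (at_right 0) (\<lambda>h. ereal ((g (x0 + h) - g x0) / h))"
definition Dini_upper_left :: "(real \<Rightarrow> real) \<Rightarrow> real \<Rightarrow> ereal" where
  "Dini_upper_left g x0 = Limsup (at_left 0) (\<lambda>h. ereal ((g (x0 + h) - g x0) / h))"
definition Dini_lower_left :: "(real \<Rightarrow> real) \<Rightarrow> real \<Rightarrow> ereal" where
  "Dini_lower_left g x0 = Liminf (at_left 0) (\<lambda>h. ereal ((g (x0 + h) - g x0) / h))"

definition PP_solution ::
  "(real \<Rightarrow> real) \<Rightarrow> (real \<Rightarrow> real) \<Rightarrow> (real \<Rightarrow> (real \<Rightarrow> real) \<Rightarrow> real) \<Rightarrow>
   (real \<Rightarrow> (real \<Rightarrow> real) \<Rightarrow> real) \<Rightarrow> real \<Rightarrow> real \<Rightarrow> (real \<Rightarrow> real) \<Rightarrow> bool" where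
  "PP_solution p q B1 B2 c d V \<longleftrightarrow>
     (\<exists>V'. (\<forall>x\<in>{c..d}. (V has_real_derivative V' x) (at x within {c..d})) \<and>
           continuous_on {c..d} V' \<and> abs_cont_on {c..d} V' \<and>
           (AE x in lebesgue. x \<in> {c..d} \<longrightarrow>
              (\<exists>V''. (V' has_real_derivative V'') (at x within {c..d}) \<and>
                     V'' + Hfun p q x (V x) (V' x) = 0))) \<and>
     B1 (V c) V = 0 \<and> B2 (V d) V = 0"

definition PP_lower ::
  "(real \<Rightarrow> real) \<Rightarrow> (real \<Rightarrow> real) \<Rightarrow> (real \<Rightarrow> (real \<Rightarrow> real) \<Rightarrow> real) \<Rightarrow>
   (real \<Rightarrow> (real \<Rightarrow> real) \<Rightarrow> real) \<Rightarrow> real \<Rightarrow> real \<Rightarrow> (real \<Rightarrow> real) \<Rightarrow> bool" where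
  "PP_lower p q B1 B2 c d \<alpha> \<longleftrightarrow>
     abs_cont_on {c..d} \<alpha> \<and> B1 (\<alpha> c) \<alpha> \<le> 0 \<and> B2 (\<alpha> d) \<alpha> \<le> 0 \<and>
     (\<forall>x0\<in>{c<..<d}.
        Dini_lower_left \<alpha> x0 < Dini_upper_right \<alpha> x0 \<or>
        (\<exists>a b. a < x0 \<and> x0 < b \<and> {a<..<b} \<subseteq> {c<..<d} \<and> W21_on {a<..<b} \<alpha> \<and>
           (AE x in lebesgue. x \<in> {a<..<b} \<longrightarrow>
              (\<exists>a''. (deriv \<alpha> has_real_derivative a'') (at x) \<and>
                     a'' + Hfun p q x (\<alpha> x) (deriv \<alpha> x) \<ge> 0))))"

definition PP_upper ::
  "(real \<Rightarrow> real) \<Rightarrow> (real \<Rightarrow> real) \<Rightarrow> (real \<Rightarrow> (real \<Rightarrow> real) \<Rightarrow> real) \<Rightarrow>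
   (real \<Rightarrow> (real \<Rightarrow> real) \<Rightarrow> real) \<Rightarrow> real \<Rightarrow> real \<Rightarrow> (real \<Rightarrow> real) \<Rightarrow> bool" where
  "PP_upper p q B1 B2 c d \<beta> \<longleftrightarrow>
     abs_cont_on {c..d} \<beta> \<and> B1 (\<beta> c) \<beta> \<ge> 0 \<and> B2 (\<beta> d) \<beta> \<ge> 0 \<and>
     (\<forall>x0\<in>{c<..<d}.
        Dini_upper_left \<beta> x0 > Dini_lower_right \<beta> x0 \<or>
        (\<exists>a b. a < x0 \<and> x0 < b \<and> {a<..<b} \<subseteq> {c<..<d} \<and> W21_on {a<..<b} \<beta> \<and>
           (AE x in lebesgue. x \<in> {a<..<b} \<longrightarrow>
              (\<exists>b''. (deriv \<beta> has_real_derivative b'') (at x) \<and>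
                     b'' + Hfun p q x (\<beta> x) (deriv \<beta> x) \<le> 0))))"

definition order_interval ::
  "real \<Rightarrow> real \<Rightarrow> (real \<Rightarrow> real) \<Rightarrow> (real \<Rightarrow> real) \<Rightarrow> (real \<Rightarrow> real) set" where
  "order_interval c d \<alpha> \<beta> =
     {\<gamma>. abs_cont_on {c..d} \<gamma> \<and> (\<forall>x\<in>{c..d}. \<alpha> x \<le> \<gamma> x \<and> \<gamma> x \<le> \<beta> x)}"

end

theory Submission
  imports Defs "HOL-Complex_Analysis.Great_Picard"
begin

text \<open>Write the equation as \<open>V'' = f x V V'\<close> with \<open>f = - H \<ge> 0\<close>; the function \<open>f\<close> is Hoelder
  continuous of exponent 1/2 in \<open>(V, V')\<close> uniformly in \<open>x\<close> and vanishes at \<open>V = V' = 0\<close>, so it grows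
  sublinearly.

  Truncating \<open>f\<close> between a lower and an upper solution gives a bounded Caratheodory right-hand side,
  for which the Dirichlet problem is solved by shooting on equations with a retarded argument and
  letting the delay tend to zero. Sublinear growth bounds \<open>V'\<close> a priori, and a maximum principle
  shows that the solution stays between the lower and the upper solution.

  The greatest solution is obtained by a Perron argument. In the set of solutions \<open>V \<in> [\<alpha>, \<beta>]\<close> of the
  equation with \<open>B\<^sub>1 (V c) V \<le> 0\<close> and \<open>B\<^sub>2 (V d) V \<le> 0\<close>, two elements have a common upper bound (solve
  the Dirichlet problem above their maximum), which produces a greatest element; by (H1) and (H2)
  a negative boundary expression would permit raising a boundary value, so both vanish.
  The least solution follows from the symmetry \<open>V \<mapsto> - V\<close>, and \<open>f \<ge> 0\<close> gives convexity.\<close>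

section \<open>Absolutely continuous functions\<close>

text \<open>With \<open>p\<close> and \<open>q\<close> only measurable the equation holds almost
  everywhere, so every passage between \<open>V'\<close> and its derivative relies on absolute
  continuity: monotonicity from an almost everywhere sign, and recovery of \<open>V'\<close> as an
  integral. The modulus |x z - y| under the root makes \<open>f\<close> merely Hoelder where
  \<open>p\<close> vanishes, so initial value problems may have several solutions and need not
  define a shooting map. Since \<open>f\<close> is not monotone in \<open>y\<close>, the equation
  alone gives no maximum principle; the truncation therefore carries a penalty of strict sign
  outside [\<alpha>, \<beta>]. Finally, the maximum of two solutions may have corners whose left
  slope is below the right slope. No differentiable function touches such a corner from above, which
  is why lower solutions are tested only at touching points.\<close>

definition short_intervals :: "real set \<Rightarrow> real \<Rightarrow> nat \<Rightarrow> (nat \<Rightarrow> real) \<Rightarrow> (nat \<Rightarrow> real) \<Rightarrow> bool" where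
  "short_intervals S \<delta> n a b \<longleftrightarrow>
     (\<forall>i<n. a i \<le> b i \<and> {a i..b i} \<subseteq> S) \<and>
     (\<forall>i<n. \<forall>j<n. i \<noteq> j \<longrightarrow> b i \<le> a j \<or> b j \<le> a i) \<and>
     (\<Sum>i<n. b i - a i) < \<delta>"

lemma short_intervals_mem:
  assumes "short_intervals S \<delta> n a b" "i < n"
  shows "a i \<in> S" "b i \<in> S" "a i \<le> b i"
  using assms by (auto simp: short_intervals_def subset_eq)

lemma short_intervals_mono:
  "\<lbrakk>short_intervals S \<delta> n a b; S \<subseteq> T; \<delta> \<le> \<delta>'\<rbrakk> \<Longrightarrow> short_intervals T \<delta>' n a b"
  unfolding short_intervals_def by (auto simp: subset_eq)

lemma abs_cont_on_iff:
  "abs_cont_on S f \<longleftrightarrow> (\<forall>\<epsilon>>0. \<exists>\<delta>>0. \<forall>n a b. short_intervals S \<delta> n a b \<longrightarrow>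
     (\<Sum>i<n. \<bar>f (b i) - f (a i)\<bar>) < \<epsilon>)"
  unfolding abs_cont_on_def short_intervals_def ..

lemma abs_cont_onE:
  assumes "abs_cont_on S f" "\<epsilon> > 0"
  obtains \<delta> where "\<delta> > 0" "\<And>n a b. short_intervals S \<delta> n a b \<Longrightarrow> (\<Sum>i<n. \<bar>f (b i) - f (a i)\<bar>) < \<epsilon>"
  using assms unfolding abs_cont_on_iff by metis

lemma abs_cont_onI:
  assumes "\<And>\<epsilon>. \<epsilon> > 0 \<Longrightarrow> \<exists>\<delta>>0. \<forall>n a b. short_intervals S \<delta> n a b \<longrightarrow>
     (\<Sum>i<n. \<bar>f (b i) - f (a i)\<bar>) < \<epsilon>"
  shows "abs_cont_on S f"
  using assms unfolding abs_cont_on_iff by blast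

text \<open>Tagged divisions come as finite sets of pairs, whereas \<open>abs_cont_on\<close>
  numbers its intervals; an enumeration of the index set carries one form over to the other.\<close>

lemma short_intervals_finite_family:
  fixes I :: "'i set" and a b :: "'i \<Rightarrow> real"
  assumes fin: "finite I" and sub: "\<And>i. i \<in> I \<Longrightarrow> a i \<le> b i \<and> {a i..b i} \<subseteq> S"
    and dis: "\<And>i j. \<lbrakk>i \<in> I; j \<in> I; i \<noteq> j\<rbrakk> \<Longrightarrow> b i \<le> a j \<or> b j \<le> a i"
    and len: "(\<Sum>i\<in>I. b i - a i) < \<delta>"
  obtains h n where "bij_betw h {..<n} I" "short_intervals S \<delta> n (a \<circ> h) (b \<circ> h)"
proof -
  obtain h where h: "bij_betw h {..<card I} I"
    using ex_bij_betw_nat_finite[OF fin] by (metis atLeast0LessThan)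
  have hI: "h i \<in> I" if "i < card I" for i
    using h that by (auto simp: bij_betw_def)
  have ne: "h i \<noteq> h j" if "i < card I" "j < card I" "i \<noteq> j" for i j
    using h that by (auto simp: bij_betw_def inj_on_def)
  have "(\<Sum>i<card I. b (h i) - a (h i)) < \<delta>"
    using sum.reindex_bij_betw[OF h, of "\<lambda>i. b i - a i"] len by simp
  then have "short_intervals S \<delta> (card I) (a \<circ> h) (b \<circ> h)"
    unfolding short_intervals_def o_def using sub hI dis ne by simp
  with h show thesis
    by (rule that)
qed

lemma abs_cont_on_subset:
  assumes "abs_cont_on S f" "T \<subseteq> S"
  shows "abs_cont_on T f"
proof (rule abs_cont_onI)
  fix \<epsilon> :: real
  assume "\<epsilon> > 0"
  then show "\<exists>\<delta>>0. \<forall>n a b. short_intervals T \<delta> n a b \<longrightarrow> (\<Sum>i<n. \<bar>f (b i) - f (a i)\<bar>) < \<epsilon>"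
    using abs_cont_onE[OF assms(1)] short_intervals_mono[OF _ assms(2) order_refl] by metis
qed

lemma abs_cont_on_cong:
  assumes "abs_cont_on S f" "\<And>x. x \<in> S \<Longrightarrow> f x = g x"
  shows "abs_cont_on S g"
proof (rule abs_cont_onI)
  fix \<epsilon> :: real
  assume "\<epsilon> > 0"
  then obtain \<delta> where d: "\<delta> > 0"
    "\<And>n a b. short_intervals S \<delta> n a b \<Longrightarrow> (\<Sum>i<n. \<bar>f (b i) - f (a i)\<bar>) < \<epsilon>"
    using abs_cont_onE[OF assms(1)] by metis
  have "(\<Sum>i<n. \<bar>g (b i) - g (a i)\<bar>) < \<epsilon>" if "short_intervals S \<delta> n a b" for n a b
  proof -
    have "(\<Sum>i<n. \<bar>g (b i) - g (a i)\<bar>) = (\<Sum>i<n. \<bar>f (b i) - f (a i)\<bar>)"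
      using short_intervals_mem[OF that] by (intro sum.cong) (auto simp: assms(2))
    with d(2)[OF that] show ?thesis
      by simp
  qed
  with d(1) show "\<exists>\<delta>>0. \<forall>n a b. short_intervals S \<delta> n a b \<longrightarrow> (\<Sum>i<n. \<bar>g (b i) - g (a i)\<bar>) < \<epsilon>"
    by blast
qed

lemma abs_cont_on_lipschitz:
  assumes "\<And>x y. \<lbrakk>x \<in> S; y \<in> S\<rbrakk> \<Longrightarrow> \<bar>f x - f y\<bar> \<le> L * \<bar>x - y\<bar>"
  shows "abs_cont_on S f"
proof (rule abs_cont_onI)
  fix \<epsilon> :: real
  assume "\<epsilon> > 0"
  \<comment> \<open>\<open>L\<close> may be zero or negative; the shift makes \<open>M\<close> a
    positive divisor of \<open>\<epsilon>\<close>.\<close>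
  define M where "M = \<bar>L\<bar> + 1"
  have "M > 0"
    by (simp add: M_def)
  have "(\<Sum>i<n. \<bar>f (b i) - f (a i)\<bar>) < \<epsilon>" if sh: "short_intervals S (\<epsilon> / M) n a b" for n a b
  proof -
    have "\<bar>f (b i) - f (a i)\<bar> \<le> M * (b i - a i)" if "i < n" for i
    proof -
      have "\<bar>f (b i) - f (a i)\<bar> \<le> L * \<bar>b i - a i\<bar>"
        using assms short_intervals_mem[OF sh that] by blast
      also have "\<dots> \<le> M * \<bar>b i - a i\<bar>"
        by (intro mult_right_mono) (auto simp: M_def)
      finally show ?thesis
        using short_intervals_mem[OF sh that] by simp
    qed
    then have "(\<Sum>i<n. \<bar>f (b i) - f (a i)\<bar>) \<le> M * (\<Sum>i<n. b i - a i)"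
      unfolding sum_distrib_left by (intro sum_mono) auto
    also have "\<dots> < M * (\<epsilon> / M)"
      using sh \<open>M > 0\<close> by (intro mult_strict_left_mono) (auto simp: short_intervals_def)
    finally show ?thesis
      using \<open>M > 0\<close> by simp
  qed
  moreover have "\<epsilon> / M > 0"
    using \<open>\<epsilon> > 0\<close> \<open>M > 0\<close> by simp
  ultimately show "\<exists>\<delta>>0. \<forall>n a b. short_intervals S \<delta> n a b \<longrightarrow> (\<Sum>i<n. \<bar>f (b i) - f (a i)\<bar>) < \<epsilon>"
    by blast
qed

lemma abs_cont_on_linear: "abs_cont_on S (\<lambda>x. k * x)"
proof (rule abs_cont_on_lipschitz)
  show "\<bar>k * x - k * y\<bar> \<le> \<bar>k\<bar> * \<bar>x - y\<bar>" for x y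
    by (metis abs_mult order_refl right_diff_distrib)
qed

text \<open>Sums and pointwise maxima both have increments bounded in this way, so one estimate
  serves both.\<close>

lemma abs_cont_on_dominated:
  assumes f: "abs_cont_on S f" and g: "abs_cont_on S g"
    and h: "\<And>x y. \<lbrakk>x \<in> S; y \<in> S\<rbrakk> \<Longrightarrow> \<bar>h x - h y\<bar> \<le> \<bar>f x - f y\<bar> + \<bar>g x - g y\<bar>"
  shows "abs_cont_on S h"
proof (rule abs_cont_onI)
  fix \<epsilon> :: real
  assume "\<epsilon> > 0"
  then have e2: "\<epsilon> / 2 > 0"
    by simp
  obtain \<delta>1 where d1: "\<delta>1 > 0"
    "\<And>n a b. short_intervals S \<delta>1 n a b \<Longrightarrow> (\<Sum>i<n. \<bar>f (b i) - f (a i)\<bar>) < \<epsilon> / 2"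
    using abs_cont_onE[OF f e2] by metis
  obtain \<delta>2 where d2: "\<delta>2 > 0"
    "\<And>n a b. short_intervals S \<delta>2 n a b \<Longrightarrow> (\<Sum>i<n. \<bar>g (b i) - g (a i)\<bar>) < \<epsilon> / 2"
    using abs_cont_onE[OF g e2] by metis
  have "(\<Sum>i<n. \<bar>h (b i) - h (a i)\<bar>) < \<epsilon>"
    if sh: "short_intervals S (min \<delta>1 \<delta>2) n a b" for n a b
  proof -
    have "(\<Sum>i<n. \<bar>h (b i) - h (a i)\<bar>) \<le> (\<Sum>i<n. \<bar>f (b i) - f (a i)\<bar> + \<bar>g (b i) - g (a i)\<bar>)"
      using short_intervals_mem[OF sh] by (intro sum_mono h) auto
    also have "\<dots> = (\<Sum>i<n. \<bar>f (b i) - f (a i)\<bar>) + (\<Sum>i<n. \<bar>g (b i) - g (a i)\<bar>)"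
      by (rule sum.distrib)
    also have "\<dots> < \<epsilon> / 2 + \<epsilon> / 2"
      using short_intervals_mono[OF sh order_refl]
      by (intro add_strict_mono d1(2) d2(2)) auto
    finally show ?thesis
      by simp
  qed
  moreover have "min \<delta>1 \<delta>2 > 0"
    using d1 d2 by simp
  ultimately show "\<exists>\<delta>>0. \<forall>n a b. short_intervals S \<delta> n a b \<longrightarrow> (\<Sum>i<n. \<bar>h (b i) - h (a i)\<bar>) < \<epsilon>"
    by blast
qed

lemma abs_cont_on_add:
  "\<lbrakk>abs_cont_on S f; abs_cont_on S g\<rbrakk> \<Longrightarrow> abs_cont_on S (\<lambda>x. f x + g x)"
  by (erule abs_cont_on_dominated, assumption) linarith

lemma abs_cont_on_max:
  "\<lbrakk>abs_cont_on S f; abs_cont_on S g\<rbrakk> \<Longrightarrow> abs_cont_on S (\<lambda>x. max (f x) (g x))"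
  by (erule abs_cont_on_dominated, assumption) (auto simp: max_def)

lemma abs_cont_on_uminus: "abs_cont_on S f \<Longrightarrow> abs_cont_on S (\<lambda>x. - f x)"
  unfolding abs_cont_on_def by (simp add: abs_minus_commute)

lemma abs_cont_on_diff:
  "\<lbrakk>abs_cont_on S f; abs_cont_on S g\<rbrakk> \<Longrightarrow> abs_cont_on S (\<lambda>x. f x - g x)"
  using abs_cont_on_add[of S f "\<lambda>x. - g x"] abs_cont_on_uminus[of S g] by simp

lemma abs_cont_on_imp_continuous_on:
  assumes "abs_cont_on {a..b} f"
  shows "continuous_on {a..b} f"
proof (rule continuous_onI)
  fix x \<epsilon> :: real
  assume x: "x \<in> {a..b}" and "\<epsilon> > 0"
  obtain \<delta> where d: "\<delta> > 0"
    "\<And>n u v. short_intervals {a..b} \<delta> n u v \<Longrightarrow> (\<Sum>i<n. \<bar>f (v i) - f (u i)\<bar>) < \<epsilon>"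
    using abs_cont_onE[OF assms \<open>\<epsilon> > 0\<close>] by metis
  have "dist (f y) (f x) \<le> \<epsilon>" if y: "y \<in> {a..b}" "dist y x < \<delta>" for y
  proof -
    have "short_intervals {a..b} \<delta> 1 (\<lambda>_. min x y) (\<lambda>_. max x y)"
      using x y by (auto simp: dist_real_def short_intervals_def max_def min_def)
    from d(2)[OF this] show ?thesis
      by (auto simp: dist_real_def max_def min_def split: if_splits)
  qed
  with d(1) show "\<exists>d>0. \<forall>x'\<in>{a..b}. dist x' x < d \<longrightarrow> dist (f x') (f x) \<le> \<epsilon>"
    by blast
qed

section \<open>Monotonicity from the sign of the almost everywhere derivative\<close>

lemma sum_lengths_le_measure:
  fixes a b :: "'i \<Rightarrow> real"
  assumes fin: "finite I" and le: "\<And>i. i \<in> I \<Longrightarrow> a i \<le> b i"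
    and dis: "\<And>i j. \<lbrakk>i \<in> I; j \<in> I; i \<noteq> j\<rbrakk> \<Longrightarrow> b i \<le> a j \<or> b j \<le> a i"
    and sub: "\<And>i. i \<in> I \<Longrightarrow> {a i<..<b i} \<subseteq> U" and U: "U \<in> lmeasurable"
  shows "(\<Sum>i\<in>I. b i - a i) \<le> measure lebesgue U"
proof -
  have "(\<Sum>i\<in>I. b i - a i) = (\<Sum>i\<in>I. measure lebesgue {a i<..<b i})"
    using le by (intro sum.cong) auto
  \<comment> \<open>Intervals that share an endpoint still have disjoint interiors, so additivity is
    applied to the open intervals, which have the same lengths.\<close>
  also have "\<dots> = measure lebesgue (\<Union>i\<in>I. {a i<..<b i})"
  proof (rule measure_finite_Union[symmetric])
    show "disjoint_family_on (\<lambda>i. {a i<..<b i}) I"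
      using dis by (force simp: disjoint_family_on_def)
    show "emeasure lebesgue {a i<..<b i} \<noteq> \<infinity>" if "i \<in> I" for i
      using le[OF that] by simp
  qed (use fin in auto)
  also have "\<dots> \<le> measure lebesgue U"
    using sub U fin by (intro measure_mono_fmeasurable) auto
  finally show ?thesis .
qed

text \<open>With error tolerance \<open>D\<close> the linear approximation at \<open>x\<close> gives
  g u \<le> g x \<le> g v. Only pairs that straddle \<open>x\<close> are compared, since
  \<open>g\<close> need not be monotone near \<open>x\<close>; a tag lies between the endpoints of
  its interval in just this way.\<close>

lemma has_real_derivative_pos_straddle:
  fixes g :: "real \<Rightarrow> real"
  assumes der: "(g has_real_derivative D) (at x within {a..b})" and "D > 0" and x: "x \<in> {a..b}"
  obtains r where "r > 0"
    "\<And>u v. \<lbrakk>u \<in> {a..b}; v \<in> {a..b}; u \<le> x; x \<le> v; \<bar>u - x\<bar> < r; \<bar>v - x\<bar> < r\<rbrakk> \<Longrightarrow> g u \<le> g v"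
proof -
  obtain r where "r > 0" and r: "\<And>y. \<lbrakk>y \<in> {a..b}; \<bar>y - x\<bar> < r\<rbrakk> \<Longrightarrow> \<bar>g y - g x - D * (y - x)\<bar> \<le> D * \<bar>y - x\<bar>"
    using der \<open>D > 0\<close> unfolding has_field_derivative_def has_derivative_within_alt real_norm_def
    by blast
  show thesis
  proof
    fix u v
    assume "u \<in> {a..b}" "v \<in> {a..b}" "u \<le> x" "x \<le> v" "\<bar>u - x\<bar> < r" "\<bar>v - x\<bar> < r"
    with r[of u] r[of v] show "g u \<le> g v"
      by (simp add: abs_if algebra_simps split: if_splits)
  qed fact
qed

text \<open>A fine division exists for the gauge that is so small at good points that the increment is
  nonnegative, and that confines the pieces tagged in the exceptional null set to an open set of
  small measure; absolute continuity makes the contribution of the latter negligible.\<close>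

lemma abs_cont_on_pos_deriv_le:
  fixes g :: "real \<Rightarrow> real"
  assumes ab: "a \<le> b" and ac: "abs_cont_on {a..b} g"
    and der: "AE x in lebesgue. x \<in> {a..b} \<longrightarrow>
                (\<exists>D>0. (g has_real_derivative D) (at x within {a..b}))"
  shows "g a \<le> g b"
proof (rule field_le_epsilon)
  fix e :: real
  assume "e > 0"
  obtain \<delta> where "\<delta> > 0" and \<delta>:
      "\<And>n u v. short_intervals {a..b} \<delta> n u v \<Longrightarrow> (\<Sum>i<n. \<bar>g (v i) - g (u i)\<bar>) < e"
    using abs_cont_onE[OF ac \<open>e > 0\<close>] by metis
  define N where "N = {x\<in>{a..b}. \<not> (\<exists>D>0. (g has_real_derivative D) (at x within {a..b}))}"
  obtain Z where Z: "Z \<in> null_sets lebesgue" "N \<subseteq> Z"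
    using der unfolding eventually_ae_filter N_def by auto
  then obtain U where U: "open U" "Z \<subseteq> U" "U - Z \<in> lmeasurable" "emeasure lebesgue (U - Z) < ennreal \<delta>"
    using sets_lebesgue_outer_open[of Z \<delta>] \<open>\<delta> > 0\<close> by blast
  have UU: "U = (U - Z) \<union> Z"
    using U by auto
  have Zm: "Z \<in> lmeasurable"
    using Z(1) by (simp add: negligible_iff_null_sets negligible_imp_measurable)
  have Ulm: "U \<in> lmeasurable"
    using UU U(3) Zm fmeasurable.Un by metis
  have "measure lebesgue U \<le> measure lebesgue (U - Z) + measure lebesgue Z"
    using measure_Un_le[of "U - Z" lebesgue Z] U(3) Zm UU by (metis fmeasurableD)
  also have "measure lebesgue Z = 0"
    using Z(1) by (simp add: measure_eq_0_null_sets)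
  also have "measure lebesgue (U - Z) < \<delta>"
    using U(3,4) \<open>\<delta> > 0\<close> by (simp add: emeasure_eq_measure2 ennreal_less_iff)
  finally have Umeas: "measure lebesgue U < \<delta>"
    by simp
  have "\<exists>r>0. (x \<in> N \<longrightarrow> ball x r \<subseteq> U) \<and> (x \<in> {a..b} - N \<longrightarrow>
        (\<forall>u v. u \<in> {a..b} \<longrightarrow> v \<in> {a..b} \<longrightarrow> u \<le> x \<longrightarrow> x \<le> v \<longrightarrow> u \<in> ball x r \<longrightarrow> v \<in> ball x r \<longrightarrow> g u \<le> g v))"
    for x
  proof -
    consider "x \<in> N" | "x \<in> {a..b} - N" | "x \<notin> {a..b}"
      by blast
    then show ?thesis
    proof cases
      case 1
      then show ?thesis
        using U(1,2) Z(2) by (metis DiffD2 openE subsetD)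
    next
      case 2
      then obtain D where "D > 0" "(g has_real_derivative D) (at x within {a..b})"
        by (auto simp: N_def)
      then obtain r where "r > 0"
        "\<And>u v. \<lbrakk>u \<in> {a..b}; v \<in> {a..b}; u \<le> x; x \<le> v; \<bar>u - x\<bar> < r; \<bar>v - x\<bar> < r\<rbrakk> \<Longrightarrow> g u \<le> g v"
        using has_real_derivative_pos_straddle[of g D x a b] 2 by blast
      with 2 show ?thesis
        by (intro exI[of _ r]) (auto simp: dist_real_def abs_minus_commute)
    next
      case 3
      then show ?thesis
        by (intro exI[of _ 1]) (auto simp: N_def)
    qed
  qed
  then obtain r where r: "\<And>x. r x > 0" "\<And>x. x \<in> N \<Longrightarrow> ball x (r x) \<subseteq> U"
    "\<And>x u v. \<lbrakk>x \<in> {a..b} - N; u \<in> {a..b}; v \<in> {a..b}; u \<le> x; x \<le> v; u \<in> ball x (r x); v \<in> ball x (r x)\<rbrakk> \<Longrightarrow> g u \<le> g v"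
    by metis
  have "gauge (\<lambda>x. ball x (r x))"
    using r(1) by (simp add: gauge_def)
  then obtain P where P: "P tagged_division_of {a..b}" "(\<lambda>x. ball x (r x)) fine P"
    using fine_division_exists_real by metis
  have finP: "finite P"
    using P(1) by auto
  have box: "\<exists>u v. K = {u..v} \<and> u \<le> x \<and> x \<le> v \<and> a \<le> u \<and> v \<le> b \<and> K \<subseteq> ball x (r x)"
    if xK: "(x, K) \<in> P" for x K
  proof -
    have "x \<in> K" "K \<subseteq> {a..b}"
      using tagged_division_ofD(2,3)[OF P(1) xK] by auto
    moreover have "K \<subseteq> ball x (r x)"
      using P(2) xK by (auto simp: fine_def)
    moreover obtain u v where "K = cbox u v"
      using tagged_division_ofD(4)[OF P(1) xK] by blast
    moreover have "u \<in> K" "v \<in> K"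
      using calculation by auto
    ultimately show ?thesis
      by (intro exI[of _ u] exI[of _ v]) auto
  qed
  \<comment> \<open>Degenerate pieces contribute no increment, and disjointness of interiors would
    not keep them from lying inside another piece; without them the remaining pieces are ordered as
    \<open>short_intervals\<close> demands.\<close>
  define Q where "Q = {(x, K)\<in>P. x \<in> N \<and> Inf K < Sup K}"
  have QP: "Q \<subseteq> P" and finQ: "finite Q"
    using finP by (auto simp: Q_def intro: finite_subset)
  have disj: "Sup (snd i) \<le> Inf (snd j) \<or> Sup (snd j) \<le> Inf (snd i)" if Qij: "i \<in> Q" "j \<in> Q" "i \<noteq> j" for i j
  proof -
    obtain x K y L where ij: "i = (x, K)" "j = (y, L)"
      by fastforce
    obtain u v where K: "K = {u..v}" "u \<le> v"
      using box[of x K] Qij ij QP by fastforce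
    obtain s t where L: "L = {s..t}" "s \<le> t"
      using box[of y L] Qij ij QP by fastforce
    have "interior K \<inter> interior L = {}"
      using tagged_division_ofD(5)[OF P(1), of x K y L] Qij QP ij by auto
    then have "{u<..<v} \<inter> {s<..<t} = {}"
      by (simp add: K L)
    moreover have "u < v" "s < t"
      using Qij K L by (auto simp: Q_def ij)
    ultimately have "v \<le> s \<or> t \<le> u"
      using dense[of "max u s" "min v t"] by (fastforce simp: disjoint_iff max_def min_def split: if_splits)
    then show ?thesis
      using K L by (simp add: ij)
  qed
  have inU: "{Inf (snd i)<..<Sup (snd i)} \<subseteq> U" "Inf (snd i) \<le> Sup (snd i)"
     "{Inf (snd i)..Sup (snd i)} \<subseteq> {a..b}" if iQ: "i \<in> Q" for i
  proof -
    obtain x K where i: "i = (x, K)"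
      by fastforce
    then obtain u v where K: "K = {u..v}" "u \<le> x" "x \<le> v" "a \<le> u" "v \<le> b" "K \<subseteq> ball x (r x)"
      using box QP iQ by blast
    moreover have "ball x (r x) \<subseteq> U"
      using iQ i by (intro r(2)) (auto simp: Q_def)
    ultimately show "{Inf (snd i)<..<Sup (snd i)} \<subseteq> U" "Inf (snd i) \<le> Sup (snd i)"
      "{Inf (snd i)..Sup (snd i)} \<subseteq> {a..b}"
      using i by (fastforce simp: subset_eq)+
  qed
  have "(\<Sum>i\<in>Q. Sup (snd i) - Inf (snd i)) \<le> measure lebesgue U"
    by (rule sum_lengths_le_measure) (use finQ disj inU Ulm in auto)
  then have len: "(\<Sum>i\<in>Q. Sup (snd i) - Inf (snd i)) < \<delta>"
    using Umeas by simp
  obtain h n where h: "bij_betw h {..<n} Q"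
     "short_intervals {a..b} \<delta> n ((\<lambda>i. Inf (snd i)) \<circ> h) ((\<lambda>i. Sup (snd i)) \<circ> h)"
    using short_intervals_finite_family[OF finQ _ disj len, of "{a..b}"] inU by blast
  have "(\<Sum>i\<in>Q. \<bar>g (Sup (snd i)) - g (Inf (snd i))\<bar>) < e"
    using \<delta>[OF h(2)] sum.reindex_bij_betw[OF h(1), of "\<lambda>i. \<bar>g (Sup (snd i)) - g (Inf (snd i))\<bar>"]
    by simp
  moreover have "- (\<Sum>i\<in>Q. g (Sup (snd i)) - g (Inf (snd i))) \<le> (\<Sum>i\<in>Q. \<bar>g (Sup (snd i)) - g (Inf (snd i))\<bar>)"
    unfolding sum_negf[symmetric] by (intro sum_mono) linarith
  moreover have "(\<Sum>i\<in>P-Q. g (Sup (snd i)) - g (Inf (snd i))) \<ge> 0"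
  proof (rule sum_nonneg)
    fix i
    assume i: "i \<in> P - Q"
    obtain x K where xK: "i = (x, K)"
      by fastforce
    then obtain u v where K: "K = {u..v}" "u \<le> x" "x \<le> v" "a \<le> u" "v \<le> b" "K \<subseteq> ball x (r x)"
      using box i by blast
    have "u \<in> K" "v \<in> K"
      using K by auto
    then have "u \<in> ball x (r x)" "v \<in> ball x (r x)"
      using K(6) by blast+
    then have "g u \<le> g v"
      using i xK K r(3)[of x u v] by (cases "x \<in> N"; cases "u = v") (auto simp: Q_def)
    then show "0 \<le> g (Sup (snd i)) - g (Inf (snd i))"
      using K xK by simp
  qed
  moreover have "(\<Sum>i\<in>P. g (Sup (snd i)) - g (Inf (snd i))) = g b - g a"
    using additive_tagged_division_1[OF ab P(1), of g] by (simp add: split_def)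
  moreover have "(\<Sum>i\<in>P. g (Sup (snd i)) - g (Inf (snd i)))
     = (\<Sum>i\<in>P-Q. g (Sup (snd i)) - g (Inf (snd i))) + (\<Sum>i\<in>Q. g (Sup (snd i)) - g (Inf (snd i)))"
    by (rule sum.subset_diff) (use QP finP in auto)
  ultimately show "g a \<le> g b + e"
    by linarith
qed

text \<open>Adding \<open>\<eta> * x\<close> makes the derivative strictly positive, at the price
  \<open>\<eta> * (b - a)\<close>, which is at most the given \<open>e\<close>; the summand 1 in the
  denominator of \<open>\<eta>\<close> covers a = b.\<close>

lemma abs_cont_on_nonneg_deriv_le:
  fixes g :: "real \<Rightarrow> real"
  assumes ab: "a \<le> b" and ac: "abs_cont_on {a..b} g"
    and der: "AE x in lebesgue. x \<in> {a..b} \<longrightarrow>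
                (\<exists>D\<ge>0. (g has_real_derivative D) (at x within {a..b}))"
  shows "g a \<le> g b"
proof (rule field_le_epsilon)
  fix e :: real
  assume "e > 0"
  define \<eta> where "\<eta> = e / (b - a + 1)"
  have "\<eta> > 0"
    using \<open>e > 0\<close> ab by (simp add: \<eta>_def)
  have "g a + \<eta> * a \<le> g b + \<eta> * b"
  proof (rule abs_cont_on_pos_deriv_le[OF ab])
    show "abs_cont_on {a..b} (\<lambda>x. g x + \<eta> * x)"
      by (intro abs_cont_on_add ac abs_cont_on_linear)
    show "AE x in lebesgue. x \<in> {a..b} \<longrightarrow>
        (\<exists>D>0. ((\<lambda>x. g x + \<eta> * x) has_real_derivative D) (at x within {a..b}))"
      using der
    proof (rule AE_mp, intro AE_I2 impI)
      fix x
      assume "x \<in> {a..b} \<longrightarrow> (\<exists>D\<ge>0. (g has_real_derivative D) (at x within {a..b}))" "x \<in> {a..b}"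
      then obtain D where "D \<ge> 0" "(g has_real_derivative D) (at x within {a..b})"
        by blast
      then have "((\<lambda>x. g x + \<eta> * x) has_real_derivative D + \<eta>) (at x within {a..b})"
        by (auto intro!: derivative_eq_intros)
      with \<open>D \<ge> 0\<close> \<open>\<eta> > 0\<close> show "\<exists>D>0. ((\<lambda>x. g x + \<eta> * x) has_real_derivative D) (at x within {a..b})"
        by (metis add_nonneg_pos)
    qed
  qed
  moreover have "\<eta> * (b - a) \<le> e"
    using \<open>e > 0\<close> ab by (simp add: \<eta>_def field_simps)
  ultimately show "g a \<le> g b + e"
    by (simp add: algebra_simps)
qed

section \<open>Differentiation of indefinite integrals\<close>

text \<open>For points where the difference quotients stay \<open>\<eta>\<close>-far from the integrand, small intervals
  tagged there violate Henstock's lemma by an amount proportional to their length; Vitali's covering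
  theorem bounds the measure of the set of such points.\<close>

lemma negligible_bad_difference_quotient:
  fixes g :: "real \<Rightarrow> real"
  assumes g: "g integrable_on {a..b}" and "\<eta> > 0"
  defines "G \<equiv> \<lambda>x. integral {a..x} g"
  shows "negligible {x\<in>{a..b}. \<forall>\<delta>>0. \<exists>y\<in>{a..b}. y \<noteq> x \<and> \<bar>y - x\<bar> < \<delta> \<and>
           \<bar>G y - G x - g x * (y - x)\<bar> > \<eta> * \<bar>y - x\<bar>}" (is "negligible ?E")
  unfolding negligible_outer_le
proof (intro allI impI)
  fix e :: real
  assume "e > 0"
  then have "e * \<eta> > 0"
    using \<open>\<eta> > 0\<close> by simp
  have "g integrable_on cbox a b"
    using g by simp
  from Henstock_lemma[OF this \<open>e * \<eta> > 0\<close>]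
  obtain \<gamma> where \<gamma>: "gauge \<gamma>" "\<And>p. \<lbrakk>p tagged_partial_division_of {a..b}; \<gamma> fine p\<rbrakk> \<Longrightarrow>
             (\<Sum>(x,k)\<in>p. norm (measure lborel k *\<^sub>R g x - integral k g)) < e * \<eta>"
    unfolding box_real by blast
  \<comment> \<open>A pair \<open>(x, y)\<close> stands for a bad point \<open>x\<close> and a
    witness \<open>y\<close> of its bad quotient. The interval between them is also written as a
    ball with centre \<open>m\<close> and radius \<open>\<rho>\<close>, the form in which the
    covering theorem selects a disjoint family.\<close>
  define J where "J = (\<lambda>(x, y). {min x y..max x y :: real})"
  define m where "m = (\<lambda>(x, y). (x + y) / 2 :: real)"
  define \<rho> where "\<rho> = (\<lambda>(x, y). \<bar>y - x\<bar> / 2 :: real)"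
  define K where "K = {(x, y). x \<in> ?E \<and> y \<in> {a..b} \<and> y \<noteq> x \<and> J (x, y) \<subseteq> \<gamma> x \<and>
           \<bar>G y - G x - g x * (y - x)\<bar> > \<eta> * \<bar>y - x\<bar>}"
  have cball: "cball (m i) (\<rho> i) = J i" for i
    by (cases i) (auto simp: cball_eq_atLeastAtMost J_def m_def \<rho>_def abs_if min_def max_def field_simps)
  obtain C where C0: "countable C" "C \<subseteq> K"
     "pairwise (\<lambda>i j. disjnt (cball (m i) (\<rho> i)) (cball (m j) (\<rho> j))) C"
     "negligible (?E - (\<Union>i \<in> C. cball (m i) (\<rho> i)))"
  proof (rule Vitali_covering_theorem_cballs[of K \<rho> ?E m])
    show "0 < \<rho> i" if "i \<in> K" for i
      using that by (auto simp: K_def \<rho>_def)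
    show "\<exists>i. i \<in> K \<and> x \<in> cball (m i) (\<rho> i) \<and> \<rho> i < \<delta>" if x: "x \<in> ?E" and "0 < \<delta>" for x \<delta>
    proof -
      obtain r where "r > 0" "ball x r \<subseteq> \<gamma> x"
        using \<gamma>(1) unfolding gauge_def by (metis openE)
      moreover from x have "\<forall>\<delta>>0. \<exists>y\<in>{a..b}. y \<noteq> x \<and> \<bar>y - x\<bar> < \<delta> \<and>
           \<bar>G y - G x - g x * (y - x)\<bar> > \<eta> * \<bar>y - x\<bar>"
        by blast
      ultimately obtain y where y: "y \<in> {a..b}" "y \<noteq> x" "\<bar>y - x\<bar> < min r \<delta>"
        "\<bar>G y - G x - g x * (y - x)\<bar> > \<eta> * \<bar>y - x\<bar>"
        using \<open>0 < \<delta>\<close> by (metis min_less_iff_conj)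
      have "J (x, y) \<subseteq> ball x r"
        using y(3) by (auto simp: J_def dist_real_def)
      then have "(x, y) \<in> K"
        using y x \<open>ball x r \<subseteq> \<gamma> x\<close> by (auto simp: K_def)
      moreover have "x \<in> J (x, y)"
        by (simp add: J_def)
      moreover have "\<rho> (x, y) < \<delta>"
      proof -
        have "\<bar>y - x\<bar> < \<delta>"
          using y(3) by simp
        with \<open>0 < \<delta>\<close> show ?thesis
          by (simp add: \<rho>_def)
      qed
      ultimately show ?thesis
        unfolding cball by blast
    qed
  qed blast
  note C = C0[unfolded cball]
  have Jlm: "J i \<in> lmeasurable" for i
    by (cases i) (simp add: J_def)
  have Jm: "measure lebesgue (J (x, y)) = \<bar>y - x\<bar>" for x y
    by (simp add: J_def max_def min_def)
  \<comment> \<open>Each selected interval has an error above \<open>\<eta>\<close> times its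
    length, while Henstock's lemma keeps the sum of errors below \<open>e * \<eta>\<close>. The
    bound is the same for all finite subfamilies and therefore passes to the countable one.\<close>
  have bound: "measure lebesgue (\<Union>i\<in>F. J i) \<le> e" if F: "F \<subseteq> C" "finite F" for F
  proof -
    define tg where "tg = (\<lambda>i. (fst i, J i))"
    have FK: "F \<subseteq> K"
      using F C by blast
    have "tg i \<noteq> tg j" if "i \<in> F" "j \<in> F" "i \<noteq> j" for i j
    proof -
      have "J i \<inter> J j = {}"
        using C(3) F that by (auto simp: pairwise_def disjnt_def)
      moreover have "J i \<noteq> {}"
        by (cases i) (auto simp: J_def)
      ultimately show ?thesis
        by (auto simp: tg_def)
    qed
    then have inj: "inj_on tg F"
      by (auto simp: inj_on_def)
    have part: "tg ` F tagged_partial_division_of {a..b}"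
      unfolding tagged_partial_division_of_def
    proof (intro conjI allI impI)
      show "finite (tg ` F)"
        using F by simp
    next
      fix x k
      assume "(x, k) \<in> tg ` F"
      then obtain y where "(x, y) \<in> F" "k = J (x, y)"
        by (auto simp: tg_def)
      then show "x \<in> k" "k \<subseteq> {a..b}" "\<exists>a b. k = cbox a b"
        using FK by (auto simp: J_def K_def)
    next
      fix x1 k1 x2 k2
      assume h: "(x1, k1) \<in> tg ` F \<and> (x2, k2) \<in> tg ` F \<and> (x1, k1) \<noteq> (x2, k2)"
      then obtain i j where "i \<in> F" "j \<in> F" "(x1, k1) = tg i" "(x2, k2) = tg j"
        by auto
      moreover from this h have "i \<noteq> j"
        by auto
      ultimately have "J i \<inter> J j = {}" "k1 = J i" "k2 = J j"
        using C(3) F by (auto simp: pairwise_def disjnt_def tg_def)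
      then show "interior k1 \<inter> interior k2 = {}"
        using interior_subset by blast
    qed
    have fine: "\<gamma> fine tg ` F"
    proof -
      have "J i \<subseteq> \<gamma> (fst i)" if "i \<in> K" for i
        using that unfolding K_def by (cases i) simp
      then show ?thesis
        unfolding fine_def using FK by (auto simp: tg_def)
    qed
    have "\<eta> * measure lebesgue (\<Union>i\<in>F. J i) \<le> \<eta> * (\<Sum>i\<in>F. measure lebesgue (J i))"
      using F \<open>\<eta> > 0\<close> Jlm by (intro mult_left_mono measure_UNION_le) (auto simp: fmeasurableD)
    also have "\<dots> \<le> (\<Sum>i\<in>F. norm (measure lborel (J i) *\<^sub>R g (fst i) - integral (J i) g))"
      unfolding sum_distrib_left
    proof (rule sum_mono)
      fix i
      assume "i \<in> F"
      then obtain x y where i: "i = (x, y)" "x \<in> {a..b}" "y \<in> {a..b}"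
          "\<bar>G y - G x - g x * (y - x)\<bar> > \<eta> * \<bar>y - x\<bar>"
        using FK by (auto simp: K_def)
      have comb: "integral {u..v} g = G v - G u" if "a \<le> u" "u \<le> v" "v \<le> b" for u v
        using Henstock_Kurzweil_Integration.integral_combine[of a u v g] that
          integrable_on_subinterval[OF g, of a v] by (simp add: G_def)
      show "\<eta> * measure lebesgue (J i) \<le> norm (measure lborel (J i) *\<^sub>R g (fst i) - integral (J i) g)"
      proof (cases "x \<le> y")
        case True
        then show ?thesis
          using i comb[of x y] by (simp add: J_def min_def max_def abs_if algebra_simps split: if_splits)
      next
        case False
        then show ?thesis
          using i comb[of y x] by (simp add: J_def min_def max_def abs_if algebra_simps split: if_splits)
      qed
    qed
    also have "\<dots> = (\<Sum>(x,k)\<in>tg ` F. norm (measure lborel k *\<^sub>R g x - integral k g))"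
      by (subst sum.reindex[OF inj]) (simp add: tg_def)
    also have "\<dots> < e * \<eta>"
      by (rule \<gamma>(2)[OF part fine])
    finally show ?thesis
      using \<open>\<eta> > 0\<close> by (simp add: mult.commute)
  qed
  have lmU: "(\<Union>i\<in>C. J i) \<in> lmeasurable" and leU: "measure lebesgue (\<Union>i\<in>C. J i) \<le> e"
    using fmeasurable_UN_bound[OF C(1) Jlm bound] measure_UN_bound[OF C(1) Jlm bound] by auto
  \<comment> \<open>The selected intervals miss only a negligible part of the bad set, which is
    added without changing the measure.\<close>
  define T where "T = (\<Union>i\<in>C. J i) \<union> (?E - (\<Union>i\<in>C. J i))"
  have "measure lebesgue T = measure lebesgue (\<Union>i\<in>C. J i)"
    unfolding T_def
    by (rule measure_Un_null_set) (use lmU C(4) negligible_iff_null_sets in \<open>auto simp: fmeasurableD\<close>)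
  then have T_le: "measure lebesgue T \<le> e"
    using leU by simp
  have T_lm: "T \<in> lmeasurable"
    unfolding T_def using lmU negligible_imp_measurable[OF C(4)] by (rule fmeasurable.Un)
  have "?E \<subseteq> T"
    unfolding T_def by blast
  then show "\<exists>T. ?E \<subseteq> T \<and> T \<in> lmeasurable \<and> measure lebesgue T \<le> e"
    by (intro exI[where x = T] conjI T_lm T_le)
qed

text \<open>Outside the countably many negligible sets belonging to the tolerances 1/(n+1), every
  difference quotient of the integral converges to the integrand.\<close>

theorem AE_has_real_derivative_integral:
  fixes g :: "real \<Rightarrow> real"
  assumes g: "g integrable_on {a..b}"
  shows "AE x in lebesgue. x \<in> {a..b} \<longrightarrow>
    ((\<lambda>x. integral {a..x} g) has_real_derivative g x) (at x within {a..b})"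
proof -
  define G where "G = (\<lambda>x. integral {a..x} g)"
  define E where "E = (\<lambda>\<eta>. {x\<in>{a..b}. \<forall>\<delta>>0. \<exists>y\<in>{a..b}. y \<noteq> x \<and> \<bar>y - x\<bar> < \<delta> \<and>
           \<bar>G y - G x - g x * (y - x)\<bar> > \<eta> * \<bar>y - x\<bar>})"
  have "negligible (E (inverse (real (Suc n))))" for n
    unfolding E_def G_def by (intro negligible_bad_difference_quotient g) simp
  then have "negligible (\<Union>n. E (inverse (real (Suc n))))"
    by (intro negligible_countable_Union) auto
  then have "AE x in lebesgue. x \<notin> (\<Union>n. E (inverse (real (Suc n))))"
    unfolding negligible_iff_null_sets by (rule AE_not_in)
  then show ?thesis
  proof (rule AE_mp, intro AE_I2 impI)
    fix x
    assume x: "x \<notin> (\<Union>n. E (inverse (real (Suc n))))" "x \<in> {a..b}"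
    have "\<exists>\<delta>>0. \<forall>y\<in>{a..b}. \<bar>y - x\<bar> < \<delta> \<longrightarrow> \<bar>G y - G x - g x * (y - x)\<bar> \<le> \<eta> * \<bar>y - x\<bar>" if "\<eta> > 0" for \<eta>
    proof -
      obtain n where n: "inverse (real (Suc n)) < \<eta>"
        using reals_Archimedean[OF \<open>\<eta> > 0\<close>] by blast
      have "x \<notin> E (inverse (real (Suc n)))"
        using x by blast
      then obtain \<delta> where "\<delta> > 0" and \<delta>:
        "\<And>y. \<lbrakk>y \<in> {a..b}; y \<noteq> x; \<bar>y - x\<bar> < \<delta>\<rbrakk> \<Longrightarrow>
            \<bar>G y - G x - g x * (y - x)\<bar> \<le> inverse (real (Suc n)) * \<bar>y - x\<bar>"
        using x(2) unfolding E_def by (simp add: not_less) (metis atLeastAtMost_iff not_less)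
      have "\<bar>G y - G x - g x * (y - x)\<bar> \<le> \<eta> * \<bar>y - x\<bar>" if "y \<in> {a..b}" "\<bar>y - x\<bar> < \<delta>" for y
      proof (cases "y = x")
        case False
        have "inverse (real (Suc n)) * \<bar>y - x\<bar> \<le> \<eta> * \<bar>y - x\<bar>"
          using n by (intro mult_right_mono) auto
        with \<delta>[OF that(1) False that(2)] show ?thesis
          by linarith
      qed simp
      with \<open>\<delta> > 0\<close> show ?thesis
        by blast
    qed
    then show "((\<lambda>x. integral {a..x} g) has_real_derivative g x) (at x within {a..b})"
      unfolding has_field_derivative_def has_derivative_within_alt G_def
      by (auto intro: bounded_linear_mult_right)
  qed
qed

section \<open>The Dirichlet problem for bounded Caratheodory right-hand sides\<close>

lemma dominated_convergence_const:
  fixes f :: "nat \<Rightarrow> real \<Rightarrow> real"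
  assumes "\<And>n. f n integrable_on {a..b}" "\<And>n t. t \<in> {a..b} \<Longrightarrow> \<bar>f n t\<bar> \<le> M"
    "\<And>t. t \<in> {a..b} \<Longrightarrow> (\<lambda>n. f n t) \<longlonglongrightarrow> g t"
  shows "g integrable_on {a..b}" "(\<lambda>n. integral {a..b} (f n)) \<longlonglongrightarrow> integral {a..b} g"
  using dominated_convergence[of f "{a..b}" "\<lambda>_. M" g] assms by auto

lemma integral_lipschitz:
  fixes g :: "real \<Rightarrow> real"
  assumes g: "g integrable_on {c..d}" and K: "\<And>t. t \<in> {c..d} \<Longrightarrow> \<bar>g t\<bar> \<le> K"
    and x: "x \<in> {c..d}" and y: "y \<in> {c..d}"
  shows "\<bar>integral {c..x} g - integral {c..y} g\<bar> \<le> K * \<bar>x - y\<bar>"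
proof -
  have *: "\<bar>integral {c..v} g - integral {c..u} g\<bar> \<le> K * \<bar>v - u\<bar>"
    if uv: "u \<in> {c..d}" "v \<in> {c..d}" "u \<le> v" for u v
  proof -
    have "integral {c..u} g + integral {u..v} g = integral {c..v} g"
      using uv by (intro Henstock_Kurzweil_Integration.integral_combine integrable_on_subinterval[OF g]) auto
    moreover have "norm (integral {u..v} g) \<le> K * (v - u)"
    proof -
      have "norm (integral {u..v} g) \<le> integral {u..v} (\<lambda>_. K)"
        by (rule integral_norm_bound_integral) (use uv K integrable_on_subinterval[OF g, of u v] in auto)
      then show ?thesis
        using uv by (simp add: mult.commute)
    qed
    ultimately show ?thesis
      using uv by auto
  qed
  show ?thesis
    using *[of x y] *[of y x] x y by (cases "x \<le> y") (auto simp: abs_minus_commute)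
qed

text \<open>The common Lipschitz constant gives equicontinuity for the Arzela-Ascoli theorem. Of the
  uniform convergence only the pointwise part is kept, which is what dominated convergence takes as
  input.\<close>

lemma lipschitz_bounded_subsequence:
  fixes u :: "nat \<Rightarrow> real \<Rightarrow> real"
  assumes bd: "\<And>n x. x \<in> {c..d} \<Longrightarrow> \<bar>u n x\<bar> \<le> M"
    and lip: "\<And>n x y. \<lbrakk>x \<in> {c..d}; y \<in> {c..d}\<rbrakk> \<Longrightarrow> \<bar>u n x - u n y\<bar> \<le> K * \<bar>x - y\<bar>"
  obtains v r where "continuous_on {c..d} v" "strict_mono (r :: nat \<Rightarrow> nat)"
    "\<And>x. x \<in> {c..d} \<Longrightarrow> (\<lambda>n. u (r n) x) \<longlonglongrightarrow> v x"
proof -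
  obtain v r where v: "continuous_on {c..d} v" "strict_mono (r :: nat \<Rightarrow> nat)"
     "\<And>e. 0 < e \<Longrightarrow> \<exists>N. \<forall>n x. n \<ge> N \<and> x \<in> {c..d} \<longrightarrow> norm (u (r n) x - v x) < e"
  proof (rule Arzela_Ascoli[of "{c..d}" u M])
    fix x e :: real
    assume x: "x \<in> {c..d}" and "0 < e"
    define \<delta> where "\<delta> = e / (\<bar>K\<bar> + 1)"
    have "\<bar>u n x - u n y\<bar> < e" if "y \<in> {c..d}" "\<bar>x - y\<bar> < \<delta>" for n y
    proof -
      have "\<bar>u n x - u n y\<bar> \<le> K * \<bar>x - y\<bar>"
        using lip x that by blast
      also have "\<dots> \<le> (\<bar>K\<bar> + 1) * \<bar>x - y\<bar>"
        by (intro mult_right_mono) auto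
      also have "\<dots> < (\<bar>K\<bar> + 1) * \<delta>"
        using that by (intro mult_strict_left_mono) auto
      finally show ?thesis
        by (simp add: \<delta>_def)
    qed
    moreover have "\<delta> > 0"
      using \<open>0 < e\<close> by (simp add: \<delta>_def)
    ultimately show "\<exists>d'. 0 < d' \<and> (\<forall>n y. y \<in> {c..d} \<and> norm (x - y) < d' \<longrightarrow> norm (u n x - u n y) < e)"
      unfolding real_norm_def by blast
  qed (use bd in auto)
  show thesis
  proof
    show "(\<lambda>n. u (r n) x) \<longlonglongrightarrow> v x" if "x \<in> {c..d}" for x
      unfolding LIMSEQ_iff using v(3) that by blast
  qed fact+
qed

text \<open>Measurability is demanded along continuous curves, the form in which \<open>F\<close>
  enters an integral, and continuity in the state is sequential, the form in which dominated
  convergence consumes it.\<close>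

locale bounded_caratheodory =
  fixes c d K :: real and F :: "real \<Rightarrow> real \<Rightarrow> real \<Rightarrow> real"
  assumes cd: "c < d"
    and meas: "\<And>V u. \<lbrakk>continuous_on {c..d} V; continuous_on {c..d} u\<rbrakk> \<Longrightarrow>
                 (\<lambda>t. F t (V t) (u t)) \<in> borel_measurable (lebesgue_on {c..d})"
    and cont: "\<And>t Y Z y z. \<lbrakk>t \<in> {c..d}; Y \<longlonglongrightarrow> y; Z \<longlonglongrightarrow> z\<rbrakk> \<Longrightarrow>
                 (\<lambda>n. F t (Y n) (Z n)) \<longlonglongrightarrow> F t y z"
    and bound: "\<And>t y z. t \<in> {c..d} \<Longrightarrow> \<bar>F t y z\<bar> \<le> K"
begin

lemma K_nonneg: "K \<ge> 0"
  using bound[of c 0 0] cd by (auto intro: order_trans[OF abs_ge_zero])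

lemma F_integrable:
  assumes "continuous_on {c..d} V" "continuous_on {c..d} u"
  shows "(\<lambda>t. F t (V t) (u t)) integrable_on {c..d}"
  by (rule measurable_bounded_by_integrable_imp_integrable[where g = "\<lambda>_. K"])
    (use meas[OF assms] bound in auto)

section \<open>Delayed Picard iterates and shooting\<close>

definition delay :: "real \<Rightarrow> real \<Rightarrow> real" where
  "delay h t = max c (t - h)"

text \<open>Picard iterates for the slope of a solution: \<open>s\<close> is the initial slope and
  the position is \<open>A\<close> plus the integral of the slope. Both are read at the delayed
  time, which is clamped to \<open>c\<close>, so that the initial state is the whole
  prehistory.\<close>

primrec delayed_iterate :: "real \<Rightarrow> real \<Rightarrow> real \<Rightarrow> nat \<Rightarrow> real \<Rightarrow> real" where
  "delayed_iterate A h s 0 = (\<lambda>x. s)"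
| "delayed_iterate A h s (Suc k) = (\<lambda>x. s + integral {c..x} (\<lambda>t.
     F t (A + integral {c..delay h t} (delayed_iterate A h s k)) (delayed_iterate A h s k (delay h t))))"

lemma delay_mem: "\<lbrakk>h \<ge> 0; t \<in> {c..d}\<rbrakk> \<Longrightarrow> delay h t \<in> {c..d}"
  by (auto simp: delay_def)

lemma continuous_on_delay: "continuous_on S (delay h)"
  unfolding delay_def by (intro continuous_intros)

lemma delayed_integrable:
  assumes u: "continuous_on {c..d} u" and h: "h \<ge> 0"
  shows "(\<lambda>t. F t (A + integral {c..delay h t} u) (u (delay h t))) integrable_on {c..d}"
proof (rule F_integrable)
  have img: "delay h ` {c..d} \<subseteq> {c..d}"
    using delay_mem[OF h] by blast
  have "continuous_on {c..d} (\<lambda>x. integral {c..x} u)"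
    by (intro indefinite_integral_continuous_1 integrable_continuous_real u)
  then show "continuous_on {c..d} (\<lambda>t. A + integral {c..delay h t} u)"
    using continuous_on_compose2[OF _ continuous_on_delay img] by (intro continuous_intros) auto
  show "continuous_on {c..d} (\<lambda>t. u (delay h t))"
    using continuous_on_compose2[OF u continuous_on_delay img] .
qed

text \<open>Continuity is carried through the induction because it makes the next integrand
  integrable. The constant \<open>K\<close> depends neither on the delay nor on \<open>s\<close> and
  \<open>k\<close>, which yields compactness when the delay tends to zero.\<close>

lemma delayed_iterate_lipschitz:
  assumes h: "h \<ge> 0"
  shows "continuous_on {c..d} (delayed_iterate A h s k)"
    and "\<lbrakk>x \<in> {c..d}; y \<in> {c..d}\<rbrakk> \<Longrightarrow>
           \<bar>delayed_iterate A h s k x - delayed_iterate A h s k y\<bar> \<le> K * \<bar>x - y\<bar>"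
proof -
  have "continuous_on {c..d} (delayed_iterate A h s k) \<and> (\<forall>x\<in>{c..d}. \<forall>y\<in>{c..d}.
      \<bar>delayed_iterate A h s k x - delayed_iterate A h s k y\<bar> \<le> K * \<bar>x - y\<bar>)"
  proof (induction k)
    case 0
    then show ?case
      using K_nonneg by simp
  next
    case (Suc k)
    let ?g = "\<lambda>t. F t (A + integral {c..delay h t} (delayed_iterate A h s k)) (delayed_iterate A h s k (delay h t))"
    have int: "?g integrable_on {c..d}"
      using Suc h by (intro delayed_integrable) auto
    have "continuous_on {c..d} (\<lambda>x. s + integral {c..x} ?g)"
      by (intro continuous_intros indefinite_integral_continuous_1 int)
    moreover have "\<bar>(s + integral {c..x} ?g) - (s + integral {c..y} ?g)\<bar> \<le> K * \<bar>x - y\<bar>"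
      if "x \<in> {c..d}" "y \<in> {c..d}" for x y
      using integral_lipschitz[OF int bound that] by simp
    ultimately show ?case
      by simp
  qed
  then show "continuous_on {c..d} (delayed_iterate A h s k)"
    and "\<lbrakk>x \<in> {c..d}; y \<in> {c..d}\<rbrakk> \<Longrightarrow>
           \<bar>delayed_iterate A h s k x - delayed_iterate A h s k y\<bar> \<le> K * \<bar>x - y\<bar>"
    by blast+
qed

lemma delayed_iterate_at_start: "delayed_iterate A h s k c = s"
  by (cases k) auto

text \<open>A bounded right-hand side changes the slope by a fixed amount at most. Hence a large
  initial slope forces a large end value, on which the shooting rests.\<close>

lemma delayed_iterate_near_slope:
  assumes "h \<ge> 0" "x \<in> {c..d}"
  shows "\<bar>delayed_iterate A h s k x - s\<bar> \<le> K * (d - c)"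
proof -
  have "\<bar>delayed_iterate A h s k x - s\<bar> \<le> K * \<bar>x - c\<bar>"
    using delayed_iterate_lipschitz(2)[OF assms(1,2), of c A s k] cd
    by (simp add: delayed_iterate_at_start)
  also have "\<dots> \<le> K * (d - c)"
    using assms K_nonneg by (intro mult_left_mono) auto
  finally show ?thesis .
qed

text \<open>The \<open>k\<close>-th iterate already is the solution of the delayed equation on the first \<open>k\<close> delay steps.\<close>

lemma delayed_iterate_stable:
  assumes h: "h \<ge> 0"
  shows "\<lbrakk>x \<in> {c..d}; x \<le> c + real k * h\<rbrakk> \<Longrightarrow>
     delayed_iterate A h s (Suc k) x = delayed_iterate A h s k x"
proof (induction k arbitrary: x)
  case 0
  then have "x = c"
    by simp
  then show ?case
    by (metis delayed_iterate_at_start)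
next
  case (Suc k)
  \<comment> \<open>Going back by \<open>h\<close> leads from the first \<open>Suc k\<close> delay
    steps into the first \<open>k\<close>, where the induction hypothesis compares the
    iterates.\<close>
  have le: "delay h t \<in> {c..d}" "delay h t \<le> c + real k * h" if "t \<in> {c..x}" for t
    using that Suc.prems h by (auto simp: delay_def algebra_simps)
  have "integral {c..delay h t} (delayed_iterate A h s (Suc k)) = integral {c..delay h t} (delayed_iterate A h s k)"
    if "t \<in> {c..x}" for t
    using le[OF that] by (intro integral_cong Suc.IH) auto
  moreover have "delayed_iterate A h s (Suc k) (delay h t) = delayed_iterate A h s k (delay h t)" if "t \<in> {c..x}" for t
    using le[OF that] by (intro Suc.IH)
  ultimately have "integral {c..x} (\<lambda>t. F t (A + integral {c..delay h t} (delayed_iterate A h s (Suc k)))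
                      (delayed_iterate A h s (Suc k) (delay h t)))
     = integral {c..x} (\<lambda>t. F t (A + integral {c..delay h t} (delayed_iterate A h s k))
                      (delayed_iterate A h s k (delay h t)))"
    by (intro integral_cong) metis
  then show ?case
    by (subst (1 2) delayed_iterate.simps(2)) simp
qed

text \<open>For fixed \<open>k\<close> the iterate is an explicit expression in the initial slope,
  so continuous dependence follows by induction and dominated convergence, without any uniqueness
  statement.\<close>

lemma delayed_iterate_tendsto:
  assumes h: "h \<ge> 0" and S: "S \<longlonglongrightarrow> s"
  shows "x \<in> {c..d} \<Longrightarrow> (\<lambda>j. delayed_iterate A h (S j) k x) \<longlonglongrightarrow> delayed_iterate A h s k x"
proof (induction k arbitrary: x)
  case 0
  then show ?case
    using S by simp
next
  case (Suc k)
  obtain M where M: "\<And>j. \<bar>S j\<bar> \<le> M"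
    using convergent_imp_Bseq[OF convergentI[OF S]] unfolding Bseq_def real_norm_def by blast
  have u_int: "(delayed_iterate A h (S j) k) integrable_on {c..t}" if "t \<in> {c..d}" for j t
    using that continuous_on_subset[OF delayed_iterate_lipschitz(1)[OF h]]
    by (intro integrable_continuous_real) auto
  have u_bd: "\<bar>delayed_iterate A h (S j) k t\<bar> \<le> M + K * (d - c)" if "t \<in> {c..d}" for j t
    using delayed_iterate_near_slope[OF h that, of A "S j" k] M[of j] by linarith
  have pos: "(\<lambda>j. integral {c..t} (delayed_iterate A h (S j) k)) \<longlonglongrightarrow> integral {c..t} (delayed_iterate A h s k)"
    if "t \<in> {c..d}" for t
    by (rule dominated_convergence_const(2)[where M = "M + K * (d - c)"])
      (use that u_int u_bd Suc.IH in auto)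
  have "(\<lambda>j. integral {c..x} (\<lambda>t. F t (A + integral {c..delay h t} (delayed_iterate A h (S j) k))
                      (delayed_iterate A h (S j) k (delay h t)))) \<longlonglongrightarrow>
     integral {c..x} (\<lambda>t. F t (A + integral {c..delay h t} (delayed_iterate A h s k))
                      (delayed_iterate A h s k (delay h t)))"
  proof (rule dominated_convergence_const(2)[where M = K])
    fix t
    assume "t \<in> {c..x}"
    then have t: "t \<in> {c..d}" "delay h t \<in> {c..d}"
      using Suc.prems delay_mem[OF h] by auto
    show "(\<lambda>j. F t (A + integral {c..delay h t} (delayed_iterate A h (S j) k))
                      (delayed_iterate A h (S j) k (delay h t))) \<longlonglongrightarrow>
          F t (A + integral {c..delay h t} (delayed_iterate A h s k))
                      (delayed_iterate A h s k (delay h t))"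
      using t by (intro cont tendsto_add tendsto_const pos Suc.IH)
  next
    fix j
    show "(\<lambda>t. F t (A + integral {c..delay h t} (delayed_iterate A h (S j) k))
                      (delayed_iterate A h (S j) k (delay h t))) integrable_on {c..x}"
      using Suc.prems
      by (intro integrable_on_subinterval[OF delayed_integrable[OF delayed_iterate_lipschitz(1)[OF h] h]]) auto
  qed (use Suc.prems bound in auto)
  then show ?case
    using S by (simp add: tendsto_add)
qed

text \<open>Since \<open>n\<close> delay steps cover the interval, the \<open>n\<close>-th iterate
  solves the delayed equation everywhere. Its end value is continuous in the initial slope. For
  initial slope \<open>R\<close> all slopes are at least |B - A| / (d - c), for \<open>- R\<close>
  at most the negative of that; so the end values enclose \<open>B\<close>, and the intermediate
  value theorem applies.\<close>

lemma delayed_solution: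
  fixes A B :: real
  assumes "n > 0"
  defines "h \<equiv> (d - c) / real n" and "R \<equiv> \<bar>B - A\<bar> / (d - c) + K * (d - c)"
  obtains u where
    "\<And>x y. \<lbrakk>x \<in> {c..d}; y \<in> {c..d}\<rbrakk> \<Longrightarrow> \<bar>u x - u y\<bar> \<le> K * \<bar>x - y\<bar>"
    "\<And>x. x \<in> {c..d} \<Longrightarrow> \<bar>u x\<bar> \<le> R + K * (d - c)"
    "continuous_on {c..d} u"
    "\<And>x. x \<in> {c..d} \<Longrightarrow> u x = u c + integral {c..x} (\<lambda>t. F t (A + integral {c..delay h t} u) (u (delay h t)))"
    "A + integral {c..d} u = B"
proof -
  have h: "h \<ge> 0" "c + real n * h = d"
    using assms cd by (auto simp: h_def)
  define \<phi> where "\<phi> s = A + integral {c..d} (delayed_iterate A h s n)" for s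
  have int: "delayed_iterate A h s n integrable_on {c..d}" for s
    by (intro integrable_continuous_real delayed_iterate_lipschitz h)
  have "continuous_on {-R..R} \<phi>"
    unfolding continuous_on_sequentially comp_def
  proof (intro allI ballI impI)
    fix S s
    assume "s \<in> {-R..R}" "(\<forall>j. S j \<in> {-R..R}) \<and> S \<longlonglongrightarrow> s"
    then have S: "S \<longlonglongrightarrow> s" "\<And>j. \<bar>S j\<bar> \<le> R"
      by (auto simp: abs_le_iff minus_le_iff)
    show "(\<lambda>j. \<phi> (S j)) \<longlonglongrightarrow> \<phi> s"
      unfolding \<phi>_def
    proof (intro tendsto_add tendsto_const dominated_convergence_const(2)[where M = "R + K * (d - c)"])
      show "\<bar>delayed_iterate A h (S j) n t\<bar> \<le> R + K * (d - c)" if "t \<in> {c..d}" for j t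
        using delayed_iterate_near_slope[OF h(1) that, of A "S j" n] S(2)[of j] by linarith
    qed (use int delayed_iterate_tendsto[OF h(1) S(1)] in auto)
  qed
  have near: "A + (s - K * (d - c)) * (d - c) \<le> \<phi> s" "\<phi> s \<le> A + (s + K * (d - c)) * (d - c)" for s
  proof -
    have *: "s - K * (d - c) \<le> delayed_iterate A h s n x" "delayed_iterate A h s n x \<le> s + K * (d - c)"
      if "x \<in> {c..d}" for x
      using delayed_iterate_near_slope[OF h(1) that, of A s n] by linarith+
    have "integral {c..d} (\<lambda>_. s - K * (d - c)) \<le> integral {c..d} (delayed_iterate A h s n)"
      by (intro integral_le int *) auto
    moreover have "integral {c..d} (delayed_iterate A h s n) \<le> integral {c..d} (\<lambda>_. s + K * (d - c))"
      by (intro integral_le int *) auto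
    ultimately show "A + (s - K * (d - c)) * (d - c) \<le> \<phi> s" "\<phi> s \<le> A + (s + K * (d - c)) * (d - c)"
      using cd by (auto simp: \<phi>_def mult.commute)
  qed
  have "(R - K * (d - c)) * (d - c) = \<bar>B - A\<bar>" "(- R + K * (d - c)) * (d - c) = - \<bar>B - A\<bar>"
    using cd by (auto simp: R_def field_simps)
  moreover have "R \<ge> 0"
    unfolding R_def using cd K_nonneg by (intro add_nonneg_nonneg divide_nonneg_nonneg mult_nonneg_nonneg) auto
  ultimately have "\<phi> (- R) \<le> B" "B \<le> \<phi> R" "- R \<le> R"
    using near[of R] near[of "- R"] by auto
  then obtain s where s: "- R \<le> s" "s \<le> R" "\<phi> s = B"
    using IVT'[of \<phi> "-R" B R] \<open>continuous_on {-R..R} \<phi>\<close> by auto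
  let ?u = "delayed_iterate A h s n"
  show thesis
  proof (rule that)
    show "\<bar>?u x - ?u y\<bar> \<le> K * \<bar>x - y\<bar>" if "x \<in> {c..d}" "y \<in> {c..d}" for x y
      using delayed_iterate_lipschitz(2)[OF h(1) that] .
    show "\<bar>?u x\<bar> \<le> R + K * (d - c)" if "x \<in> {c..d}" for x
      using delayed_iterate_near_slope[OF h(1) that, of A s n] s by linarith
    show "continuous_on {c..d} ?u"
      by (rule delayed_iterate_lipschitz(1)[OF h(1)])
    show "?u x = ?u c + integral {c..x} (\<lambda>t. F t (A + integral {c..delay h t} ?u) (?u (delay h t)))"
      if "x \<in> {c..d}" for x
      using delayed_iterate_stable[OF h(1) that, of n A s] h(2) that
      by (simp add: delayed_iterate_at_start)
    show "A + integral {c..d} ?u = B"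
      using s(3) by (simp add: \<phi>_def)
  qed
qed

text \<open>The bounds on the delayed slopes and their Lipschitz constant do not depend on the
  delay, so a subsequence converges as the delay shrinks, and dominated convergence passes to the
  limit in the position and in the integral equation.\<close>

theorem Dirichlet_solution:
  obtains u where "continuous_on {c..d} u"
    "\<And>x. x \<in> {c..d} \<Longrightarrow> u x = u c + integral {c..x} (\<lambda>t. F t (A + integral {c..t} u) (u t))"
    "A + integral {c..d} u = B"
proof -
  define R where "R = \<bar>B - A\<bar> / (d - c) + K * (d - c)"
  define M where "M = R + K * (d - c)"
  define h where "h n = (d - c) / real (Suc n)" for n
  have h0: "h n \<ge> 0" for n
    using cd by (simp add: h_def)
  have h_lim: "h \<longlonglongrightarrow> 0"
    unfolding h_def using tendsto_mult_left[OF LIMSEQ_inverse_real_of_nat, of "d - c"]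
    by (simp add: divide_inverse)
  define P where "P n u \<longleftrightarrow> (\<forall>x\<in>{c..d}. \<forall>y\<in>{c..d}. \<bar>u x - u y\<bar> \<le> K * \<bar>x - y\<bar>) \<and>
    (\<forall>x\<in>{c..d}. \<bar>u x\<bar> \<le> M) \<and> continuous_on {c..d} u \<and>
    (\<forall>x\<in>{c..d}. u x = u c + integral {c..x} (\<lambda>t. F t (A + integral {c..delay (h n) t} u) (u (delay (h n) t)))) \<and>
    A + integral {c..d} u = B" for n u
  have "\<exists>u. P n u" for n
  proof (rule delayed_solution[of "Suc n" B A])
    show "0 < Suc n"
      by simp
    fix u
    assume "\<And>x y. \<lbrakk>x \<in> {c..d}; y \<in> {c..d}\<rbrakk> \<Longrightarrow> \<bar>u x - u y\<bar> \<le> K * \<bar>x - y\<bar>"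
      "\<And>x. x \<in> {c..d} \<Longrightarrow> \<bar>u x\<bar> \<le> \<bar>B - A\<bar> / (d - c) + K * (d - c) + K * (d - c)"
      "continuous_on {c..d} u"
      "\<And>x. x \<in> {c..d} \<Longrightarrow> u x = u c + integral {c..x}
         (\<lambda>t. F t (A + integral {c..delay ((d - c) / real (Suc n)) t} u) (u (delay ((d - c) / real (Suc n)) t)))"
      "A + integral {c..d} u = B"
    then have "P n u"
      unfolding P_def M_def R_def h_def by blast
    then show "\<exists>u. P n u"
      by blast
  qed
  then obtain u where u: "\<And>n. P n (u n)"
    by metis
  have lip: "\<And>n x y. \<lbrakk>x \<in> {c..d}; y \<in> {c..d}\<rbrakk> \<Longrightarrow> \<bar>u n x - u n y\<bar> \<le> K * \<bar>x - y\<bar>"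
    and bd: "\<And>n x. x \<in> {c..d} \<Longrightarrow> \<bar>u n x\<bar> \<le> M"
    and cu: "\<And>n. continuous_on {c..d} (u n)"
    and eq: "\<And>n x. x \<in> {c..d} \<Longrightarrow> u n x = u n c +
           integral {c..x} (\<lambda>t. F t (A + integral {c..delay (h n) t} (u n)) (u n (delay (h n) t)))"
    and end_val: "\<And>n. A + integral {c..d} (u n) = B"
    using u unfolding P_def by blast+
  obtain v r where v: "continuous_on {c..d} v" and r: "strict_mono (r :: nat \<Rightarrow> nat)"
    and lim: "\<And>x. x \<in> {c..d} \<Longrightarrow> (\<lambda>n. u (r n) x) \<longlonglongrightarrow> v x"
    using lipschitz_bounded_subsequence[of c d u M K] bd lip by blast
  have hr: "(\<lambda>n. h (r n)) \<longlonglongrightarrow> 0"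
    using LIMSEQ_subseq_LIMSEQ[OF h_lim r] by (simp add: o_def)
  have ui: "u n integrable_on {c..t}" if "t \<in> {c..d}" for n t
    using that by (intro integrable_continuous_real continuous_on_subset[OF cu]) auto
  have pos: "(\<lambda>n. integral {c..t} (u (r n))) \<longlonglongrightarrow> integral {c..t} v" if "t \<in> {c..d}" for t
    by (rule dominated_convergence_const(2)[where M = M]) (use that ui bd lim in auto)
  have dl: "\<bar>t - delay (h n) t\<bar> \<le> h n" if "t \<in> {c..d}" for n t
    using that h0[of n] by (auto simp: delay_def)
  \<comment> \<open>Function and argument vary together; the common Lipschitz constant bounds the
    effect of the shifted argument by \<open>K * h (r n)\<close>.\<close>
  have u_delay: "(\<lambda>n. u (r n) (delay (h (r n)) t)) \<longlonglongrightarrow> v t" if t: "t \<in> {c..d}" for t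
  proof (rule Lim_transform2[OF lim[OF t]])
    show "(\<lambda>n. u (r n) t - u (r n) (delay (h (r n)) t)) \<longlonglongrightarrow> 0"
    proof (rule Lim_null_comparison[OF always_eventually])
      show "\<forall>n. norm (u (r n) t - u (r n) (delay (h (r n)) t)) \<le> K * h (r n)"
      proof
        fix n
        have "\<bar>u (r n) t - u (r n) (delay (h (r n)) t)\<bar> \<le> K * \<bar>t - delay (h (r n)) t\<bar>"
          using t delay_mem[OF h0] by (intro lip)
        also have "\<dots> \<le> K * h (r n)"
          using dl[OF t] K_nonneg by (intro mult_left_mono) auto
        finally show "norm (u (r n) t - u (r n) (delay (h (r n)) t)) \<le> K * h (r n)"
          by simp
      qed
      show "(\<lambda>n. K * h (r n)) \<longlonglongrightarrow> 0"
        using tendsto_mult_right_zero[OF hr, of K] by simp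
    qed
  qed
  have M0: "M \<ge> 0"
    using bd[of c 0] cd by (auto intro: order_trans[OF abs_ge_zero])
  have pos_delay: "(\<lambda>n. integral {c..delay (h (r n)) t} (u (r n))) \<longlonglongrightarrow> integral {c..t} v"
    if t: "t \<in> {c..d}" for t
  proof (rule Lim_transform2[OF pos[OF t]])
    show "(\<lambda>n. integral {c..t} (u (r n)) - integral {c..delay (h (r n)) t} (u (r n))) \<longlonglongrightarrow> 0"
    proof (rule Lim_null_comparison[OF always_eventually])
      show "\<forall>n. norm (integral {c..t} (u (r n)) - integral {c..delay (h (r n)) t} (u (r n))) \<le> M * h (r n)"
      proof
        fix n
        have "\<bar>integral {c..t} (u (r n)) - integral {c..delay (h (r n)) t} (u (r n))\<bar> \<le> M * \<bar>t - delay (h (r n)) t\<bar>"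
          using t delay_mem[OF h0 t] cd by (intro integral_lipschitz[where c = c and d = d] ui bd) auto
        also have "\<dots> \<le> M * h (r n)"
          using dl[OF t] M0 by (intro mult_left_mono) auto
        finally show "norm (integral {c..t} (u (r n)) - integral {c..delay (h (r n)) t} (u (r n))) \<le> M * h (r n)"
          by simp
      qed
      show "(\<lambda>n. M * h (r n)) \<longlonglongrightarrow> 0"
        using tendsto_mult_right_zero[OF hr, of M] by simp
    qed
  qed
  show thesis
  proof (rule that[OF v])
    fix x
    assume x: "x \<in> {c..d}"
    have "(\<lambda>n. integral {c..x} (\<lambda>t. F t (A + integral {c..delay (h (r n)) t} (u (r n))) (u (r n) (delay (h (r n)) t))))
       \<longlonglongrightarrow> integral {c..x} (\<lambda>t. F t (A + integral {c..t} v) (v t))"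
    proof (rule dominated_convergence_const(2)[where M = K])
      fix t
      assume "t \<in> {c..x}"
      then have t: "t \<in> {c..d}"
        using x by auto
      show "(\<lambda>n. F t (A + integral {c..delay (h (r n)) t} (u (r n))) (u (r n) (delay (h (r n)) t)))
         \<longlonglongrightarrow> F t (A + integral {c..t} v) (v t)"
        by (intro cont t tendsto_add tendsto_const pos_delay u_delay)
    next
      fix n
      show "(\<lambda>t. F t (A + integral {c..delay (h (r n)) t} (u (r n))) (u (r n) (delay (h (r n)) t))) integrable_on {c..x}"
        using x by (intro integrable_on_subinterval[OF delayed_integrable[OF cu h0]]) auto
    qed (use x bound in auto)
    then have "(\<lambda>n. u (r n) c + integral {c..x} (\<lambda>t. F t (A + integral {c..delay (h (r n)) t} (u (r n))) (u (r n) (delay (h (r n)) t))))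
       \<longlonglongrightarrow> v c + integral {c..x} (\<lambda>t. F t (A + integral {c..t} v) (v t))"
      using cd by (intro tendsto_add lim) auto
    then have "(\<lambda>n. u (r n) x) \<longlonglongrightarrow> v c + integral {c..x} (\<lambda>t. F t (A + integral {c..t} v) (v t))"
      by (subst eq[OF x])
    then show "v x = v c + integral {c..x} (\<lambda>t. F t (A + integral {c..t} v) (v t))"
      using lim[OF x] LIMSEQ_unique by blast
  next
    have "(\<lambda>n. A + integral {c..d} (u (r n))) \<longlonglongrightarrow> A + integral {c..d} v"
      using cd by (intro tendsto_add tendsto_const pos) auto
    then show "A + integral {c..d} v = B"
      unfolding end_val using LIMSEQ_unique tendsto_const by blast
  qed
qed

end

section \<open>Solutions, and lower solutions in the sense of touching\<close>

lemma AC_of_integral_equation: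
  fixes u g :: "real \<Rightarrow> real"
  assumes g: "g integrable_on {c..d}" and K: "\<And>t. t \<in> {c..d} \<Longrightarrow> \<bar>g t\<bar> \<le> K"
    and u: "\<And>x. x \<in> {c..d} \<Longrightarrow> u x = s + integral {c..x} g"
  shows "abs_cont_on {c..d} u"
    and "AE x in lebesgue. x \<in> {c..d} \<longrightarrow> (u has_real_derivative g x) (at x within {c..d})"
proof -
  show "abs_cont_on {c..d} u"
    by (rule abs_cont_on_lipschitz[of _ _ K]) (use integral_lipschitz[OF g K] u in auto)
  show "AE x in lebesgue. x \<in> {c..d} \<longrightarrow> (u has_real_derivative g x) (at x within {c..d})"
    using AE_has_real_derivative_integral[OF g]
  proof (rule AE_mp, intro AE_I2 impI)
    fix x
    assume x: "x \<in> {c..d}"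
      and "x \<in> {c..d} \<longrightarrow> ((\<lambda>x. integral {c..x} g) has_real_derivative g x) (at x within {c..d})"
    then have "((\<lambda>x. s + integral {c..x} g) has_real_derivative g x) (at x within {c..d})"
      by (auto intro!: derivative_eq_intros)
    then show "(u has_real_derivative g x) (at x within {c..d})"
      by (rule has_field_derivative_transform_within[OF _ zero_less_one x]) (simp add: u)
  qed
qed

text \<open>The difference of \<open>u\<close> and the integral is absolutely continuous with
  derivative zero almost everywhere; monotonicity, applied to it and to its negative, makes it
  constant.\<close>

lemma AC_eq_integral_deriv:
  fixes u g :: "real \<Rightarrow> real"
  assumes ac: "abs_cont_on {c..d} u"
    and der: "AE x in lebesgue. x \<in> {c..d} \<longrightarrow> (u has_real_derivative g x) (at x within {c..d})"
    and g: "g integrable_on {c..d}" and K: "\<And>t. t \<in> {c..d} \<Longrightarrow> \<bar>g t\<bar> \<le> K"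
    and x: "x \<in> {c..d}"
  shows "u x = u c + integral {c..x} g"
proof -
  define w where "w = (\<lambda>x. u x - integral {c..x} g)"
  have I: "abs_cont_on {c..d} (\<lambda>x. integral {c..x} g)"
    using AC_of_integral_equation(1)[OF g K, of "\<lambda>x. integral {c..x} g" 0] by simp
  have wac: "abs_cont_on {c..x} w"
    unfolding w_def using x by (intro abs_cont_on_subset[OF abs_cont_on_diff[OF ac I]]) auto
  have der0: "AE y in lebesgue. y \<in> {c..x} \<longrightarrow> (w has_real_derivative 0) (at y within {c..x})"
    using der AE_has_real_derivative_integral[OF g]
  proof eventually_elim
    case (elim y)
    show ?case
    proof
      assume "y \<in> {c..x}"
      then have "(w has_real_derivative g y - g y) (at y within {c..d})"
        unfolding w_def using elim x by (intro DERIV_diff) auto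
      then show "(w has_real_derivative 0) (at y within {c..x})"
        using x by (auto intro: has_field_derivative_subset)
    qed
  qed
  have "w c \<le> w x"
  proof (rule abs_cont_on_nonneg_deriv_le[OF _ wac])
    show "AE y in lebesgue. y \<in> {c..x} \<longrightarrow> (\<exists>D\<ge>0. (w has_real_derivative D) (at y within {c..x}))"
      using der0 by eventually_elim blast
  qed (use x in auto)
  moreover have "- w c \<le> - w x"
  proof (rule abs_cont_on_nonneg_deriv_le[OF _ abs_cont_on_uminus[OF wac]])
    show "AE y in lebesgue. y \<in> {c..x} \<longrightarrow> (\<exists>D\<ge>0. ((\<lambda>x. - w x) has_real_derivative D) (at y within {c..x}))"
      using der0 by eventually_elim (metis DERIV_minus minus_zero order_refl)
  qed (use x in auto)
  ultimately show ?thesis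
    by (simp add: w_def)
qed

definition ode_solution ::
  "(real \<Rightarrow> real \<Rightarrow> real \<Rightarrow> real) \<Rightarrow> real \<Rightarrow> real \<Rightarrow> (real \<Rightarrow> real) \<Rightarrow> (real \<Rightarrow> real) \<Rightarrow> bool" where
  "ode_solution f c d V V' \<longleftrightarrow>
     (\<forall>x\<in>{c..d}. (V has_real_derivative V' x) (at x within {c..d})) \<and> abs_cont_on {c..d} V' \<and>
     (AE x in lebesgue. x \<in> {c..d} \<longrightarrow>
        (V' has_real_derivative f x (V x) (V' x)) (at x within {c..d}))"

text \<open>A weak notion of lower solution of \<open>V'' = f x V V'\<close> that covers both alternatives of the
  definition of \<open>PP_lower\<close> and, in addition, is closed under pointwise maxima: wherever \<open>\<alpha>\<close> can be
  touched from above by a differentiable function, it can be touched from below by a local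
  \<open>W\<^sup>2\<^sup>,\<^sup>1\<close> lower solution.\<close>

definition touching_lower :: "(real \<Rightarrow> real \<Rightarrow> real \<Rightarrow> real) \<Rightarrow> real \<Rightarrow> real \<Rightarrow> (real \<Rightarrow> real) \<Rightarrow> bool" where
  "touching_lower f c d \<alpha> \<longleftrightarrow>
     (\<forall>x0\<in>{c<..<d}. \<forall>W m. (W has_real_derivative m) (at x0) \<and>
        (\<forall>x\<in>{c..d}. \<alpha> x - W x \<le> \<alpha> x0 - W x0) \<longrightarrow>
        (\<exists>l u a a'. l < x0 \<and> x0 < u \<and> {l<..<u} \<subseteq> {c<..<d} \<and> a x0 = \<alpha> x0 \<and>
           (\<forall>x\<in>{l<..<u}. a x \<le> \<alpha> x \<and> (a has_real_derivative a' x) (at x)) \<and>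
           abs_cont_on {l<..<u} a' \<and>
           (AE x in lebesgue. x \<in> {l<..<u} \<longrightarrow>
              (\<exists>D. (a' has_real_derivative D) (at x) \<and> f x (a x) (a' x) \<le> D))))"

text \<open>The right-hand side that \<open>- V\<close> satisfies when \<open>V\<close> satisfies
  the equation with \<open>f\<close>; through it upper solutions and least solutions reduce to lower
  solutions and greatest ones.\<close>

definition reflect :: "(real \<Rightarrow> real \<Rightarrow> real \<Rightarrow> real) \<Rightarrow> real \<Rightarrow> real \<Rightarrow> real \<Rightarrow> real" where
  "reflect f = (\<lambda>x y z. - f x (- y) (- z))"

lemma reflect_reflect [simp]: "reflect (reflect f) = f"
  by (simp add: reflect_def)

definition touching_upper :: "(real \<Rightarrow> real \<Rightarrow> real \<Rightarrow> real) \<Rightarrow> real \<Rightarrow> real \<Rightarrow> (real \<Rightarrow> real) \<Rightarrow> bool" where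
  "touching_upper f c d \<beta> \<longleftrightarrow> touching_lower (reflect f) c d (\<lambda>x. - \<beta> x)"

lemma ode_solution_reflect:
  assumes "ode_solution f c d V V'"
  shows "ode_solution (reflect f) c d (\<lambda>x. - V x) (\<lambda>x. - V' x)"
proof -
  have "AE x in lebesgue. x \<in> {c..d} \<longrightarrow>
        ((\<lambda>x. - V' x) has_real_derivative reflect f x (- V x) (- V' x)) (at x within {c..d})"
    using assms unfolding ode_solution_def reflect_def
    by (auto elim!: eventually_mono intro!: DERIV_minus)
  then show ?thesis
    using assms unfolding ode_solution_def by (auto intro: DERIV_minus abs_cont_on_uminus)
qed

lemma ode_solution_imp_continuous_on:
  assumes "ode_solution f c d V V'"
  shows "continuous_on {c..d} V" "continuous_on {c..d} V'"
  using assms unfolding ode_solution_def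
  by (auto intro: abs_cont_on_imp_continuous_on DERIV_continuous_on)

lemma ode_solution_has_derivative_interior:
  assumes "ode_solution f c d V V'" "x \<in> {c<..<d}"
  shows "(V has_real_derivative V' x) (at x)"
  using assms unfolding ode_solution_def by (metis at_within_Icc_at greaterThanLessThan_iff atLeastAtMost_iff less_imp_le)

text \<open>At each point one of the two solutions attains the maximum and lies below it on the
  whole interval, so that solution is the required function touching from below, even where the
  maximum has a corner.\<close>

lemma touching_lower_max:
  assumes V: "ode_solution f c d V1 V1'" "ode_solution f c d V2 V2'"
  shows "touching_lower f c d (\<lambda>x. max (V1 x) (V2 x))"
  unfolding touching_lower_def
proof (intro ballI allI impI)
  fix x0 W m
  assume x0: "x0 \<in> {c<..<d}"
  obtain a a' where a: "ode_solution f c d a a'" "a x0 = max (V1 x0) (V2 x0)" "\<And>x. a x \<le> max (V1 x) (V2 x)"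
    using V by (metis max.cobounded1 max.cobounded2 max_def)
  have "AE x in lebesgue. x \<in> {c<..<d} \<longrightarrow>
              (\<exists>D. (a' has_real_derivative D) (at x) \<and> f x (a x) (a' x) \<le> D)"
    using a(1) unfolding ode_solution_def
  proof (elim conjE eventually_mono, intro impI)
    fix x
    assume "x \<in> {c..d} \<longrightarrow> (a' has_real_derivative f x (a x) (a' x)) (at x within {c..d})" "x \<in> {c<..<d}"
    then have "(a' has_real_derivative f x (a x) (a' x)) (at x)"
      by (metis at_within_Icc_at greaterThanLessThan_iff atLeastAtMost_iff less_imp_le)
    then show "\<exists>D. (a' has_real_derivative D) (at x) \<and> f x (a x) (a' x) \<le> D"
      by blast
  qed
  moreover have "abs_cont_on {c<..<d} a'"
    using a(1) unfolding ode_solution_def by (auto intro: abs_cont_on_subset)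
  moreover have "\<forall>x\<in>{c<..<d}. a x \<le> max (V1 x) (V2 x) \<and> (a has_real_derivative a' x) (at x)"
    using a(3) ode_solution_has_derivative_interior[OF a(1)] by blast
  ultimately show "\<exists>l u a a'. l < x0 \<and> x0 < u \<and> {l<..<u} \<subseteq> {c<..<d} \<and> a x0 = max (V1 x0) (V2 x0) \<and>
           (\<forall>x\<in>{l<..<u}. a x \<le> max (V1 x) (V2 x) \<and> (a has_real_derivative a' x) (at x)) \<and>
           abs_cont_on {l<..<u} a' \<and>
           (AE x in lebesgue. x \<in> {l<..<u} \<longrightarrow>
              (\<exists>D. (a' has_real_derivative D) (at x) \<and> f x (a x) (a' x) \<le> D))"
    using x0 a(2) by (intro exI[of _ c] exI[of _ d] exI[of _ a] exI[of _ a']) auto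
qed

section \<open>A priori bounds and compactness for sublinear right-hand sides\<close>

lemma sublinear_sqrt_bound:
  fixes a b M S :: real
  assumes "b \<ge> 0" "M + S \<ge> 0"
  shows "a + b * sqrt (M + S) \<le> a + b\<^sup>2 / 2 + (M + S) / 2"
proof -
  \<comment> \<open>Young's inequality: the root is traded for \<open>S\<close> with coefficient
    1/2, which an inequality of the form \<open>S \<le> a + b * sqrt (M + S)\<close> can absorb on
    its left.\<close>
  have "0 \<le> (b - sqrt (M + S))\<^sup>2"
    by simp
  also have "\<dots> = b\<^sup>2 - 2 * (b * sqrt (M + S)) + (M + S)"
    using assms by (simp add: power2_diff)
  finally have *: "0 \<le> b\<^sup>2 - 2 * (b * sqrt (M + S)) + (M + S)" .
  have "a + q \<le> a + p / 2 + r / 2" if "0 \<le> p - 2 * q + r" for p q r :: real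
    using that by linarith
  from this[OF *] show ?thesis .
qed

lemma continuous_on_Icc_bounded:
  fixes V :: "real \<Rightarrow> real"
  assumes "continuous_on {c..d} V"
  obtains M where "\<And>t. t \<in> {c..d} \<Longrightarrow> \<bar>V t\<bar> \<le> M"
  using compact_imp_bounded[OF compact_continuous_image[OF assms compact_Icc]]
  unfolding bounded_iff real_norm_def by blast

locale hoelder_field =
  fixes c d K :: real and f :: "real \<Rightarrow> real \<Rightarrow> real \<Rightarrow> real"
  assumes cd: "c < d"
    and hoelder: "\<And>x y z y' z'. x \<in> {c..d} \<Longrightarrow> \<bar>f x y z - f x y' z'\<bar> \<le> K * sqrt (\<bar>y - y'\<bar> + \<bar>z - z'\<bar>)"
    and zero: "\<And>x. x \<in> {c..d} \<Longrightarrow> f x 0 0 = 0"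
    and meas: "\<And>V u. \<lbrakk>continuous_on {c..d} V; continuous_on {c..d} u\<rbrakk> \<Longrightarrow>
                 (\<lambda>t. f t (V t) (u t)) \<in> borel_measurable (lebesgue_on {c..d})"

lemma hoelder_field_reflect:
  assumes "hoelder_field c d K f"
  shows "hoelder_field c d K (reflect f)"
proof -
  interpret hoelder_field c d K f
    by fact
  show ?thesis
  proof
    show "c < d"
      by (rule cd)
    show "\<bar>reflect f x y z - reflect f x y' z'\<bar> \<le> K * sqrt (\<bar>y - y'\<bar> + \<bar>z - z'\<bar>)"
      if "x \<in> {c..d}" for x y z y' z'
      using hoelder[OF that, of "- y" "- z" "- y'" "- z'"] by (simp add: reflect_def abs_minus_commute add.commute)
    show "reflect f x 0 0 = 0" if "x \<in> {c..d}" for x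
      using zero[OF that] by (simp add: reflect_def)
    show "(\<lambda>t. reflect f t (V t) (u t)) \<in> borel_measurable (lebesgue_on {c..d})"
      if "continuous_on {c..d} V" "continuous_on {c..d} u" for V u
      using meas[of "\<lambda>t. - V t" "\<lambda>t. - u t"] that by (auto simp: reflect_def intro!: continuous_intros)
  qed
qed

context hoelder_field
begin

lemma K_nonneg: "K \<ge> 0"
  using order_trans[OF abs_ge_zero hoelder[of c 1 0 0 0]] cd by simp

lemma growth: "x \<in> {c..d} \<Longrightarrow> \<bar>f x y z\<bar> \<le> K * sqrt (\<bar>y\<bar> + \<bar>z\<bar>)"
  using hoelder[of x y z 0 0] zero[of x] by simp

lemma growth_bound:
  assumes "x \<in> {c..d}" "\<bar>y\<bar> \<le> M" "\<bar>z\<bar> \<le> N"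
  shows "\<bar>f x y z\<bar> \<le> K * sqrt (M + N)"
proof -
  have "K * sqrt (\<bar>y\<bar> + \<bar>z\<bar>) \<le> K * sqrt (M + N)"
    using assms K_nonneg by (intro mult_left_mono real_sqrt_le_mono) auto
  then show ?thesis
    using growth[OF assms(1), of y z] by linarith
qed

lemma f_tendsto:
  assumes "t \<in> {c..d}" "Y \<longlonglongrightarrow> y" "Z \<longlonglongrightarrow> z"
  shows "(\<lambda>n. f t (Y n) (Z n)) \<longlonglongrightarrow> f t y z"
proof (rule LIM_zero_cancel, rule Lim_null_comparison[OF always_eventually])
  show "\<forall>n. norm (f t (Y n) (Z n) - f t y z) \<le> K * sqrt (\<bar>Y n - y\<bar> + \<bar>Z n - z\<bar>)"
    using hoelder[OF assms(1)] by simp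
  have "(\<lambda>n. K * sqrt (\<bar>Y n - y\<bar> + \<bar>Z n - z\<bar>)) \<longlonglongrightarrow> K * sqrt (\<bar>y - y\<bar> + \<bar>z - z\<bar>)"
    using assms by (intro tendsto_intros)
  then show "(\<lambda>n. K * sqrt (\<bar>Y n - y\<bar> + \<bar>Z n - z\<bar>)) \<longlonglongrightarrow> 0"
    by simp
qed

lemma f_integrable:
  assumes V: "continuous_on {c..d} V" and u: "continuous_on {c..d} u"
  shows "(\<lambda>t. f t (V t) (u t)) integrable_on {c..d}"
proof (rule measurable_bounded_by_integrable_imp_integrable[where g = "\<lambda>t. K * sqrt (\<bar>V t\<bar> + \<bar>u t\<bar>)"])
  show "(\<lambda>t. K * sqrt (\<bar>V t\<bar> + \<bar>u t\<bar>)) integrable_on {c..d}"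
    by (intro integrable_continuous_real continuous_intros V u)
qed (use meas[OF V u] growth in auto)

lemma ode_solutionI:
  assumes v: "continuous_on {c..d} v"
    and V: "\<And>x. x \<in> {c..d} \<Longrightarrow> V x = A + integral {c..x} v"
    and eq: "\<And>x. x \<in> {c..d} \<Longrightarrow> v x = s + integral {c..x} (\<lambda>t. f t (V t) (v t))"
  shows "ode_solution f c d V v"
proof -
  have *: "((\<lambda>x. A + integral {c..x} v) has_real_derivative v x) (at x within {c..d})" if "x \<in> {c..d}" for x
    using integral_has_real_derivative[OF v that] by (auto intro!: derivative_eq_intros)
  have der: "(V has_real_derivative v x) (at x within {c..d})" if "x \<in> {c..d}" for x
    by (rule has_field_derivative_transform_within[OF *[OF that] zero_less_one that]) (simp add: V)
  then have cV: "continuous_on {c..d} V"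
    using DERIV_continuous_on by blast
  obtain M N where M: "\<And>t. t \<in> {c..d} \<Longrightarrow> \<bar>V t\<bar> \<le> M" and N: "\<And>t. t \<in> {c..d} \<Longrightarrow> \<bar>v t\<bar> \<le> N"
    using continuous_on_Icc_bounded[OF cV] continuous_on_Icc_bounded[OF v] by metis
  show ?thesis
    unfolding ode_solution_def
    using der AC_of_integral_equation[OF f_integrable[OF cV v] growth_bound[OF _ M N] eq] by blast
qed

lemma ode_solution_integral:
  assumes sol: "ode_solution f c d V V'" and x: "x \<in> {c..d}"
  shows "V x = V c + integral {c..x} V'"
    and "V' x = V' c + integral {c..x} (\<lambda>t. f t (V t) (V' t))"
proof -
  note cont = ode_solution_imp_continuous_on[OF sol]
  have "(V' has_integral V x - V c) {c..x}"
  proof (rule fundamental_theorem_of_calculus)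
    show "(V has_vector_derivative V' t) (at t within {c..x})" if "t \<in> {c..x}" for t
    proof -
      have "(V has_real_derivative V' t) (at t within {c..d})"
        using sol that x unfolding ode_solution_def by auto
      then show ?thesis
        unfolding has_real_derivative_iff_has_vector_derivative[symmetric]
        by (rule has_field_derivative_subset) (use x in auto)
    qed
  qed (use x in auto)
  then show "V x = V c + integral {c..x} V'"
    by (simp add: integral_unique)
  obtain M N where M: "\<And>t. t \<in> {c..d} \<Longrightarrow> \<bar>V t\<bar> \<le> M" and N: "\<And>t. t \<in> {c..d} \<Longrightarrow> \<bar>V' t\<bar> \<le> N"
    using continuous_on_Icc_bounded[OF cont(1)] continuous_on_Icc_bounded[OF cont(2)] by metis
  show "V' x = V' c + integral {c..x} (\<lambda>t. f t (V t) (V' t))"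
    using sol unfolding ode_solution_def
    by (intro AC_eq_integral_deriv[OF _ _ f_integrable[OF cont] growth_bound[OF _ M N] x]) auto
qed

text \<open>All values of \<open>u\<close> lie within \<open>L * (d - c)\<close> of
  \<open>u x\<close>, hence so does the mean of \<open>u\<close> over the interval.\<close>

lemma slope_bound_of_lipschitz:
  fixes u :: "real \<Rightarrow> real"
  assumes u: "continuous_on {c..d} u" and lip: "\<And>x y. \<lbrakk>x \<in> {c..d}; y \<in> {c..d}\<rbrakk> \<Longrightarrow> \<bar>u x - u y\<bar> \<le> L * \<bar>x - y\<bar>"
    and L: "L \<ge> 0" and x: "x \<in> {c..d}"
  shows "\<bar>u x\<bar> \<le> \<bar>integral {c..d} u\<bar> / (d - c) + L * (d - c)"
proof -
  have near: "u x - L * (d - c) \<le> u t" "u t \<le> u x + L * (d - c)" if "t \<in> {c..d}" for t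
  proof -
    have "\<bar>u x - u t\<bar> \<le> L * \<bar>x - t\<bar>"
      using lip x that by blast
    also have "\<dots> \<le> L * (d - c)"
      using x that L by (intro mult_left_mono) auto
    finally show "u x - L * (d - c) \<le> u t" "u t \<le> u x + L * (d - c)"
      by linarith+
  qed
  have ui: "u integrable_on {c..d}"
    by (intro integrable_continuous_real u)
  have "integral {c..d} (\<lambda>_. u x - L * (d - c)) \<le> integral {c..d} u"
    by (intro integral_le ui near) auto
  moreover have "integral {c..d} u \<le> integral {c..d} (\<lambda>_. u x + L * (d - c))"
    by (intro integral_le ui near) auto
  ultimately have "(u x - L * (d - c)) * (d - c) \<le> \<bar>integral {c..d} u\<bar>"
    "- (u x + L * (d - c)) * (d - c) \<le> \<bar>integral {c..d} u\<bar>"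
    using cd by (auto simp: algebra_simps)
  then have "u x - L * (d - c) \<le> \<bar>integral {c..d} u\<bar> / (d - c)"
    "- (u x + L * (d - c)) \<le> \<bar>integral {c..d} u\<bar> / (d - c)"
    using cd by (simp_all only: pos_le_divide_eq diff_gt_0_iff_gt)
  then show ?thesis
    by (simp add: abs_le_iff)
qed

lemma ode_solution_lipschitz:
  assumes sol: "ode_solution f c d V V'" and M: "\<And>x. x \<in> {c..d} \<Longrightarrow> \<bar>V x\<bar> \<le> M"
    and S: "\<And>x. x \<in> {c..d} \<Longrightarrow> \<bar>V' x\<bar> \<le> S" and x: "x \<in> {c..d}" and y: "y \<in> {c..d}"
  shows "\<bar>V' x - V' y\<bar> \<le> K * sqrt (M + S) * \<bar>x - y\<bar>"
  using integral_lipschitz[OF f_integrable[OF ode_solution_imp_continuous_on[OF sol]] growth_bound[OF _ M S] x y]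
    ode_solution_integral(2)[OF sol x] ode_solution_integral(2)[OF sol y] by simp

text \<open>What remains of \<open>S \<le> 2 * M / (d - c) + K * (d - c) * sqrt (M + S)\<close>
  after Young's inequality, absorption of \<open>S / 2\<close> and multiplication by 2.\<close>

definition slope_bound :: "real \<Rightarrow> real" where
  "slope_bound M = 2 * (2 * M / (d - c)) + (K * (d - c))\<^sup>2 + M"

text \<open>The mean of \<open>V'\<close> is controlled by the end values of \<open>V\<close>, its
  oscillation by \<open>K * sqrt (M + S) * (d - c)\<close>, where \<open>S\<close> is the maximum of
  |V'|. Because \<open>S\<close> enters through a root, this self-referential bound closes for every
  size of \<open>K\<close> and of the interval.\<close>

lemma ode_solution_slope_bound:
  assumes sol: "ode_solution f c d V V'" and M: "\<And>x. x \<in> {c..d} \<Longrightarrow> \<bar>V x\<bar> \<le> M" and x: "x \<in> {c..d}"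
  shows "\<bar>V' x\<bar> \<le> slope_bound M"
proof -
  note cont = ode_solution_imp_continuous_on[OF sol]
  obtain x1 where x1: "x1 \<in> {c..d}" "\<And>y. y \<in> {c..d} \<Longrightarrow> \<bar>V' y\<bar> \<le> \<bar>V' x1\<bar>"
    using continuous_attains_sup[of "{c..d}" "\<lambda>x. \<bar>V' x\<bar>"] cont(2) x
    by (metis compact_Icc continuous_on_rabs empty_iff)
  define S where "S = \<bar>V' x1\<bar>"
  have M0: "M \<ge> 0"
    using M[OF x] by linarith
  have "integral {c..d} V' = V d - V c"
    using ode_solution_integral(1)[OF sol, of d] cd by simp
  then have "\<bar>integral {c..d} V'\<bar> \<le> 2 * M"
    using M[of d] M[of c] cd by simp
  then have "\<bar>integral {c..d} V'\<bar> / (d - c) \<le> 2 * M / (d - c)"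
    using cd by (simp add: divide_right_mono)
  moreover have "S \<le> \<bar>integral {c..d} V'\<bar> / (d - c) + K * sqrt (M + S) * (d - c)"
    unfolding S_def
    by (rule slope_bound_of_lipschitz[OF cont(2) ode_solution_lipschitz[OF sol M x1(2)]])
      (use K_nonneg M0 x1 in auto)
  ultimately have "S \<le> 2 * M / (d - c) + (K * (d - c)) * sqrt (M + S)"
    by (simp add: algebra_simps)
  also have "\<dots> \<le> 2 * M / (d - c) + (K * (d - c))\<^sup>2 / 2 + (M + S) / 2"
    using M0 K_nonneg cd by (intro sublinear_sqrt_bound) (auto simp: S_def)
  finally have *: "S \<le> 2 * M / (d - c) + (K * (d - c))\<^sup>2 / 2 + (M + S) / 2" .
  have "S \<le> slope_bound M"
  proof -
    have "S \<le> 2 * a + b + M" if "S \<le> a + b / 2 + (M + S) / 2" for a b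
      using that unfolding add_divide_distrib by linarith
    then show ?thesis
      using * unfolding slope_bound_def by blast
  qed
  then show ?thesis
    using x1(2)[OF x] by (simp add: S_def)
qed

text \<open>A bound on the values alone yields a bound on the slopes and then a common Lipschitz
  constant for them. Pointwise convergence of the solutions therefore suffices; a subsequence is
  taken only to make the slopes converge.\<close>

lemma ode_solution_limit:
  assumes sol: "\<And>n. ode_solution f c d (V n) (V' n)" and M: "\<And>n x. x \<in> {c..d} \<Longrightarrow> \<bar>V n x\<bar> \<le> M"
    and lim: "\<And>x. x \<in> {c..d} \<Longrightarrow> (\<lambda>n. V n x) \<longlonglongrightarrow> U x"
  shows "\<exists>U'. ode_solution f c d U U'"
proof -
  define N where "N = slope_bound M"
  have N: "\<bar>V' n x\<bar> \<le> N" if "x \<in> {c..d}" for n x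
    unfolding N_def by (rule ode_solution_slope_bound[OF sol M that])
  have lip: "\<bar>V' n x - V' n y\<bar> \<le> K * sqrt (M + N) * \<bar>x - y\<bar>" if "x \<in> {c..d}" "y \<in> {c..d}" for n x y
    by (rule ode_solution_lipschitz[OF sol M N that])
  obtain v r where v: "continuous_on {c..d} v" and r: "strict_mono (r :: nat \<Rightarrow> nat)"
    and v_lim: "\<And>x. x \<in> {c..d} \<Longrightarrow> (\<lambda>n. V' (r n) x) \<longlonglongrightarrow> v x"
    using lipschitz_bounded_subsequence[of c d V' N] N lip by metis
  have V_lim: "(\<lambda>n. V (r n) x) \<longlonglongrightarrow> U x" if "x \<in> {c..d}" for x
    using LIMSEQ_subseq_LIMSEQ[OF lim[OF that] r] by (simp add: o_def)
  note cont = ode_solution_imp_continuous_on[OF sol]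
  have "ode_solution f c d U v"
  proof (rule ode_solutionI[OF v])
    fix x
    assume x: "x \<in> {c..d}"
    have "(\<lambda>n. integral {c..x} (V' (r n))) \<longlonglongrightarrow> integral {c..x} v"
      by (rule dominated_convergence_const(2)[where M = N])
        (use x N v_lim in \<open>auto intro!: integrable_continuous_real continuous_on_subset[OF cont(2)]\<close>)
    then have "(\<lambda>n. V (r n) c + integral {c..x} (V' (r n))) \<longlonglongrightarrow> U c + integral {c..x} v"
      using cd by (intro tendsto_add V_lim) auto
    then have "(\<lambda>n. V (r n) x) \<longlonglongrightarrow> U c + integral {c..x} v"
      by (subst ode_solution_integral(1)[OF sol x])
    then show "U x = U c + integral {c..x} v"
      using V_lim[OF x] LIMSEQ_unique by blast
    have "(\<lambda>n. integral {c..x} (\<lambda>t. f t (V (r n) t) (V' (r n) t))) \<longlonglongrightarrow> integral {c..x} (\<lambda>t. f t (U t) (v t))"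
    proof (rule dominated_convergence_const(2)[where M = "K * sqrt (M + N)"])
      show "(\<lambda>t. f t (V (r n) t) (V' (r n) t)) integrable_on {c..x}" for n
        using x by (intro integrable_on_subinterval[OF f_integrable[OF cont]]) auto
      show "\<bar>f t (V (r n) t) (V' (r n) t)\<bar> \<le> K * sqrt (M + N)" if "t \<in> {c..x}" for n t
        using x that by (intro growth_bound M N) auto
      show "(\<lambda>n. f t (V (r n) t) (V' (r n) t)) \<longlonglongrightarrow> f t (U t) (v t)" if "t \<in> {c..x}" for t
        using x that by (intro f_tendsto V_lim v_lim) auto
    qed
    then have "(\<lambda>n. V' (r n) c + integral {c..x} (\<lambda>t. f t (V (r n) t) (V' (r n) t)))
         \<longlonglongrightarrow> v c + integral {c..x} (\<lambda>t. f t (U t) (v t))"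
      using cd by (intro tendsto_add v_lim) auto
    then have "(\<lambda>n. V' (r n) x) \<longlonglongrightarrow> v c + integral {c..x} (\<lambda>t. f t (U t) (v t))"
      by (subst ode_solution_integral(2)[OF sol x])
    then show "v x = v c + integral {c..x} (\<lambda>t. f t (U t) (v t))"
      using v_lim[OF x] LIMSEQ_unique by blast
  qed
  then show ?thesis
    by blast
qed

end

section \<open>Solutions between a lower and an upper solution\<close>

context hoelder_field
begin

text \<open>At a positive maximum of \<open>\<alpha> - V\<close> the touching function
  \<open>a\<close> has the value of \<open>\<alpha>\<close> and the slope of \<open>V\<close>.
  Nearby, the derivative of \<open>V'\<close> lies below \<open>f x (\<alpha> x) (V' x)\<close> by
  the penalty \<open>min 1 (\<alpha> x - V x)\<close>, while that of \<open>a'\<close> is at least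
  \<open>f x (a x) (a' x)\<close>. The Hoelder estimate makes these values of \<open>f\<close>
  close, so the penalty prevails and \<open>a - V\<close> increases to the right of the maximum
  point, which contradicts maximality.\<close>

lemma comparison_lower:
  assumes cont_\<alpha>: "continuous_on {c..d} \<alpha>" and touch: "touching_lower f c d \<alpha>"
    and der: "\<And>x. x \<in> {c..d} \<Longrightarrow> (V has_real_derivative V' x) (at x within {c..d})"
    and ac: "abs_cont_on {c..d} V'"
    and ineq: "AE x in lebesgue. x \<in> {c..d} \<longrightarrow> V x < \<alpha> x \<longrightarrow>
       (\<exists>D. (V' has_real_derivative D) (at x within {c..d}) \<and> D \<le> f x (\<alpha> x) (V' x) - min 1 (\<alpha> x - V x))"
    and ends: "\<alpha> c \<le> V c" "\<alpha> d \<le> V d"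
    and x: "x \<in> {c..d}"
  shows "\<alpha> x \<le> V x"
proof (rule ccontr)
  assume "\<not> \<alpha> x \<le> V x"
  have cont_V: "continuous_on {c..d} V"
    using der DERIV_continuous_on by blast
  have "continuous_on {c..d} (\<lambda>x. \<alpha> x - V x)"
    by (intro continuous_intros cont_V cont_\<alpha>)
  then obtain x0 where x0: "x0 \<in> {c..d}" "\<And>y. y \<in> {c..d} \<Longrightarrow> \<alpha> y - V y \<le> \<alpha> x0 - V x0"
    using continuous_attains_sup[of "{c..d}" "\<lambda>x. \<alpha> x - V x"] x by (metis compact_Icc empty_iff)
  define \<eta> where "\<eta> = \<alpha> x0 - V x0"
  have \<eta>: "\<eta> > 0"
    using x0(2)[OF x] \<open>\<not> \<alpha> x \<le> V x\<close> by (simp add: \<eta>_def)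
  then have "x0 \<noteq> c" "x0 \<noteq> d"
    using ends by (auto simp: \<eta>_def)
  then have x0': "x0 \<in> {c<..<d}"
    using x0 by auto
  have V_at: "(V has_real_derivative V' y) (at y)" if "y \<in> {c<..<d}" for y
    using der[of y] that by (metis at_within_Icc_at greaterThanLessThan_iff atLeastAtMost_iff less_imp_le)
  \<comment> \<open>\<open>V\<close> itself is the test function: up to an additive constant it
    touches \<open>\<alpha>\<close> from above at \<open>x0\<close>.\<close>
  have "\<exists>l u a a'. l < x0 \<and> x0 < u \<and> {l<..<u} \<subseteq> {c<..<d} \<and> a x0 = \<alpha> x0 \<and>
           (\<forall>x\<in>{l<..<u}. a x \<le> \<alpha> x \<and> (a has_real_derivative a' x) (at x)) \<and>
           abs_cont_on {l<..<u} a' \<and>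
           (AE x in lebesgue. x \<in> {l<..<u} \<longrightarrow>
              (\<exists>D. (a' has_real_derivative D) (at x) \<and> f x (a x) (a' x) \<le> D))"
    by (rule touch[unfolded touching_lower_def, rule_format, OF x0', OF conjI, OF V_at[OF x0']])
      (use x0(2) in blast)
  then obtain l u a a' where lu: "l < x0" "x0 < u" "{l<..<u} \<subseteq> {c<..<d}" and a0: "a x0 = \<alpha> x0"
    and a_ball: "\<forall>x\<in>{l<..<u}. a x \<le> \<alpha> x \<and> (a has_real_derivative a' x) (at x)"
    and a'_ac: "abs_cont_on {l<..<u} a'"
    and a'_ineq: "AE x in lebesgue. x \<in> {l<..<u} \<longrightarrow>
              (\<exists>D. (a' has_real_derivative D) (at x) \<and> f x (a x) (a' x) \<le> D)"
    by blast
  have a: "a x \<le> \<alpha> x" "(a has_real_derivative a' x) (at x)" if "x \<in> {l<..<u}" for x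
    using a_ball that by auto
  have g_max: "a y - V y \<le> a x0 - V x0" if "y \<in> {l<..<u}" for y
    using a(1)[OF that] x0(2)[of y] a0 lu(3) that by fastforce
  have slope0: "a' x0 = V' x0"
  proof -
    have "((\<lambda>x. a x - V x) has_real_derivative a' x0 - V' x0) (at x0)"
      using a(2)[of x0] V_at[OF x0'] lu by (auto intro: DERIV_diff)
    moreover have "\<forall>y. \<bar>x0 - y\<bar> < min (x0 - l) (u - x0) \<longrightarrow> a y - V y \<le> a x0 - V x0"
      by (intro allI impI g_max) auto
    ultimately have "a' x0 - V' x0 = 0"
      using lu DERIV_local_max[of "\<lambda>x. a x - V x" "a' x0 - V' x0" x0 "min (x0 - l) (u - x0)"] by auto
    then show ?thesis
      by simp
  qed
  have isC: "isCont \<alpha> x0" "isCont V x0" "isCont V' x0"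
    using continuous_on_interior[OF cont_\<alpha>] continuous_on_interior[OF cont_V]
      continuous_on_interior[OF abs_cont_on_imp_continuous_on[OF ac]] x0' by auto
  have isCa: "isCont a x0"
    using a(2)[of x0] lu DERIV_isCont by auto
  have isCa': "isCont a' x0"
  proof -
    have "{(l + x0) / 2..(x0 + u) / 2} \<subseteq> {l<..<u}"
      using lu by (auto simp: field_simps)
    then have "continuous_on {(l + x0) / 2..(x0 + u) / 2} a'"
      by (intro abs_cont_on_imp_continuous_on abs_cont_on_subset[OF a'_ac])
    moreover have "x0 \<in> interior {(l + x0) / 2..(x0 + u) / 2}"
      using lu by (auto simp: field_simps)
    ultimately show ?thesis
      by (rule continuous_on_interior)
  qed
  \<comment> \<open>A lower bound for the penalty near \<open>x0\<close>, where
    \<open>\<alpha> - V\<close> exceeds half its maximum. Half of \<open>\<delta>\<close> is spent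
    on the Hoelder error, the other half survives as growth of \<open>a' - V'\<close>.\<close>
  define \<delta> where "\<delta> = min 1 (\<eta> / 2)"
  have \<delta>: "\<delta> > 0"
    using \<eta> by (simp add: \<delta>_def)
  have "((\<lambda>x. K * sqrt (\<bar>a x - \<alpha> x\<bar> + \<bar>a' x - V' x\<bar>)) \<longlongrightarrow> K * sqrt (\<bar>a x0 - \<alpha> x0\<bar> + \<bar>a' x0 - V' x0\<bar>)) (at x0)"
    using isC isCa isCa' unfolding isCont_def by (intro tendsto_intros)
  then have "((\<lambda>x. K * sqrt (\<bar>a x - \<alpha> x\<bar> + \<bar>a' x - V' x\<bar>)) \<longlongrightarrow> 0) (at x0)"
    by (simp add: a0 slope0)
  then have ev1: "\<forall>\<^sub>F x in at x0. K * sqrt (\<bar>a x - \<alpha> x\<bar> + \<bar>a' x - V' x\<bar>) < \<delta> / 2"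
    by (rule order_tendstoD(2)) (use \<delta> in simp)
  have "((\<lambda>x. \<alpha> x - V x) \<longlongrightarrow> \<eta>) (at x0)"
    using isC unfolding isCont_def \<eta>_def by (intro tendsto_intros)
  then have ev2: "\<forall>\<^sub>F x in at x0. \<eta> / 2 < \<alpha> x - V x"
    by (rule order_tendstoD(1)) (use \<eta> in simp)
  obtain r where r: "r > 0" "\<And>y. \<lbrakk>y \<noteq> x0; dist y x0 < r\<rbrakk> \<Longrightarrow>
      K * sqrt (\<bar>a y - \<alpha> y\<bar> + \<bar>a' y - V' y\<bar>) < \<delta> / 2 \<and> \<eta> / 2 < \<alpha> y - V y"
    using eventually_conj[OF ev1 ev2] unfolding eventually_at by blast
  define x1 where "x1 = x0 + min r (u - x0) / 2"
  have x1: "x0 < x1" "x1 - x0 < r" "x1 < u"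
    using r(1) lu by (auto simp: x1_def min_def field_simps)
  have sub: "{x0..x1} \<subseteq> {l<..<u}" "{x0..x1} \<subseteq> {c..d}"
    using x1 lu by (auto simp: subset_eq) (meson greaterThanLessThan_iff less_imp_le less_le_trans lu(3) order_le_less_trans subsetD)+
  \<comment> \<open>If \<open>g\<close> is nondecreasing, then \<open>a' - V'\<close>, which
    vanishes at \<open>x0\<close>, is at least \<open>\<delta> / 2 * (y - x0)\<close> and thus
    positive to the right.\<close>
  define g where "g = (\<lambda>y. a' y - V' y - \<delta> / 2 * y)"
  have g_mono: "g x0 \<le> g y" if y: "y \<in> {x0..x1}" for y
  proof (rule abs_cont_on_nonneg_deriv_le[where g = g])
    show "x0 \<le> y"
      using y by simp
    have suby: "{x0..y} \<subseteq> {l<..<u}" "{x0..y} \<subseteq> {c..d}"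
      using sub y by (auto simp: subset_eq)
    have "abs_cont_on {x0..y} (\<lambda>y. \<delta> / 2 * y)"
      by (rule abs_cont_on_linear)
    then show "abs_cont_on {x0..y} g"
      unfolding g_def
      by (intro abs_cont_on_diff abs_cont_on_subset[OF a'_ac] abs_cont_on_subset[OF ac] suby)
    show "AE t in lebesgue. t \<in> {x0..y} \<longrightarrow> (\<exists>D\<ge>0. (g has_real_derivative D) (at t within {x0..y}))"
      \<comment> \<open>The closeness estimates are known on a punctured neighbourhood; the point
        \<open>x0\<close> is discarded as a null set.\<close>
      using a'_ineq ineq AE_completion[OF AE_lborel_singleton[of x0]]
    proof eventually_elim
      case (elim t)
      show ?case
      proof
        assume t: "t \<in> {x0..y}"
        then have t': "t \<in> {l<..<u}" "t \<in> {c..d}"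
          using suby by auto
        have "dist t x0 < r"
          using t y x1 by (auto simp: dist_real_def)
        then have small: "K * sqrt (\<bar>a t - \<alpha> t\<bar> + \<bar>a' t - V' t\<bar>) < \<delta> / 2" "\<eta> / 2 < \<alpha> t - V t"
          using r(2) elim(3) by auto
        obtain D1 where D1: "(a' has_real_derivative D1) (at t)" "f t (a t) (a' t) \<le> D1"
          using elim(1) t' by blast
        have "V t < \<alpha> t"
          using small(2) \<eta> by simp
        then obtain D2 where D2: "(V' has_real_derivative D2) (at t within {c..d})"
          "D2 \<le> f t (\<alpha> t) (V' t) - min 1 (\<alpha> t - V t)"
          using elim(2) t' by blast
        have "\<bar>f t (a t) (a' t) - f t (\<alpha> t) (V' t)\<bar> < \<delta> / 2"
          using hoelder[OF t'(2), of "a t" "a' t" "\<alpha> t" "V' t"] small(1) by linarith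
        moreover have "\<delta> \<le> min 1 (\<alpha> t - V t)"
          using small(2) by (auto simp: \<delta>_def)
        ultimately have "0 \<le> D1 - D2 - \<delta> / 2"
          using D1(2) D2(2) by linarith
        moreover have "(a' has_real_derivative D1) (at t within {x0..y})"
          using D1(1) by (rule has_field_derivative_at_within)
        moreover have "(V' has_real_derivative D2) (at t within {x0..y})"
          using D2(1) suby(2) by (rule has_field_derivative_subset)
        ultimately show "\<exists>D\<ge>0. (g has_real_derivative D) (at t within {x0..y})"
          unfolding g_def by (intro exI[of _ "D1 - D2 - \<delta> / 2"] conjI) (auto intro!: derivative_eq_intros)
      qed
    qed
  qed
  have "a x0 - V x0 < a x1 - V x1"
  proof (rule DERIV_pos_imp_increasing_open[OF x1(1)])
    fix y
    assume y: "x0 < y" "y < x1"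
    then have "y \<in> {l<..<u}"
      using lu x1 by auto
    moreover from this have "y \<in> {c<..<d}"
      using lu(3) by blast
    ultimately have "((\<lambda>x. a x - V x) has_real_derivative a' y - V' y) (at y)"
      using a(2) V_at by (intro DERIV_diff) auto
    moreover have "a' y - V' y > 0"
    proof -
      have "\<delta> / 2 * y > \<delta> / 2 * x0"
        using y \<delta> by simp
      then show ?thesis
        using g_mono[of y] y slope0 by (simp add: g_def)
    qed
    ultimately show "\<exists>D. ((\<lambda>x. a x - V x) has_real_derivative D) (at y) \<and> 0 < D"
      by blast
  next
    have "continuous_on {x0..x1} a"
      by (intro DERIV_continuous_on[of _ _ a'] has_field_derivative_at_within[OF a(2)]) (use sub(1) in blast)
    then show "continuous_on {x0..x1} (\<lambda>x. a x - V x)"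
      by (intro continuous_intros continuous_on_subset[OF cont_V] sub)
  qed
  with g_max[of x1] x1 lu show False
    by auto
qed

text \<open>Values are truncated to [\<alpha>, \<beta>] with a penalty, slopes to [-N, N].
  Comparison removes the first truncation; the second never acts because \<open>N\<close> bounds the
  slopes of the truncated solution. That bound depends on \<open>N\<close> again through
  \<open>K0\<close>, and sublinear growth breaks the circle.\<close>

theorem Dirichlet_between:
  assumes cont: "continuous_on {c..d} \<alpha>" "continuous_on {c..d} \<beta>"
    and lower: "touching_lower f c d \<alpha>" and upper: "touching_upper f c d \<beta>"
    and le: "\<And>x. x \<in> {c..d} \<Longrightarrow> \<alpha> x \<le> \<beta> x"
    and A: "\<alpha> c \<le> A" "A \<le> \<beta> c" and B: "\<alpha> d \<le> B" "B \<le> \<beta> d"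
  shows "\<exists>V V'. ode_solution f c d V V' \<and> V c = A \<and> V d = B \<and> (\<forall>x\<in>{c..d}. \<alpha> x \<le> V x \<and> V x \<le> \<beta> x)"
proof -
  obtain M1 M2 where M1: "\<And>t. t \<in> {c..d} \<Longrightarrow> \<bar>\<alpha> t\<bar> \<le> M1" and M2: "\<And>t. t \<in> {c..d} \<Longrightarrow> \<bar>\<beta> t\<bar> \<le> M2"
    using continuous_on_Icc_bounded[OF cont(1)] continuous_on_Icc_bounded[OF cont(2)] by metis
  define M where "M = max M1 M2"
  have M: "\<bar>\<alpha> t\<bar> \<le> M" "\<bar>\<beta> t\<bar> \<le> M" if "t \<in> {c..d}" for t
    using M1[OF that] M2[OF that] by (auto simp: M_def)
  have M0: "M \<ge> 0"
    using M[of c] cd by auto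
  \<comment> \<open>The part of the slope bound that does not involve \<open>N\<close>: the mean
    slope, and the penalty of size at most 1 over the interval. \<open>N\<close> then solves
    \<open>N = s + (K * (d - c))^2 / 2 + (M + N) / 2\<close>, so Young's inequality ends exactly at
    \<open>N\<close>.\<close>
  define s where "s = \<bar>B - A\<bar> / (d - c) + (d - c)"
  define N where "N = 2 * s + (K * (d - c))\<^sup>2 + M"
  have s0: "s \<ge> 0"
    using cd by (simp add: s_def)
  have N0: "N \<ge> 0"
    using M0 s0 by (simp add: N_def)
  define K0 where "K0 = K * sqrt (M + N) + 1"
  have K0: "K0 \<ge> 0"
    using K_nonneg M0 N0 by (simp add: K0_def)
  have K0_N: "\<bar>B - A\<bar> / (d - c) + K0 * (d - c) \<le> N"
  proof -
    have "\<bar>B - A\<bar> / (d - c) + K0 * (d - c) = s + (K * (d - c)) * sqrt (M + N)"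
      by (simp add: s_def K0_def algebra_simps)
    also have "\<dots> \<le> s + (K * (d - c))\<^sup>2 / 2 + (M + N) / 2"
      using K_nonneg cd M0 N0 by (intro sublinear_sqrt_bound) auto
    also have "\<dots> = N"
      by (simp add: N_def field_simps)
    finally show ?thesis .
  qed
  define tr where "tr t y = max (\<alpha> t) (min (\<beta> t) y)" for t y
  define cl where "cl L z = max (- L) (min L z)" for L z :: real
  \<comment> \<open>The last term vanishes inside [\<alpha>, \<beta>] and has the strict sign of the
    excess outside; it supplies the penalty in \<open>comparison_lower\<close>, and its cap at 1
    keeps \<open>F\<close> bounded.\<close>
  define F where "F t y z = f t (tr t y) (cl N z) + cl 1 (y - tr t y)" for t y z
  have tr_bound: "\<bar>tr t y\<bar> \<le> M" if "t \<in> {c..d}" for t y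
    using M[OF that] le[OF that] by (auto simp: tr_def)
  have cl_bound: "\<bar>cl L z\<bar> \<le> L" if "L \<ge> 0" for L z
    using that by (auto simp: cl_def)
  have F_bound: "\<bar>F t y z\<bar> \<le> K0" if "t \<in> {c..d}" for t y z
  proof -
    have "\<bar>f t (tr t y) (cl N z)\<bar> \<le> K * sqrt (M + N)"
      by (intro growth_bound that tr_bound cl_bound N0)
    moreover have "\<bar>cl 1 (y - tr t y)\<bar> \<le> 1"
      by (rule cl_bound) simp
    ultimately show ?thesis
      unfolding F_def K0_def by linarith
  qed
  have F_meas: "(\<lambda>t. F t (V t) (u t)) \<in> borel_measurable (lebesgue_on {c..d})"
    if "continuous_on {c..d} V" "continuous_on {c..d} u" for V u
  proof -
    have c1: "continuous_on {c..d} (\<lambda>t. tr t (V t))" "continuous_on {c..d} (\<lambda>t. cl N (u t))"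
      "continuous_on {c..d} (\<lambda>t. cl 1 (V t - tr t (V t)))"
      unfolding tr_def cl_def using that cont by (auto intro!: continuous_intros)
    show ?thesis
      unfolding F_def
      by (intro borel_measurable_add meas c1 continuous_imp_measurable_on_sets_lebesgue) auto
  qed
  interpret F: bounded_caratheodory c d K0 F
  proof
    show "(\<lambda>n. F t (Y n) (Z n)) \<longlonglongrightarrow> F t y z" if "t \<in> {c..d}" "Y \<longlonglongrightarrow> y" "Z \<longlonglongrightarrow> z" for t Y Z y z
    proof -
      have tr: "(\<lambda>n. tr t (Y n)) \<longlonglongrightarrow> tr t y"
        unfolding tr_def using that by (intro tendsto_intros)
      then have "(\<lambda>n. cl 1 (Y n - tr t (Y n))) \<longlonglongrightarrow> cl 1 (y - tr t y)"
        unfolding cl_def using that by (intro tendsto_intros)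
      moreover have "(\<lambda>n. cl N (Z n)) \<longlonglongrightarrow> cl N z"
        unfolding cl_def using that by (intro tendsto_intros)
      ultimately show ?thesis
        unfolding F_def using tr that by (intro tendsto_add f_tendsto)
    qed
  qed (use cd F_meas F_bound in auto)
  obtain u where u: "continuous_on {c..d} u"
    "\<And>x. x \<in> {c..d} \<Longrightarrow> u x = u c + integral {c..x} (\<lambda>t. F t (A + integral {c..t} u) (u t))"
    "A + integral {c..d} u = B"
    using F.Dirichlet_solution[of A B] by blast
  define V where "V x = A + integral {c..x} u" for x
  have V_der: "(V has_real_derivative u x) (at x within {c..d})" if "x \<in> {c..d}" for x
    unfolding V_def using integral_has_real_derivative[OF u(1) that] by (auto intro!: derivative_eq_intros)
  then have cont_V: "continuous_on {c..d} V"
    using DERIV_continuous_on by blast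
  have V_ends: "V c = A" "V d = B"
    using u(3) by (auto simp: V_def)
  have u_eq: "u x = u c + integral {c..x} (\<lambda>t. F t (V t) (u t))" if "x \<in> {c..d}" for x
    using u(2)[OF that] by (simp add: V_def)
  have u_ac: "abs_cont_on {c..d} u"
    and u_der: "AE x in lebesgue. x \<in> {c..d} \<longrightarrow> (u has_real_derivative F x (V x) (u x)) (at x within {c..d})"
    using AC_of_integral_equation[OF F.F_integrable[OF cont_V u(1)] F_bound u_eq] by auto
  have u_bound: "\<bar>u x\<bar> \<le> N" if "x \<in> {c..d}" for x
  proof -
    have "\<bar>u x - u y\<bar> \<le> K0 * \<bar>x - y\<bar>" if "x \<in> {c..d}" "y \<in> {c..d}" for x y
      using integral_lipschitz[OF F.F_integrable[OF cont_V u(1)] F_bound that] u_eq[OF that(1)] u_eq[OF that(2)] by simp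
    from slope_bound_of_lipschitz[OF u(1) this K0 that]
    have "\<bar>u x\<bar> \<le> \<bar>integral {c..d} u\<bar> / (d - c) + K0 * (d - c)" .
    moreover have "integral {c..d} u = B - A"
      using u(3) by simp
    ultimately show ?thesis
      using K0_N by simp
  qed
  then have cl_u: "cl N (u x) = u x" if "x \<in> {c..d}" for x
    using that by (fastforce simp: cl_def abs_le_iff)
  have ge: "\<alpha> x \<le> V x" if "x \<in> {c..d}" for x
  proof (rule comparison_lower[OF cont(1) lower V_der u_ac])
    show "AE x in lebesgue. x \<in> {c..d} \<longrightarrow> V x < \<alpha> x \<longrightarrow>
       (\<exists>D. (u has_real_derivative D) (at x within {c..d}) \<and> D \<le> f x (\<alpha> x) (u x) - min 1 (\<alpha> x - V x))"
      using u_der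
    proof eventually_elim
      case (elim x)
      show ?case
      proof (intro impI)
        assume x: "x \<in> {c..d}" "V x < \<alpha> x"
        then have "tr x (V x) = \<alpha> x"
          using le[OF x(1)] by (auto simp: tr_def)
        then have "F x (V x) (u x) = f x (\<alpha> x) (u x) - min 1 (\<alpha> x - V x)"
          using x by (simp add: F_def cl_u) (auto simp: cl_def min_def max_def)
        then show "\<exists>D. (u has_real_derivative D) (at x within {c..d}) \<and> D \<le> f x (\<alpha> x) (u x) - min 1 (\<alpha> x - V x)"
          using elim x by auto
      qed
    qed
  qed (use A B V_ends that in auto)
  \<comment> \<open>Under reflection the penalty keeps its form, and the bound from above becomes a
    bound from below for \<open>- V\<close> by \<open>- \<beta>\<close>.\<close>
  have le': "V x \<le> \<beta> x" if "x \<in> {c..d}" for x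
  proof -
    interpret R: hoelder_field c d K "reflect f"
      by (rule hoelder_field_reflect) unfold_locales
    have "- \<beta> x \<le> - V x"
    proof (rule R.comparison_lower[where \<alpha> = "\<lambda>x. - \<beta> x" and V = "\<lambda>x. - V x" and V' = "\<lambda>x. - u x"])
      show "continuous_on {c..d} (\<lambda>x. - \<beta> x)"
        by (intro continuous_intros cont)
      show "touching_lower (reflect f) c d (\<lambda>x. - \<beta> x)"
        using upper by (simp add: touching_upper_def)
      show "((\<lambda>x. - V x) has_real_derivative - u x) (at x within {c..d})" if "x \<in> {c..d}" for x
        by (intro DERIV_minus V_der that)
      show "abs_cont_on {c..d} (\<lambda>x. - u x)"
        by (intro abs_cont_on_uminus u_ac)
      show "AE x in lebesgue. x \<in> {c..d} \<longrightarrow> - V x < - \<beta> x \<longrightarrow>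
         (\<exists>D. ((\<lambda>x. - u x) has_real_derivative D) (at x within {c..d}) \<and>
              D \<le> reflect f x (- \<beta> x) (- u x) - min 1 (- \<beta> x - - V x))"
        using u_der
      proof eventually_elim
        case (elim x)
        show ?case
        proof (intro impI)
          assume x: "x \<in> {c..d}" "- V x < - \<beta> x"
          then have "tr x (V x) = \<beta> x"
            using le[OF x(1)] by (auto simp: tr_def)
          then have "- F x (V x) (u x) = reflect f x (- \<beta> x) (- u x) - min 1 (- \<beta> x - - V x)"
            using x by (simp add: F_def cl_u reflect_def) (auto simp: cl_def min_def max_def)
          moreover have "((\<lambda>x. - u x) has_real_derivative - F x (V x) (u x)) (at x within {c..d})"
            using elim x by (intro DERIV_minus) auto
          ultimately show "\<exists>D. ((\<lambda>x. - u x) has_real_derivative D) (at x within {c..d}) \<and>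
              D \<le> reflect f x (- \<beta> x) (- u x) - min 1 (- \<beta> x - - V x)"
            by auto
        qed
      qed
    qed (use A B V_ends that in auto)
    then show ?thesis
      by simp
  qed
  have "ode_solution f c d V u"
    unfolding ode_solution_def
  proof (intro conjI ballI V_der u_ac)
    show "AE x in lebesgue. x \<in> {c..d} \<longrightarrow> (u has_real_derivative f x (V x) (u x)) (at x within {c..d})"
      using u_der
    proof eventually_elim
      case (elim x)
      show ?case
      proof
        assume x: "x \<in> {c..d}"
        then have "tr x (V x) = V x"
          using ge le' by (simp add: tr_def)
        then have "F x (V x) (u x) = f x (V x) (u x)"
          using cl_u[OF x] by (simp add: F_def cl_def)
        then show "(u has_real_derivative f x (V x) (u x)) (at x within {c..d})"
          using elim x by simp
      qed
    qed
  qed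
  then show ?thesis
    using V_ends ge le' by blast
qed

end

section \<open>Extremal solutions\<close>

text \<open>What the problem requires of \<open>B\<^sub>1\<close> (with \<open>e = c\<close>) and \<open>B\<^sub>2\<close> (with \<open>e = d\<close>): only the sign
  of \<open>B y \<gamma>\<close> matters in (H1).\<close>

definition boundary_functional ::
  "real \<Rightarrow> real \<Rightarrow> (real \<Rightarrow> real) \<Rightarrow> (real \<Rightarrow> real) \<Rightarrow> real \<Rightarrow> (real \<Rightarrow> (real \<Rightarrow> real) \<Rightarrow> real) \<Rightarrow> bool" where
  "boundary_functional c d \<alpha> \<beta> e B \<longleftrightarrow>
     B (\<alpha> e) \<alpha> \<le> 0 \<and> 0 \<le> B (\<beta> e) \<beta> \<and>
     (\<forall>\<gamma>\<in>order_interval c d \<alpha> \<beta>. \<forall>y\<in>{\<alpha> e..\<beta> e}.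
        (0 < B y \<gamma> \<longrightarrow> (\<forall>\<^sub>F z in at_left y. 0 < B z \<gamma>)) \<and>
        (B y \<gamma> < 0 \<longrightarrow> (\<forall>\<^sub>F z in at_right y. B z \<gamma> < 0))) \<and>
     (\<forall>y\<in>{\<alpha> e..\<beta> e}. \<forall>\<gamma>1\<in>order_interval c d \<alpha> \<beta>. \<forall>\<gamma>2\<in>order_interval c d \<alpha> \<beta>.
        (\<forall>x\<in>{c..d}. \<gamma>1 x \<le> \<gamma>2 x) \<longrightarrow> B y \<gamma>2 \<le> B y \<gamma>1)"

lemma order_interval_reflect:
  "\<gamma> \<in> order_interval c d (\<lambda>x. - \<beta> x) (\<lambda>x. - \<alpha> x) \<longleftrightarrow> (\<lambda>x. - \<gamma> x) \<in> order_interval c d \<alpha> \<beta>"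
  using abs_cont_on_uminus[of "{c..d}" \<gamma>] abs_cont_on_uminus[of "{c..d}" "\<lambda>x. - \<gamma> x"]
  by (fastforce simp: order_interval_def minus_le_iff le_minus_iff)

text \<open>Negating the value and both arguments exchanges left with right neighbourhoods and
  positive with negative signs, so the two sign conditions trade places, while monotonicity in the
  function argument is preserved.\<close>

lemma boundary_functional_reflect:
  assumes "boundary_functional c d \<alpha> \<beta> e B"
  shows "boundary_functional c d (\<lambda>x. - \<beta> x) (\<lambda>x. - \<alpha> x) e (\<lambda>y \<gamma>. - B (- y) (\<lambda>x. - \<gamma> x))"
  unfolding boundary_functional_def order_interval_reflect
proof (intro conjI ballI impI)
  show "- B (- (- \<beta> e)) (\<lambda>x. - (- \<beta> x)) \<le> 0" "0 \<le> - B (- (- \<alpha> e)) (\<lambda>x. - (- \<alpha> x))"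
    using assms by (auto simp: boundary_functional_def)
next
  fix \<gamma> y
  assume g: "\<gamma> \<in> order_interval c d (\<lambda>x. - \<beta> x) (\<lambda>x. - \<alpha> x)" and y: "y \<in> {- \<beta> e..- \<alpha> e}"
  then have g': "(\<lambda>x. - \<gamma> x) \<in> order_interval c d \<alpha> \<beta>" and y': "- y \<in> {\<alpha> e..\<beta> e}"
    by (auto simp: order_interval_reflect)
  show "\<forall>\<^sub>F z in at_left y. 0 < - B (- z) (\<lambda>x. - \<gamma> x)" if "0 < - B (- y) (\<lambda>x. - \<gamma> x)"
  proof -
    have "\<forall>\<^sub>F z in at_right (- y). B z (\<lambda>x. - \<gamma> x) < 0"
      using assms g' y' that unfolding boundary_functional_def by auto
    then show ?thesis
      unfolding at_right_minus eventually_filtermap by simp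
  qed
  show "\<forall>\<^sub>F z in at_right y. - B (- z) (\<lambda>x. - \<gamma> x) < 0" if "- B (- y) (\<lambda>x. - \<gamma> x) < 0"
  proof -
    have "\<forall>\<^sub>F z in at_left (- y). 0 < B z (\<lambda>x. - \<gamma> x)"
      using assms g' y' that unfolding boundary_functional_def by auto
    then show ?thesis
      unfolding at_left_minus eventually_filtermap by simp
  qed
next
  fix y \<gamma>1 \<gamma>2
  assume y: "y \<in> {- \<beta> e..- \<alpha> e}"
    and g: "\<gamma>1 \<in> order_interval c d (\<lambda>x. - \<beta> x) (\<lambda>x. - \<alpha> x)" "\<gamma>2 \<in> order_interval c d (\<lambda>x. - \<beta> x) (\<lambda>x. - \<alpha> x)"
    and le: "\<forall>x\<in>{c..d}. \<gamma>1 x \<le> \<gamma>2 x"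
  have "- y \<in> {\<alpha> e..\<beta> e}"
    using y by auto
  then show "- B (- y) (\<lambda>x. - \<gamma>2 x) \<le> - B (- y) (\<lambda>x. - \<gamma>1 x)"
    using assms g le unfolding boundary_functional_def order_interval_reflect by auto
qed

text \<open>By monotonicity \<open>B (V n e) U\<close> is at most \<open>B (V n e) (V n)\<close>,
  hence nonpositive. If \<open>B (U e) U\<close> were positive, then \<open>V n e\<close> would
  differ from \<open>U e\<close> and approach it from the left, where the sign condition makes
  \<open>B z U\<close> positive.\<close>

lemma boundary_functional_limit:
  assumes B: "boundary_functional c d \<alpha> \<beta> e B" and e: "e \<in> {c..d}"
    and V: "\<And>n. V n \<in> order_interval c d \<alpha> \<beta>" and U: "U \<in> order_interval c d \<alpha> \<beta>"
    and le: "\<And>n x. x \<in> {c..d} \<Longrightarrow> V n x \<le> U x" and lim: "(\<lambda>n. V n e) \<longlonglongrightarrow> U e"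
    and neg: "\<And>n. B (V n e) (V n) \<le> 0"
  shows "B (U e) U \<le> 0"
proof (rule ccontr)
  assume "\<not> B (U e) U \<le> 0"
  have mem: "V n e \<in> {\<alpha> e..\<beta> e}" "U e \<in> {\<alpha> e..\<beta> e}" for n
    using V[of n] U e by (auto simp: order_interval_def)
  have neg': "B (V n e) U \<le> 0" for n
  proof -
    have "B (V n e) U \<le> B (V n e) (V n)"
      using B V[of n] U le mem unfolding boundary_functional_def by blast
    with neg[of n] show ?thesis
      by linarith
  qed
  have "V n e \<noteq> U e" for n
    using neg'[of n] \<open>\<not> B (U e) U \<le> 0\<close> by auto
  then have "\<forall>\<^sub>F n in sequentially. V n e < U e"
    using le[OF e] by (intro always_eventually) (auto simp: less_le)
  then have "filterlim (\<lambda>n. V n e) (at_left (U e)) sequentially"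
    by (intro tendsto_imp_filterlim_at_left lim)
  moreover have "\<forall>\<^sub>F z in at_left (U e). 0 < B z U"
    using B U mem \<open>\<not> B (U e) U \<le> 0\<close> unfolding boundary_functional_def by auto
  ultimately have "\<forall>\<^sub>F n in sequentially. 0 < B (V n e) U"
    by (rule eventually_compose_filterlim[rotated])
  then show False
    using neg' by (auto simp: eventually_sequentially not_less[symmetric])
qed

text \<open>If \<open>U e\<close> were already \<open>\<beta> e\<close>, monotonicity would give
  \<open>B (U e) U\<close> at least \<open>B (\<beta> e) \<beta>\<close>, which is nonnegative. So
  there is room below \<open>\<beta> e\<close>, and negativity persists slightly to the right of
  \<open>U e\<close>.\<close>

lemma boundary_functional_raise:
  assumes B: "boundary_functional c d \<alpha> \<beta> e B" and e: "e \<in> {c..d}"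
    and U: "U \<in> order_interval c d \<alpha> \<beta>" and \<beta>: "\<beta> \<in> order_interval c d \<alpha> \<beta>" and neg: "B (U e) U < 0"
  obtains z where "U e < z" "z \<le> \<beta> e" "B z U \<le> 0"
proof -
  have mem: "\<alpha> e \<le> U e" "U e \<le> \<beta> e" "\<forall>x\<in>{c..d}. U x \<le> \<beta> x"
    using U e by (auto simp: order_interval_def)
  have "U e \<noteq> \<beta> e"
  proof
    assume eq: "U e = \<beta> e"
    have "B (\<beta> e) \<beta> \<le> B (\<beta> e) U"
      using B U \<beta> mem unfolding boundary_functional_def by auto
    then show False
      using B neg eq unfolding boundary_functional_def by auto
  qed
  then have "U e < \<beta> e"
    using mem by simp
  have "\<forall>\<^sub>F z in at_right (U e). B z U < 0"
    using B U mem neg unfolding boundary_functional_def by auto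
  then obtain b where b: "U e < b" "\<And>z. \<lbrakk>U e < z; z < b\<rbrakk> \<Longrightarrow> B z U < 0"
    unfolding eventually_at_right_field by blast
  obtain z where "U e < z" "z < min b (\<beta> e)"
    using dense[of "U e" "min b (\<beta> e)"] b(1) \<open>U e < \<beta> e\<close> by auto
  then show thesis
    using that[of z] b(2)[of z] by auto
qed

section \<open>The Perron class and its greatest element\<close>

context hoelder_field
begin

lemma ode_solution_AC:
  assumes sol: "ode_solution f c d V V'"
  shows "abs_cont_on {c..d} V"
proof -
  note cont = ode_solution_imp_continuous_on[OF sol]
  obtain N where "\<And>t. t \<in> {c..d} \<Longrightarrow> \<bar>V' t\<bar> \<le> N"
    using continuous_on_Icc_bounded[OF cont(2)] by metis
  then show ?thesis
    by (rule AC_of_integral_equation(1)[OF integrable_continuous_real[OF cont(2)] _ ode_solution_integral(1)[OF sol]])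
qed

text \<open>The greatest element of the Perron class \<open>S\<close> is the limit of an increasing sequence along which
  the integral over \<open>[c, d]\<close> tends to its supremum over \<open>S\<close>.\<close>

theorem greatest_solution:
  assumes ac: "abs_cont_on {c..d} \<alpha>" "abs_cont_on {c..d} \<beta>"
    and lower: "touching_lower f c d \<alpha>" and upper: "touching_upper f c d \<beta>"
    and le: "\<And>x. x \<in> {c..d} \<Longrightarrow> \<alpha> x \<le> \<beta> x"
    and B1: "boundary_functional c d \<alpha> \<beta> c B1" and B2: "boundary_functional c d \<alpha> \<beta> d B2"
  shows "\<exists>U U'. ode_solution f c d U U' \<and> U \<in> order_interval c d \<alpha> \<beta> \<and> B1 (U c) U = 0 \<and> B2 (U d) U = 0 \<and>
     (\<forall>V V'. ode_solution f c d V V' \<and> V \<in> order_interval c d \<alpha> \<beta> \<and> B1 (V c) V = 0 \<and> B2 (V d) V = 0 \<longrightarrow>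
        (\<forall>x\<in>{c..d}. V x \<le> U x))"
proof -
  let ?I = "order_interval c d \<alpha> \<beta>"
  define S where "S = {V \<in> ?I. (\<exists>V'. ode_solution f c d V V') \<and> B1 (V c) V \<le> 0 \<and> B2 (V d) V \<le> 0}"
  have ends: "c \<in> {c..d}" "d \<in> {c..d}"
    using cd by auto
  have \<alpha>I: "\<alpha> \<in> ?I" and \<beta>I: "\<beta> \<in> ?I"
    using ac le by (auto simp: order_interval_def)
  have I_cont: "continuous_on {c..d} \<gamma>" if "\<gamma> \<in> ?I" for \<gamma>
    using that abs_cont_on_imp_continuous_on by (auto simp: order_interval_def)
  have I_int: "\<gamma> integrable_on {c..d}" if "\<gamma> \<in> ?I" for \<gamma>
    using I_cont[OF that] by (rule integrable_continuous_real)
  have SI: "V \<in> ?I" if "V \<in> S" for V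
    using that by (simp add: S_def)
  have mono: "B y h \<le> 0" if "boundary_functional c d \<alpha> \<beta> e B" "y \<in> {\<alpha> e..\<beta> e}" "g \<in> ?I" "h \<in> ?I"
    "\<And>x. x \<in> {c..d} \<Longrightarrow> g x \<le> h x" "B y g \<le> 0" for B e y g h
  proof -
    have "B y h \<le> B y g"
      using that unfolding boundary_functional_def by blast
    with that show ?thesis
      by linarith
  qed
  \<comment> \<open>The Dirichlet problem is solved between \<open>\<gamma>\<close> and
    \<open>\<beta>\<close>. The boundary inequalities known for \<open>\<gamma>\<close> carry over
    to the solution because it lies above \<open>\<gamma>\<close> and the functionals are
    nonincreasing in their function argument.\<close>
  have raise: "\<exists>V\<in>S. V c = A \<and> V d = D \<and> (\<forall>x\<in>{c..d}. \<gamma> x \<le> V x)"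
    if \<gamma>: "\<gamma> \<in> ?I" "touching_lower f c d \<gamma>" and A: "\<gamma> c \<le> A" "A \<le> \<beta> c" "B1 A \<gamma> \<le> 0"
      and D: "\<gamma> d \<le> D" "D \<le> \<beta> d" "B2 D \<gamma> \<le> 0" for \<gamma> A D
  proof -
    have bd: "\<alpha> x \<le> \<gamma> x" "\<gamma> x \<le> \<beta> x" if "x \<in> {c..d}" for x
      using \<gamma>(1) that by (auto simp: order_interval_def)
    obtain V V' where V: "ode_solution f c d V V'" "V c = A" "V d = D"
      "\<And>x. x \<in> {c..d} \<Longrightarrow> \<gamma> x \<le> V x" "\<And>x. x \<in> {c..d} \<Longrightarrow> V x \<le> \<beta> x"
      using Dirichlet_between[OF I_cont[OF \<gamma>(1)] I_cont[OF \<beta>I] \<gamma>(2) upper bd(2) A(1,2) D(1,2)] by blast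
    have VI: "V \<in> ?I"
      using ode_solution_AC[OF V(1)] V(4,5) bd by (fastforce simp: order_interval_def)
    have "B1 A V \<le> 0"
      using A bd[OF ends(1)] by (intro mono[OF B1 _ \<gamma>(1) VI V(4)]) auto
    moreover have "B2 D V \<le> 0"
      using D bd[OF ends(2)] by (intro mono[OF B2 _ \<gamma>(1) VI V(4)]) auto
    ultimately show ?thesis
      using V VI by (intro bexI[of _ V]) (auto simp: S_def)
  qed
  have directed: "\<exists>V\<in>S. \<forall>x\<in>{c..d}. V1 x \<le> V x \<and> V2 x \<le> V x" if V12: "V1 \<in> S" "V2 \<in> S" for V1 V2
  proof -
    define m where "m x = max (V1 x) (V2 x)" for x
    have mI: "m \<in> ?I"
      using SI[OF V12(1)] SI[OF V12(2)] unfolding m_def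
      by (auto simp: order_interval_def intro: abs_cont_on_max le_max_iff_disj[THEN iffD2])
    obtain V1' V2' where "ode_solution f c d V1 V1'" "ode_solution f c d V2 V2'"
      using V12 by (auto simp: S_def)
    then have touch: "touching_lower f c d m"
      unfolding m_def by (rule touching_lower_max)
    \<comment> \<open>At the endpoint \<open>m\<close> takes the value of one of the two solutions,
      and replacing that solution by the larger \<open>m\<close> can only lower
      \<open>B\<close>.\<close>
    have neg: "B (m e) m \<le> 0" if B: "boundary_functional c d \<alpha> \<beta> e B" and e: "e \<in> {c..d}"
      and B12: "B (V1 e) V1 \<le> 0" "B (V2 e) V2 \<le> 0" for B e
    proof -
      have "V1 e \<in> {\<alpha> e..\<beta> e}" "V2 e \<in> {\<alpha> e..\<beta> e}"
        using SI[OF V12(1)] SI[OF V12(2)] e by (auto simp: order_interval_def)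
      then have "B (V1 e) m \<le> 0" "B (V2 e) m \<le> 0"
        using mono[where B = B and e = e and y = "V1 e" and g = V1 and h = m]
          mono[where B = B and e = e and y = "V2 e" and g = V2 and h = m]
          B SI[OF V12(1)] SI[OF V12(2)] mI B12 by (auto simp: m_def)
      then show ?thesis
        by (simp add: m_def max_def)
    qed
    have "m c \<le> \<beta> c" "m d \<le> \<beta> d"
      using mI ends by (auto simp: order_interval_def)
    then obtain V where "V \<in> S" "\<forall>x\<in>{c..d}. m x \<le> V x"
      using raise[OF mI touch, of "m c" "m d"] neg[OF B1 ends(1)] neg[OF B2 ends(2)] V12
      by (auto simp: S_def)
    then show ?thesis
      by (auto simp: m_def)
  qed
  have "\<exists>V. V \<in> S"
    using raise[OF \<alpha>I lower, of "\<alpha> c" "\<alpha> d"] le ends B1 B2 unfolding boundary_functional_def by blast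
  then have S_ne: "S \<noteq> {}"
    by blast
  define J where "J V = integral {c..d} V" for V :: "real \<Rightarrow> real"
  have J_mono: "J V \<le> J W" if "V \<in> ?I" "W \<in> ?I" "\<And>x. x \<in> {c..d} \<Longrightarrow> V x \<le> W x" for V W
    unfolding J_def using that by (intro integral_le I_int)
  define s where "s = Sup (J ` S)"
  have "J V \<le> J \<beta>" if "V \<in> S" for V
    using SI[OF that] by (intro J_mono \<beta>I) (auto simp: order_interval_def)
  then have bdd: "bdd_above (J ` S)"
    by (rule bdd_aboveI2)
  have J_le: "J V \<le> s" if "V \<in> S" for V
    unfolding s_def using bdd that by (intro cSup_upper) auto
  have "\<exists>X. X \<in> S \<and> s - inverse (real (Suc n)) < J X" for n
    using less_cSupD[of "J ` S" "s - inverse (real (Suc n))"] S_ne unfolding s_def by auto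
  then obtain X where X: "\<And>n. X n \<in> S" "\<And>n. s - inverse (real (Suc n)) < J (X n)"
    by metis
  obtain join where join: "\<And>V1 V2. \<lbrakk>V1 \<in> S; V2 \<in> S\<rbrakk> \<Longrightarrow> join V1 V2 \<in> S"
    "\<And>V1 V2 x. \<lbrakk>V1 \<in> S; V2 \<in> S; x \<in> {c..d}\<rbrakk> \<Longrightarrow> V1 x \<le> join V1 V2 x \<and> V2 x \<le> join V1 V2 x"
    using directed by metis
  \<comment> \<open>The maximizing sequence \<open>X\<close> need not be monotone; successive common
    upper bounds give an increasing sequence above it. Monotonicity yields pointwise convergence and
    the approach from below that \<open>boundary_functional_limit\<close> demands.\<close>
  define V where "V = rec_nat (X 0) (\<lambda>n W. join W (X (Suc n)))"
  have V_simps: "V 0 = X 0" "V (Suc n) = join (V n) (X (Suc n))" for n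
    by (simp_all add: V_def)
  have VS: "V n \<in> S" for n
    by (induction n) (simp_all add: V_simps X join)
  have VX: "X n x \<le> V n x" if "x \<in> {c..d}" for n x
    using that join(2)[OF VS X(1)] by (cases n) (auto simp: V_simps)
  have inc: "incseq (\<lambda>n. V n x)" if "x \<in> {c..d}" for x
    using that join(2)[OF VS X(1)] by (intro incseq_SucI) (auto simp: V_simps)
  have V_bd: "\<alpha> x \<le> V n x" "V n x \<le> \<beta> x" if "x \<in> {c..d}" for n x
    using SI[OF VS[of n]] that by (auto simp: order_interval_def)
  define U where "U x = (SUP n. V n x)" for x
  have V_lim: "(\<lambda>n. V n x) \<longlonglongrightarrow> U x" and V_le: "V n x \<le> U x" if "x \<in> {c..d}" for n x
  proof -
    have "bdd_above (range (\<lambda>n. V n x))"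
      using V_bd(2)[OF that] by (intro bdd_aboveI2)
    then show "(\<lambda>n. V n x) \<longlonglongrightarrow> U x" "V n x \<le> U x"
      unfolding U_def by (auto intro: LIMSEQ_incseq_SUP[OF _ inc[OF that]] cSUP_upper)
  qed
  obtain M1 M2 where M: "\<And>t. t \<in> {c..d} \<Longrightarrow> \<bar>\<alpha> t\<bar> \<le> M1" "\<And>t. t \<in> {c..d} \<Longrightarrow> \<bar>\<beta> t\<bar> \<le> M2"
    using continuous_on_Icc_bounded[OF I_cont[OF \<alpha>I]] continuous_on_Icc_bounded[OF I_cont[OF \<beta>I]] by metis
  have "\<forall>n. \<exists>V'. ode_solution f c d (V n) V'"
    using VS by (auto simp: S_def)
  then obtain V' where V': "\<And>n. ode_solution f c d (V n) (V' n)"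
    by metis
  have "\<bar>V n x\<bar> \<le> max M1 M2" if "x \<in> {c..d}" for n x
    using V_bd[OF that, of n] M[OF that] by (auto simp: abs_le_iff)
  from ode_solution_limit[OF V' this V_lim] obtain U' where U': "ode_solution f c d U U'"
    by blast
  have U_bd: "\<alpha> x \<le> U x" "U x \<le> \<beta> x" if "x \<in> {c..d}" for x
    using LIMSEQ_le_const[OF V_lim[OF that]] LIMSEQ_le_const2[OF V_lim[OF that]] V_bd[OF that] by blast+
  then have UI: "U \<in> ?I"
    using ode_solution_AC[OF U'] by (auto simp: order_interval_def)
  have "B1 (U c) U \<le> 0"
    using VS by (intro boundary_functional_limit[OF B1 ends(1) SI[OF VS] UI V_le V_lim[OF ends(1)]]) (auto simp: S_def)
  moreover have "B2 (U d) U \<le> 0"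
    using VS by (intro boundary_functional_limit[OF B2 ends(2) SI[OF VS] UI V_le V_lim[OF ends(2)]]) (auto simp: S_def)
  ultimately have US: "U \<in> S"
    using UI U' by (auto simp: S_def)
  have JU: "s \<le> J U"
  proof (rule field_le_epsilon)
    fix e :: real
    assume "e > 0"
    then obtain n where "inverse (real (Suc n)) < e"
      using reals_Archimedean by blast
    moreover have "J (X n) \<le> J U"
      using VX V_le by (intro J_mono SI X UI) (meson order_trans)
    ultimately show "s \<le> J U + e"
      using X(2)[of n] by linarith
  qed
  \<comment> \<open>A common upper bound \<open>Z\<close> of \<open>U\<close> and \<open>W\<close>
    in \<open>S\<close> cannot have a larger integral than \<open>U\<close>, which attains the
    supremum. Being continuous and above \<open>U\<close>, it equals \<open>U\<close>.\<close>
  have greatest: "W x \<le> U x" if W: "W \<in> S" and x: "x \<in> {c..d}" for W x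
  proof -
    obtain Z where Z: "Z \<in> S" "\<And>x. x \<in> {c..d} \<Longrightarrow> U x \<le> Z x \<and> W x \<le> Z x"
      using directed[OF US W] by blast
    have "integral {c..d} (\<lambda>x. Z x - U x) = J Z - J U"
      unfolding J_def by (intro integral_diff I_int SI Z UI)
    also have "\<dots> = 0"
      using J_le[OF Z(1)] JU J_mono[OF UI SI[OF Z(1)]] Z(2) by fastforce
    finally have "integral {c..d} (\<lambda>x. Z x - U x) = 0" .
    moreover have "continuous_on {c..d} (\<lambda>x. Z x - U x)"
      by (intro continuous_intros I_cont SI Z UI)
    ultimately have "\<forall>x\<in>{c..d}. Z x - U x = 0"
      using integral_eq_0_iff[of c d "\<lambda>x. Z x - U x"] cd Z(2) by auto
    with Z(2)[OF x] x show ?thesis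
      by auto
  qed
  \<comment> \<open>A solution is the maximum of itself with itself, so the Dirichlet problem can be
    solved above it.\<close>
  have touchU: "touching_lower f c d U"
    using touching_lower_max[OF U' U'] by simp
  have "B1 (U c) U = 0"
  proof (rule ccontr)
    assume "B1 (U c) U \<noteq> 0"
    then have "B1 (U c) U < 0"
      using US by (auto simp: S_def)
    then obtain z where z: "U c < z" "z \<le> \<beta> c" "B1 z U \<le> 0"
      using boundary_functional_raise[OF B1 ends(1) UI \<beta>I] by blast
    then obtain Z where "Z \<in> S" "Z c = z"
      using raise[OF UI touchU, of z "U d"] US U_bd[OF ends(2)] by (auto simp: S_def)
    then show False
      using greatest[OF _ ends(1)] z by force
  qed
  moreover have "B2 (U d) U = 0"
  proof (rule ccontr)
    assume "B2 (U d) U \<noteq> 0"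
    then have "B2 (U d) U < 0"
      using US by (auto simp: S_def)
    then obtain z where z: "U d < z" "z \<le> \<beta> d" "B2 z U \<le> 0"
      using boundary_functional_raise[OF B2 ends(2) UI \<beta>I] by blast
    then obtain Z where "Z \<in> S" "Z d = z"
      using raise[OF UI touchU, of "U c" z] US U_bd[OF ends(1)] by (auto simp: S_def)
    then show False
      using greatest[OF _ ends(2)] z by force
  qed
  ultimately show ?thesis
    using U' UI greatest by (intro exI[of _ U] exI[of _ U']) (auto simp: S_def)
qed

end

section \<open>The operator H\<close>

text \<open>Difference quotients of \<open>\<alpha>\<close> lie below those of \<open>W\<close> on
  the right and, as h is negative there, above them on the left. This excludes the corner
  alternative in the definition of a lower solution at every touching point.\<close>

lemma touching_point_Dini:
  assumes W: "(W has_real_derivative m) (at x0)" and x0: "x0 \<in> {c<..<d}"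
    and max: "\<And>x. x \<in> {c..d} \<Longrightarrow> \<alpha> x - W x \<le> \<alpha> x0 - W x0"
  shows "Dini_upper_right \<alpha> x0 \<le> ereal m" "ereal m \<le> Dini_lower_left \<alpha> x0"
proof -
  define Q where "Q g h = (g (x0 + h) - g x0) / h" for g :: "real \<Rightarrow> real" and h
  have "(Q W \<longlongrightarrow> m) (at 0)"
    using W by (simp add: DERIV_def Q_def[abs_def])
  then have lim: "((\<lambda>h. ereal (Q W h)) \<longlongrightarrow> ereal m) (at_left 0)" "((\<lambda>h. ereal (Q W h)) \<longlongrightarrow> ereal m) (at_right 0)"
    by (simp_all add: filterlim_at_split)
  have "\<forall>\<^sub>F h in at_right 0. h < d - x0"
    using x0 by (intro order_tendstoD(2)[OF tendsto_ident_at]) auto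
  then have "\<forall>\<^sub>F h in at_right 0. ereal (Q \<alpha> h) \<le> ereal (Q W h)"
    using eventually_at_right_less
  proof eventually_elim
    case (elim h)
    then show ?case
      using max[of "x0 + h"] x0 by (simp add: Q_def divide_right_mono)
  qed
  then have "Limsup (at_right 0) (\<lambda>h. ereal (Q \<alpha> h)) \<le> Limsup (at_right 0) (\<lambda>h. ereal (Q W h))"
    by (rule Limsup_mono)
  also have "\<dots> = ereal m"
    by (rule lim_imp_Limsup[OF _ lim(2)]) simp
  finally show "Dini_upper_right \<alpha> x0 \<le> ereal m"
    by (simp add: Dini_upper_right_def Q_def)
  have "\<forall>\<^sub>F h in at_left 0. c - x0 < h"
    using x0 by (intro order_tendstoD(1)[OF tendsto_ident_at]) auto
  moreover have "\<forall>\<^sub>F h in at_left 0. h < (0::real)"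
    by (simp add: eventually_at_filter)
  ultimately have "\<forall>\<^sub>F h in at_left 0. ereal (Q W h) \<le> ereal (Q \<alpha> h)"
  proof eventually_elim
    case (elim h)
    then show ?case
      using max[of "x0 + h"] x0 by (simp add: Q_def divide_right_mono_neg)
  qed
  then have "Liminf (at_left 0) (\<lambda>h. ereal (Q W h)) \<le> Liminf (at_left 0) (\<lambda>h. ereal (Q \<alpha> h))"
    by (rule Liminf_mono)
  moreover have "Liminf (at_left 0) (\<lambda>h. ereal (Q W h)) = ereal m"
    by (rule lim_imp_Liminf[OF _ lim(1)]) simp
  ultimately show "ereal m \<le> Dini_lower_left \<alpha> x0"
    by (simp add: Dini_lower_left_def Q_def)
qed

definition local_W21_lower :: "(real \<Rightarrow> real \<Rightarrow> real \<Rightarrow> real) \<Rightarrow> real \<Rightarrow> real \<Rightarrow> (real \<Rightarrow> real) \<Rightarrow> real \<Rightarrow> bool" where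
  "local_W21_lower f c d \<alpha> x0 \<longleftrightarrow>
     (\<exists>a b. a < x0 \<and> x0 < b \<and> {a<..<b} \<subseteq> {c<..<d} \<and> W21_on {a<..<b} \<alpha> \<and>
        (AE x in lebesgue. x \<in> {a<..<b} \<longrightarrow>
           (\<exists>D. (deriv \<alpha> has_real_derivative D) (at x) \<and> f x (\<alpha> x) (deriv \<alpha> x) \<le> D)))"

text \<open>\<open>W21_on\<close> provides some derivative; by uniqueness it agrees on
  \<open>J\<close> with \<open>deriv\<close>, in which the differential inequalities are
  written.\<close>

lemma W21_on_deriv:
  assumes "W21_on J \<alpha>"
  shows "x \<in> J \<Longrightarrow> (\<alpha> has_real_derivative deriv \<alpha> x) (at x)" and "abs_cont_on J (deriv \<alpha>)"
proof -
  obtain g where g: "\<And>x. x \<in> J \<Longrightarrow> (\<alpha> has_real_derivative g x) (at x)" "abs_cont_on J g"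
    using assms unfolding W21_on_def by blast
  then have "g x = deriv \<alpha> x" if "x \<in> J" for x
    using that DERIV_imp_deriv by metis
  with g show "x \<in> J \<Longrightarrow> (\<alpha> has_real_derivative deriv \<alpha> x) (at x)" "abs_cont_on J (deriv \<alpha>)"
    using abs_cont_on_cong[of J g "deriv \<alpha>"] by auto
qed

text \<open>At a touching point the Dini alternative fails, so the other one holds and
  \<open>\<alpha>\<close> itself is the function touching from below.\<close>

lemma touching_lowerI:
  assumes "\<And>x0. x0 \<in> {c<..<d} \<Longrightarrow>
    Dini_lower_left \<alpha> x0 < Dini_upper_right \<alpha> x0 \<or> local_W21_lower f c d \<alpha> x0"
  shows "touching_lower f c d \<alpha>"
  unfolding touching_lower_def
proof (intro ballI allI impI)
  fix x0 W m
  assume x0: "x0 \<in> {c<..<d}" and W: "(W has_real_derivative m) (at x0) \<and> (\<forall>x\<in>{c..d}. \<alpha> x - W x \<le> \<alpha> x0 - W x0)"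
  have "Dini_upper_right \<alpha> x0 \<le> Dini_lower_left \<alpha> x0"
    using touching_point_Dini[of W m x0 c d \<alpha>] W x0 order_trans by blast
  then have "local_W21_lower f c d \<alpha> x0"
    using assms[OF x0] by auto
  then obtain l u where lu: "l < x0" "x0 < u" "{l<..<u} \<subseteq> {c<..<d}" "W21_on {l<..<u} \<alpha>"
    "AE x in lebesgue. x \<in> {l<..<u} \<longrightarrow>
           (\<exists>D. (deriv \<alpha> has_real_derivative D) (at x) \<and> f x (\<alpha> x) (deriv \<alpha> x) \<le> D)"
    unfolding local_W21_lower_def by blast
  then show "\<exists>l u a a'. l < x0 \<and> x0 < u \<and> {l<..<u} \<subseteq> {c<..<d} \<and> a x0 = \<alpha> x0 \<and>
           (\<forall>x\<in>{l<..<u}. a x \<le> \<alpha> x \<and> (a has_real_derivative a' x) (at x)) \<and>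
           abs_cont_on {l<..<u} a' \<and>
           (AE x in lebesgue. x \<in> {l<..<u} \<longrightarrow>
              (\<exists>D. (a' has_real_derivative D) (at x) \<and> f x (a x) (a' x) \<le> D))"
    using W21_on_deriv[OF lu(4)]
    by (intro exI[of _ l] exI[of _ u] exI[of _ \<alpha>] exI[of _ "deriv \<alpha>"]) auto
qed

lemma touching_lower_PP_lower:
  assumes "PP_lower p q B1 B2 c d \<alpha>"
  shows "touching_lower (\<lambda>x y z. - Hfun p q x y z) c d \<alpha>"
proof (rule touching_lowerI)
  fix x0
  assume "x0 \<in> {c<..<d}"
  then have "Dini_lower_left \<alpha> x0 < Dini_upper_right \<alpha> x0 \<or>
        (\<exists>a b. a < x0 \<and> x0 < b \<and> {a<..<b} \<subseteq> {c<..<d} \<and> W21_on {a<..<b} \<alpha> \<and>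
           (AE x in lebesgue. x \<in> {a<..<b} \<longrightarrow>
              (\<exists>a''. (deriv \<alpha> has_real_derivative a'') (at x) \<and>
                     a'' + Hfun p q x (\<alpha> x) (deriv \<alpha> x) \<ge> 0)))"
    using assms unfolding PP_lower_def by blast
  moreover have "- Hfun p q x y z \<le> D \<longleftrightarrow> D + Hfun p q x y z \<ge> 0" for x y z D
    by linarith
  ultimately show "Dini_lower_left \<alpha> x0 < Dini_upper_right \<alpha> x0 \<or> local_W21_lower (\<lambda>x y z. - Hfun p q x y z) c d \<alpha> x0"
    unfolding local_W21_lower_def by simp
qed

text \<open>Negation exchanges upper and lower Dini derivatives on the same side, which turns the
  corner condition for \<beta> into that of a lower solution for -\<beta>.\<close>

lemma touching_upper_PP_upper:
  assumes "PP_upper p q B1 B2 c d \<beta>"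
  shows "touching_upper (\<lambda>x y z. - Hfun p q x y z) c d \<beta>"
  unfolding touching_upper_def
proof (rule touching_lowerI)
  fix x0
  assume "x0 \<in> {c<..<d}"
  then consider "Dini_upper_left \<beta> x0 > Dini_lower_right \<beta> x0"
    | a b where "a < x0" "x0 < b" "{a<..<b} \<subseteq> {c<..<d}" "W21_on {a<..<b} \<beta>"
           "AE x in lebesgue. x \<in> {a<..<b} \<longrightarrow>
              (\<exists>b''. (deriv \<beta> has_real_derivative b'') (at x) \<and>
                     b'' + Hfun p q x (\<beta> x) (deriv \<beta> x) \<le> 0)"
    using assms unfolding PP_upper_def by blast
  then show "Dini_lower_left (\<lambda>x. - \<beta> x) x0 < Dini_upper_right (\<lambda>x. - \<beta> x) x0 \<or>
      local_W21_lower (reflect (\<lambda>x y z. - Hfun p q x y z)) c d (\<lambda>x. - \<beta> x) x0"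
  proof cases
    case 1
    have neg: "ereal ((- \<beta> (x0 + h) - - \<beta> x0) / h) = - ereal ((\<beta> (x0 + h) - \<beta> x0) / h)" for h
      using minus_divide_left[of "\<beta> (x0 + h) - \<beta> x0" h] by simp
    have "Dini_lower_left (\<lambda>x. - \<beta> x) x0 = - Dini_upper_left \<beta> x0"
      unfolding Dini_lower_left_def Dini_upper_left_def neg by (rule ereal_Liminf_uminus)
    moreover have "Dini_upper_right (\<lambda>x. - \<beta> x) x0 = - Dini_lower_right \<beta> x0"
      unfolding Dini_upper_right_def Dini_lower_right_def neg by (rule ereal_Limsup_uminus)
    ultimately show ?thesis
      using 1 by simp
  next
    case 2
    note der = W21_on_deriv(1)[OF 2(4)]
    have der_minus: "deriv (\<lambda>x. - \<beta> x) x = - deriv \<beta> x" if "x \<in> {a<..<b}" for x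
      by (intro DERIV_imp_deriv DERIV_minus der that)
    have "W21_on {a<..<b} (\<lambda>x. - \<beta> x)"
      unfolding W21_on_def
      by (intro exI[of _ "\<lambda>x. - deriv \<beta> x"] conjI ballI DERIV_minus der
          abs_cont_on_uminus[OF W21_on_deriv(2)[OF 2(4)]])
    moreover have "AE x in lebesgue. x \<in> {a<..<b} \<longrightarrow>
         (\<exists>D. (deriv (\<lambda>x. - \<beta> x) has_real_derivative D) (at x) \<and>
              reflect (\<lambda>x y z. - Hfun p q x y z) x (- \<beta> x) (deriv (\<lambda>x. - \<beta> x) x) \<le> D)"
      using 2(5)
    proof eventually_elim
      case (elim x)
      show ?case
      proof
        assume x: "x \<in> {a<..<b}"
        then obtain D where D: "(deriv \<beta> has_real_derivative D) (at x)" "D + Hfun p q x (\<beta> x) (deriv \<beta> x) \<le> 0"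
          using elim by blast
        have "((\<lambda>x. - deriv \<beta> x) has_real_derivative - D) (at x)"
          by (intro DERIV_minus D)
        \<comment> \<open>The two derivatives of first order are known to agree only on the open
          interval, which is enough to differentiate once more at \<open>x\<close>.\<close>
        then have "(deriv (\<lambda>x. - \<beta> x) has_real_derivative - D) (at x)"
          by (rule has_field_derivative_transform_within_open[OF _ open_greaterThanLessThan x]) (simp add: der_minus)
        moreover have "reflect (\<lambda>x y z. - Hfun p q x y z) x (- \<beta> x) (deriv (\<lambda>x. - \<beta> x) x) \<le> - D"
          using D(2) der_minus[OF x] by (simp add: reflect_def)
        ultimately show "\<exists>D. (deriv (\<lambda>x. - \<beta> x) has_real_derivative D) (at x) \<and>
              reflect (\<lambda>x y z. - Hfun p q x y z) x (- \<beta> x) (deriv (\<lambda>x. - \<beta> x) x) \<le> D"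
          by blast
      qed
    qed
    ultimately show ?thesis
      using 2(1-3) unfolding local_W21_lower_def by blast
  qed
qed

lemma PP_solution_iff:
  "PP_solution p q B1 B2 c d V \<longleftrightarrow>
     (\<exists>V'. ode_solution (\<lambda>x y z. - Hfun p q x y z) c d V V') \<and> B1 (V c) V = 0 \<and> B2 (V d) V = 0"
proof -
  have eq: "(\<exists>D. (V' has_real_derivative D) (at x within {c..d}) \<and> D + Hfun p q x (V x) (V' x) = 0) \<longleftrightarrow>
     (V' has_real_derivative - Hfun p q x (V x) (V' x)) (at x within {c..d})" for V' x
    unfolding eq_neg_iff_add_eq_0[symmetric] by simp
  show ?thesis
    unfolding PP_solution_def ode_solution_def eq
    using abs_cont_on_imp_continuous_on by blast
qed

section \<open>Hoelder continuity and sign of H, convexity, and the boundary hypotheses\<close>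

lemma abs_sqrt_diff_le:
  assumes "0 \<le> a" "0 \<le> b"
  shows "\<bar>sqrt a - sqrt b\<bar> \<le> sqrt \<bar>a - b\<bar>"
proof -
  \<comment> \<open>Subadditivity of the root, from which the exponent 1/2 arises.\<close>
  have *: "sqrt v \<le> sqrt u + sqrt (v - u)" if "0 \<le> u" "u \<le> v" for u v
    using sqrt_add_le_add_sqrt[of u "v - u"] that by simp
  show ?thesis
  proof (cases "a \<le> b")
    case True
    then show ?thesis
      using *[of a b] assms by (simp add: abs_if)
  next
    case False
    then show ?thesis
      using *[of b a] assms by (simp add: abs_if)
  qed
qed

text \<open>In a difference of two values of H at the same \<open>x\<close> the terms outside the
  roots cancel, and the roots differ by at most the root of the difference of their arguments. There
  \<open>max 1 d\<close> is a Lipschitz constant of x z - y in (y, z), \<open>4 * d ^ 3 * Q\<close>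
  bounds the coefficient, and \<open>c > 0\<close> keeps the denominator away from zero.\<close>

lemma hoelder_field_Hfun:
  assumes cd: "0 < c" "c < d"
    and p: "\<And>x. x \<in> {c..d} \<Longrightarrow> p x \<ge> 0" and q: "\<And>x. x \<in> {c..d} \<Longrightarrow> q x \<ge> 0"
    and qb: "\<And>x. x \<in> {c..d} \<Longrightarrow> q x \<le> Q"
    and p_meas: "p \<in> borel_measurable (lebesgue_on {c..d})"
    and q_meas: "q \<in> borel_measurable (lebesgue_on {c..d})"
  shows "hoelder_field c d (sqrt (4 * d ^ 3 * Q * max 1 d) / (2 * c ^ 3)) (\<lambda>x y z. - Hfun p q x y z)"
proof
  show "c < d"
    by fact
  show "- Hfun p q x 0 0 = 0" if "x \<in> {c..d}" for x
  proof -
    have "sqrt ((p x)\<^sup>2 * x ^ 4) = sqrt ((p x * x\<^sup>2)\<^sup>2)"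
      by (simp add: power_mult_distrib)
    also have "\<dots> = p x * x\<^sup>2"
      using p[OF that] by (subst real_sqrt_abs) simp
    finally show ?thesis
      by (simp add: Hfun_def)
  qed
  show "\<bar>- Hfun p q x y z - - Hfun p q x y' z'\<bar>
      \<le> sqrt (4 * d ^ 3 * Q * max 1 d) / (2 * c ^ 3) * sqrt (\<bar>y - y'\<bar> + \<bar>z - z'\<bar>)"
    if x: "x \<in> {c..d}" for x y z y' z'
  proof -
    define P where "P = (p x)\<^sup>2 * x ^ 4"
    define R where "R = 4 * x ^ 3 * q x"
    define s where "s = \<bar>x * z - y\<bar>"
    define s' where "s' = \<bar>x * z' - y'\<bar>"
    have x0: "0 < x" "c \<le> x" "x \<le> d"
      using x cd by auto
    have R0: "0 \<le> R" and P0: "0 \<le> P" and Q0: "0 \<le> Q"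
      using x0 q[OF x] qb[OF x] by (auto simp: R_def P_def)
    have R_le: "R \<le> 4 * d ^ 3 * Q"
      unfolding R_def using x0 q[OF x] qb[OF x] cd by (intro mult_mono power_mono) auto
    have "\<bar>s - s'\<bar> \<le> \<bar>(x * z - y) - (x * z' - y')\<bar>"
      unfolding s_def s'_def by (rule abs_triangle_ineq3)
    also have "\<dots> = \<bar>x * (z - z') - (y - y')\<bar>"
      by (simp add: algebra_simps)
    also have "\<dots> \<le> x * \<bar>z - z'\<bar> + \<bar>y - y'\<bar>"
      using x0 abs_triangle_ineq4[of "x * (z - z')" "y - y'"] by (simp add: abs_mult)
    also have "\<dots> \<le> max 1 d * \<bar>z - z'\<bar> + max 1 d * \<bar>y - y'\<bar>"
    proof (rule add_mono)
      show "x * \<bar>z - z'\<bar> \<le> max 1 d * \<bar>z - z'\<bar>"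
        using x0 by (intro mult_right_mono) auto
      show "\<bar>y - y'\<bar> \<le> max 1 d * \<bar>y - y'\<bar>"
        using mult_right_mono[of 1 "max 1 d" "\<bar>y - y'\<bar>"] by simp
    qed
    also have "\<dots> = max 1 d * (\<bar>y - y'\<bar> + \<bar>z - z'\<bar>)"
      by (simp add: algebra_simps)
    finally have ss: "\<bar>s - s'\<bar> \<le> max 1 d * (\<bar>y - y'\<bar> + \<bar>z - z'\<bar>)" .
    have "\<bar>sqrt (P + R * s) - sqrt (P + R * s')\<bar> \<le> sqrt \<bar>(P + R * s) - (P + R * s')\<bar>"
      using R0 P0 by (intro abs_sqrt_diff_le) (auto simp: s_def s'_def)
    also have "\<bar>(P + R * s) - (P + R * s')\<bar> = R * \<bar>s - s'\<bar>"
      using R0 by (simp add: abs_mult flip: right_diff_distrib)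
    also have "sqrt (R * \<bar>s - s'\<bar>) \<le> sqrt ((4 * d ^ 3 * Q) * (max 1 d * (\<bar>y - y'\<bar> + \<bar>z - z'\<bar>)))"
      using R0 R_le ss Q0 cd by (intro real_sqrt_le_mono mult_mono) auto
    also have "\<dots> = sqrt (4 * d ^ 3 * Q * max 1 d) * sqrt (\<bar>y - y'\<bar> + \<bar>z - z'\<bar>)"
      by (simp add: real_sqrt_mult mult.assoc)
    finally have num: "\<bar>sqrt (P + R * s) - sqrt (P + R * s')\<bar> \<le> sqrt (4 * d ^ 3 * Q * max 1 d) * sqrt (\<bar>y - y'\<bar> + \<bar>z - z'\<bar>)" .
    have "- Hfun p q x y z - - Hfun p q x y' z' = (sqrt (P + R * s) - sqrt (P + R * s')) / (2 * x ^ 3)"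
      by (simp add: Hfun_def P_def R_def s_def s'_def diff_divide_distrib)
    then have "\<bar>- Hfun p q x y z - - Hfun p q x y' z'\<bar> = \<bar>sqrt (P + R * s) - sqrt (P + R * s')\<bar> / (2 * x ^ 3)"
      using x0 by (simp add: abs_divide)
    also have "\<dots> \<le> sqrt (4 * d ^ 3 * Q * max 1 d) * sqrt (\<bar>y - y'\<bar> + \<bar>z - z'\<bar>) / (2 * c ^ 3)"
      using num x0 cd Q0 by (intro frac_le mult_nonneg_nonneg) (auto intro!: power_mono)
    finally show ?thesis
      by simp
  qed
  show "(\<lambda>t. - Hfun p q t (V t) (u t)) \<in> borel_measurable (lebesgue_on {c..d})"
    if V: "continuous_on {c..d} V" and u: "continuous_on {c..d} u" for V u
  proof -
    have [measurable]: "V \<in> borel_measurable (lebesgue_on {c..d})" "u \<in> borel_measurable (lebesgue_on {c..d})"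
      "(\<lambda>t. t) \<in> borel_measurable (lebesgue_on {c..d})"
      using V u by (auto intro!: continuous_imp_measurable_on_sets_lebesgue continuous_intros)
    note [measurable] = p_meas q_meas
    show ?thesis
      unfolding Hfun_def by measurable
  qed
qed

lemma Hfun_nonpos:
  assumes "0 < x" "p x \<ge> 0" "q x \<ge> 0"
  shows "Hfun p q x y z \<le> 0"
proof -
  have "p x * x\<^sup>2 = sqrt ((p x * x\<^sup>2)\<^sup>2)"
    using assms by (subst real_sqrt_abs) simp
  also have "\<dots> = sqrt ((p x)\<^sup>2 * x ^ 4)"
    by (simp add: power_mult_distrib)
  also have "\<dots> \<le> sqrt ((p x)\<^sup>2 * x ^ 4 + 4 * x ^ 3 * q x * \<bar>x * z - y\<bar>)"
    using assms by simp
  finally show ?thesis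
    using assms by (simp add: Hfun_def divide_nonpos_pos)
qed

text \<open>\<open>V'\<close> is absolutely continuous with nonnegative derivative almost
  everywhere, hence nondecreasing; by the mean value theorem the graph then lies above each of its
  tangents.\<close>

lemma ode_solution_convex:
  assumes sol: "ode_solution f c d V V'" and nonneg: "\<And>x y z. x \<in> {c..d} \<Longrightarrow> 0 \<le> f x y z"
  shows "convex_on {c..d} V"
proof -
  have mono: "V' x \<le> V' y" if xy: "x \<in> {c..d}" "y \<in> {c..d}" "x \<le> y" for x y
  proof (rule abs_cont_on_nonneg_deriv_le[OF xy(3)])
    show "abs_cont_on {x..y} V'"
      using sol xy unfolding ode_solution_def by (auto intro: abs_cont_on_subset)
    have "AE t in lebesgue. t \<in> {c..d} \<longrightarrow> (V' has_real_derivative f t (V t) (V' t)) (at t within {c..d})"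
      using sol unfolding ode_solution_def by blast
    then show "AE t in lebesgue. t \<in> {x..y} \<longrightarrow> (\<exists>D\<ge>0. (V' has_real_derivative D) (at t within {x..y}))"
    proof eventually_elim
      case (elim t)
      show ?case
      proof
        assume t: "t \<in> {x..y}"
        then have "t \<in> {c..d}"
          using xy by auto
        moreover have "(V' has_real_derivative f t (V t) (V' t)) (at t within {x..y})"
          using elim[rule_format, OF \<open>t \<in> {c..d}\<close>] by (rule has_field_derivative_subset) (use xy in auto)
        ultimately show "\<exists>D\<ge>0. (V' has_real_derivative D) (at t within {x..y})"
          using nonneg by blast
      qed
    qed
  qed
  have mean_value: "\<exists>\<xi>\<in>{c..d}. x \<le> \<xi> \<and> \<xi> \<le> y \<and> V y - V x = V' \<xi> * (y - x)"
    if xy: "x \<in> {c..d}" "y \<in> {c..d}" "x < y" for x y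
  proof -
    have "continuous_on {x..y} V"
      by (rule continuous_on_subset[OF ode_solution_imp_continuous_on(1)[OF sol]]) (use xy in auto)
    then obtain \<xi> where "x < \<xi>" "\<xi> < y" "V y - V x = (*) (V' \<xi>) (y - x)"
    proof (rule mvt[OF xy(3)])
      show "(V has_derivative (*) (V' \<xi>)) (at \<xi>)" if "x < \<xi>" "\<xi> < y" for \<xi>
        using ode_solution_has_derivative_interior[OF sol, of \<xi>] that xy
        by (simp add: has_field_derivative_def)
    qed
    then show ?thesis
      using xy by (intro bexI[of _ \<xi>]) auto
  qed
  show ?thesis
  proof (rule pos_convex_function)
    show "convex {c..d}"
      by simp
    fix x y
    assume xy: "x \<in> {c..d}" "y \<in> {c..d}"
    consider "x < y" | "x = y" | "y < x"
      by linarith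
    then show "V' x * (y - x) \<le> V y - V x"
    proof cases
      case 1
      then obtain \<xi> where "\<xi> \<in> {c..d}" "x \<le> \<xi>" "V y - V x = V' \<xi> * (y - x)"
        using mean_value[OF xy] by blast
      then show ?thesis
        using mono[OF xy(1)] 1 by (simp add: mult_right_mono)
    next
      case 3
      then obtain \<xi> where \<xi>: "\<xi> \<in> {c..d}" "\<xi> \<le> x" "V x - V y = V' \<xi> * (x - y)"
        using mean_value[OF xy(2,1)] by blast
      then have "V' \<xi> * (x - y) \<le> V' x * (x - y)"
        using mono[OF _ xy(1)] 3 by (simp add: mult_right_mono)
      then show ?thesis
        using \<xi>(3) by (simp add: algebra_simps)
    qed simp
  qed
qed

text \<open>The values between \<open>\<alpha> e\<close> and \<open>\<beta> e\<close> lie in the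
  interval E of the hypotheses. The semicontinuity inequalities turn a strict sign at
  \<open>y\<close> into the same sign on a one-sided neighbourhood.\<close>

lemma boundary_functionalI:
  assumes e: "e \<in> {c..d}" and ac: "abs_cont_on {c..d} \<alpha>" "abs_cont_on {c..d} \<beta>"
    and ends: "B (\<alpha> e) \<alpha> \<le> 0" "B (\<beta> e) \<beta> \<ge> 0"
    and H1: "\<And>\<gamma> y. \<lbrakk>\<gamma> \<in> order_interval c d \<alpha> \<beta>; y \<in> {(INF x\<in>{c..d}. \<alpha> x)..(SUP x\<in>{c..d}. \<beta> x)}\<rbrakk> \<Longrightarrow>
                 Liminf (at_left y) (\<lambda>z. ereal (B z \<gamma>)) \<ge> ereal (B y \<gamma>) \<and>
                 ereal (B y \<gamma>) \<ge> Limsup (at_right y) (\<lambda>z. ereal (B z \<gamma>))"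
    and H2: "\<And>y \<gamma>1 \<gamma>2. \<lbrakk>y \<in> {(INF x\<in>{c..d}. \<alpha> x)..(SUP x\<in>{c..d}. \<beta> x)};
               \<gamma>1 \<in> order_interval c d \<alpha> \<beta>; \<gamma>2 \<in> order_interval c d \<alpha> \<beta>;
               \<forall>x\<in>{c..d}. \<gamma>1 x \<le> \<gamma>2 x\<rbrakk> \<Longrightarrow> B y \<gamma>1 \<ge> B y \<gamma>2"
  shows "boundary_functional c d \<alpha> \<beta> e B"
proof -
  have bounded: "bounded (g ` {c..d})" if "abs_cont_on {c..d} g" for g
    using compact_imp_bounded[OF compact_continuous_image[OF abs_cont_on_imp_continuous_on[OF that] compact_Icc]] .
  have "(INF x\<in>{c..d}. \<alpha> x) \<le> \<alpha> e" "\<beta> e \<le> (SUP x\<in>{c..d}. \<beta> x)"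
    using bounded_imp_bdd_below[OF bounded[OF ac(1)]] bounded_imp_bdd_above[OF bounded[OF ac(2)]] e
    by (auto intro: cINF_lower cSUP_upper)
  then have sub: "y \<in> {(INF x\<in>{c..d}. \<alpha> x)..(SUP x\<in>{c..d}. \<beta> x)}" if "y \<in> {\<alpha> e..\<beta> e}" for y
    using that by auto
  show ?thesis
    unfolding boundary_functional_def
  proof (intro conjI ballI impI ends)
    fix \<gamma> y
    assume "\<gamma> \<in> order_interval c d \<alpha> \<beta>" "y \<in> {\<alpha> e..\<beta> e}"
    note H = H1[OF this(1) sub[OF this(2)]]
    show "\<forall>\<^sub>F z in at_left y. 0 < B z \<gamma>" if "0 < B y \<gamma>"
    proof -
      have "ereal 0 < ereal (B y \<gamma>)"
        using that by simp
      also have "\<dots> \<le> Liminf (at_left y) (\<lambda>z. ereal (B z \<gamma>))"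
        using H by blast
      finally show ?thesis
        using less_LiminfD by fastforce
    qed
    show "\<forall>\<^sub>F z in at_right y. B z \<gamma> < 0" if "B y \<gamma> < 0"
    proof -
      have "Limsup (at_right y) (\<lambda>z. ereal (B z \<gamma>)) \<le> ereal (B y \<gamma>)"
        using H by blast
      also have "\<dots> < ereal 0"
        using that by simp
      finally show ?thesis
        using Limsup_lessD by fastforce
    qed
  qed (use H2 sub in blast)
qed

theorem theorem4:
  fixes c d :: real
    and p q :: "real \<Rightarrow> real"
    and B1 B2 :: "real \<Rightarrow> (real \<Rightarrow> real) \<Rightarrow> real"
    and \<alpha> \<beta> :: "real \<Rightarrow> real"
  assumes cd: "0 < c" "c < d"
    and p_nonneg: "\<forall>x\<in>{c..d}. p x \<ge> 0"
    and q_nonneg: "\<forall>x\<in>{c..d}. q x \<ge> 0"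
    and p_bounded: "bounded (p ` {c..d})"
    and q_bounded: "bounded (q ` {c..d})"
    and p_meas: "p \<in> borel_measurable (lebesgue_on {c..d})"
    and q_meas: "q \<in> borel_measurable (lebesgue_on {c..d})"
    and lower: "PP_lower p q B1 B2 c d \<alpha>"
    and upper: "PP_upper p q B1 B2 c d \<beta>"
    and le: "\<forall>x\<in>{c..d}. \<alpha> x \<le> \<beta> x"
    and H1: "\<forall>\<gamma>\<in>order_interval c d \<alpha> \<beta>.
               \<forall>y\<in>{(INF x\<in>{c..d}. \<alpha> x)..(SUP x\<in>{c..d}. \<beta> x)}.
               \<forall>B\<in>{B1, B2}.
                 Liminf (at_left y) (\<lambda>z. ereal (B z \<gamma>)) \<ge> ereal (B y \<gamma>) \<and>
                 ereal (B y \<gamma>) \<ge> Limsup (at_right y) (\<lambda>z. ereal (B z \<gamma>))"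
    and H2: "\<forall>y\<in>{(INF x\<in>{c..d}. \<alpha> x)..(SUP x\<in>{c..d}. \<beta> x)}.
               \<forall>B\<in>{B1, B2}.
               \<forall>\<gamma>1\<in>order_interval c d \<alpha> \<beta>. \<forall>\<gamma>2\<in>order_interval c d \<alpha> \<beta>.
                 (\<forall>x\<in>{c..d}. \<gamma>1 x \<le> \<gamma>2 x) \<longrightarrow> B y \<gamma>1 \<ge> B y \<gamma>2"
  shows "\<exists>Vl Vu.
           PP_solution p q B1 B2 c d Vl \<and> Vl \<in> order_interval c d \<alpha> \<beta> \<and> convex_on {c..d} Vl \<and>
           PP_solution p q B1 B2 c d Vu \<and> Vu \<in> order_interval c d \<alpha> \<beta> \<and> convex_on {c..d} Vu \<and>
           (\<forall>V. PP_solution p q B1 B2 c d V \<and> V \<in> order_interval c d \<alpha> \<beta> \<longrightarrow>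
                (\<forall>x\<in>{c..d}. Vl x \<le> V x \<and> V x \<le> Vu x))"
proof -
  let ?f = "\<lambda>x y z. - Hfun p q x y z"
  let ?I = "order_interval c d \<alpha> \<beta>"
  obtain Q where Q: "\<And>x. x \<in> {c..d} \<Longrightarrow> \<bar>q x\<bar> \<le> Q"
    using q_bounded unfolding bounded_iff real_norm_def by blast
  define K where "K = sqrt (4 * d ^ 3 * Q * max 1 d) / (2 * c ^ 3)"
  have field: "hoelder_field c d K ?f"
    unfolding K_def
    by (rule hoelder_field_Hfun) (use cd p_nonneg q_nonneg p_meas q_meas Q in \<open>auto dest: abs_le_D1\<close>)
  have ac: "abs_cont_on {c..d} \<alpha>" "abs_cont_on {c..d} \<beta>"
    using lower upper by (auto simp: PP_lower_def PP_upper_def)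
  have touch: "touching_lower ?f c d \<alpha>" "touching_upper ?f c d \<beta>"
    using touching_lower_PP_lower[OF lower] touching_upper_PP_upper[OF upper] .
  have bf: "boundary_functional c d \<alpha> \<beta> c B1" "boundary_functional c d \<alpha> \<beta> d B2"
    using cd lower upper H1 H2 by (auto intro!: boundary_functionalI ac simp: PP_lower_def PP_upper_def)
  obtain Vu Vu' where Vu: "ode_solution ?f c d Vu Vu'" "Vu \<in> ?I" "B1 (Vu c) Vu = 0" "B2 (Vu d) Vu = 0"
    and Vu_greatest: "\<forall>V V'. ode_solution ?f c d V V' \<and> V \<in> ?I \<and> B1 (V c) V = 0 \<and> B2 (V d) V = 0 \<longrightarrow>
       (\<forall>x\<in>{c..d}. V x \<le> Vu x)"
    using hoelder_field.greatest_solution[OF field ac touch le[rule_format] bf] by blast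
  \<comment> \<open>The boundary functional as seen by \<open>- V\<close>. The negative of the
    greatest solution of the reflected problem is the least solution of the original one.\<close>
  let ?R = "\<lambda>B y \<gamma>. - B (- y) (\<lambda>x. - \<gamma> x) :: real"
  have "\<exists>U U'. ode_solution (reflect ?f) c d U U' \<and> U \<in> order_interval c d (\<lambda>x. - \<beta> x) (\<lambda>x. - \<alpha> x) \<and>
     ?R B1 (U c) U = 0 \<and> ?R B2 (U d) U = 0 \<and>
     (\<forall>V V'. ode_solution (reflect ?f) c d V V' \<and> V \<in> order_interval c d (\<lambda>x. - \<beta> x) (\<lambda>x. - \<alpha> x) \<and>
        ?R B1 (V c) V = 0 \<and> ?R B2 (V d) V = 0 \<longrightarrow> (\<forall>x\<in>{c..d}. V x \<le> U x))"
  proof (rule hoelder_field.greatest_solution[OF hoelder_field_reflect[OF field], where ?B1.0 = "?R B1" and ?B2.0 = "?R B2"])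
    show "touching_lower (reflect ?f) c d (\<lambda>x. - \<beta> x)"
      using touch(2) by (simp add: touching_upper_def)
    show "touching_upper (reflect ?f) c d (\<lambda>x. - \<alpha> x)"
      using touch(1) by (simp add: touching_upper_def)
  qed (use ac le bf in \<open>auto intro: abs_cont_on_uminus boundary_functional_reflect\<close>)
  then obtain U U' where U: "ode_solution (reflect ?f) c d U U'" "(\<lambda>x. - U x) \<in> ?I"
      "B1 (- U c) (\<lambda>x. - U x) = 0" "B2 (- U d) (\<lambda>x. - U x) = 0"
    and U_greatest: "\<forall>V V'. ode_solution (reflect ?f) c d V V' \<and> (\<lambda>x. - V x) \<in> ?I \<and>
       B1 (- V c) (\<lambda>x. - V x) = 0 \<and> B2 (- V d) (\<lambda>x. - V x) = 0 \<longrightarrow> (\<forall>x\<in>{c..d}. V x \<le> U x)"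
    unfolding order_interval_reflect neg_equal_0_iff_equal by blast
  define Vl where "Vl x = - U x" for x
  have Vl: "ode_solution ?f c d Vl (\<lambda>x. - U' x)" "Vl \<in> ?I" "B1 (Vl c) Vl = 0" "B2 (Vl d) Vl = 0"
    using ode_solution_reflect[OF U(1)] U(2-4) by (simp_all add: Vl_def[abs_def])
  have f_nonneg: "0 \<le> ?f x y z" if "x \<in> {c..d}" for x y z
    using Hfun_nonpos[of x p q y z] that cd p_nonneg q_nonneg by auto
  have "Vl x \<le> V x \<and> V x \<le> Vu x" if V: "PP_solution p q B1 B2 c d V" "V \<in> ?I" and x: "x \<in> {c..d}" for V x
  proof -
    obtain V' where V': "ode_solution ?f c d V V'" "B1 (V c) V = 0" "B2 (V d) V = 0"
      using V(1) unfolding PP_solution_iff by blast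
    have "- V x \<le> U x"
      using U_greatest[rule_format, OF conjI, OF ode_solution_reflect[OF V'(1)]] V' V(2) x by simp
    moreover have "V x \<le> Vu x"
      using Vu_greatest V' V(2) x by blast
    ultimately show ?thesis
      by (simp add: Vl_def)
  qed
  moreover have "PP_solution p q B1 B2 c d Vl" "PP_solution p q B1 B2 c d Vu"
    unfolding PP_solution_iff using Vl Vu by blast+
  moreover have "convex_on {c..d} Vl" "convex_on {c..d} Vu"
    using ode_solution_convex[OF Vl(1) f_nonneg] ode_solution_convex[OF Vu(1) f_nonneg] by auto
  ultimately show ?thesis
    using Vl(2) Vu(2) by blast
qed

end
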